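(* Let $P$ be a countable discrete right LCM monoid, let $\mathcal{H}$ be a separable Hilbert space, let $T:P\to\mathcal{B}(\mathcal{H})$ be a contractive representation, and let $S_1,S_2\in\mathcal{B}(\mathcal{H})$ be commuting contractions (no commutation with $T$ is required), so that $(S_1\times S_2)*T$ is a contractive representation of the free product $\mathbb{N}^2*P$ on $\mathcal{H}$. Suppose that for each $i=1,2$ the representation $S_i*T$ of $\mathbb{N}*P$ has a $*$-regular dilation. Then there exists an isometric dilation of $(S_1\times S_2)*T$ of the form $(V_1\times V_2)*W$; that is, there exist a Hilbert space $\mathcal{K}\supset\mathcal{H}$, commuting isometries $V_1,V_2\in\mathcal{B}(\mathcal{K})$, and an isometric representation $W:P\to\mathcal{B}(\mathcal{K})$ such that \[ P_{\mathcal{H}}\,\big((V_1\times V_2)*W\big)(x)\,|_{\mathcal{H}}=\big((S_1\times S_2)*T\big)(x)\quad\text{for all } x\in\mathbb{N}^2*P . \] Moreover, $V_1,V_2,W$ can be chosen so that, for both $i=1,2$, the representation $V_i*W$ of $\mathbb{N}*P$ is an isometric Nica-covariant co-extension of $S_i*T$.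
   Context: A right LCM monoid $P$ is a unital left-cancellative semigroup such that for all $p,q\in P$ the set $pP\cap qP$ is either empty or equal to $rP$ for some $r\in P$. If $r\in pP$, then $p^{-1}r$ denotes the unique element $s\in P$ with $ps=r$. Here $\mathbb{N}=\{0,1,2,\dots\}$ under addition; $Q*P$ denotes the free product of monoids, and if $P$ is right LCM then so are $\mathbb{N}*P$ and $\mathbb{N}^2*P$. For a right LCM monoid $P$: - A contractive representation is a unital monoid homomorphism $T:P\to\mathcal{B}(\mathcal{H})$ with $\|T(p)\|\le 1$ for all $p$. It is isometric if each $T(p)$ is an isometry. - An isometric representation $V$ is Nica-covariant if for all $p,q\in P$, $V(p)V(p)^*V(q)V(q)^*=V(r)V(r)^*$ when $pP\cap qP=rP$, and $V(p)V(p)^*V(q)V(q)^*=0$ when $pP\cap qP=\emptyset$. - An isometric dilation of $T:P\to\mathcal{B}(\mathcal{H})$ is an isometric representation $V:P\to\mathcal{B}(\mathcal{K})$ on a Hilbert space $\mathcal{K}\supset\mathcal{H}$ with $T(p)=P_{\mathcal{H}}V(p)|_{\mathcal{H}}$ for all $p\in P$, where $P_{\mathcal{H}}$ is the orthogonal projection onto $\mathcal{H}$. It is a co-extension of $T$ if $\mathcal{H}$ is invariant for $V(p)^*$ for all $p\in P$ (equivalently, $\mathcal{H}^\perp$ is invariant for $V$). An isometric Nica-covariant co-extension is a co-extension that is an isometric Nica-covariant representation. - An isometric dilation $V$ of $T$ is a $*$-regular dilation if for all $p,q\in P$, $P_{\mathcal{H}}V(p)^*V(q)|_{\mathcal{H}}=T(p^{-1}r)T(q^{-1}r)^*$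 when $pP\cap qP=rP$, and $P_{\mathcal{H}}V(p)^*V(q)|_{\mathcal{H}}=0$ when $pP\cap qP=\emptyset$. For an operator $S$, $S*T$ is the representation of $\mathbb{N}*P$ sending the generator of $\mathbb{N}$ to $S$ and each $p\in P$ to $T(p)$. For commuting operators $S_1,S_2$, $S_1\times S_2$ is the representation $(n,m)\mapsto S_1^nS_2^m$ of $\mathbb{N}^2$, and $(S_1\times S_2)*T$ is the representation of $\mathbb{N}^2*P$ restricting to $S_1\times S_2$ on $\mathbb{N}^2$ and to $T$ on $P$. The same notation is used for $V_1,V_2,W$. *)

theory Defs
  imports "HOL-Analysis.Analysis" "HOL-Algebra.Coset"
begin

section \<open>Complex inner product spaces\<close>

text \<open>
  The real structure (vector space, norm, metric, topology) is that of \<^class>\<open>real_inner\<close>;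
  the complex inner product is linear in its first argument.
\<close>

class complex_inner = real_inner +
  fixes scaleC :: "complex \<Rightarrow> 'a \<Rightarrow> 'a" (infixr "*\<^sub>C" 75)
    and cinner :: "'a \<Rightarrow> 'a \<Rightarrow> complex"
  assumes scaleC_add_right: "c *\<^sub>C (x + y) = c *\<^sub>C x + c *\<^sub>C y"
    and scaleC_add_left: "(c + d) *\<^sub>C x = c *\<^sub>C x + d *\<^sub>C x"
    and scaleC_scaleC: "c *\<^sub>C d *\<^sub>C x = (c * d) *\<^sub>C x"
    and scaleC_of_real: "complex_of_real r *\<^sub>C x = r *\<^sub>R x"
    and cinner_commute: "cinner x y = cnj (cinner y x)"
    and cinner_add_left: "cinner (x + y) z = cinner x z + cinner y z"
    and cinner_scaleC_left: "cinner (c *\<^sub>C x) y = c * cinner x y"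
    and Re_cinner: "Re (cinner x y) = inner x y"

text \<open>
  Hilbert spaces are complete complex subspaces of a complex inner product space.  For a type
  that is itself complete, \<^term>\<open>UNIV\<close> is one.
\<close>

definition hilbert_space :: "'a::complex_inner set \<Rightarrow> bool" where
  "hilbert_space H \<longleftrightarrow>
     0 \<in> H \<and> (\<forall>x\<in>H. \<forall>y\<in>H. x + y \<in> H) \<and> (\<forall>c. \<forall>x\<in>H. c *\<^sub>C x \<in> H) \<and> complete H"

definition separable_hilbert_space :: "'a::complex_inner set \<Rightarrow> bool" where
  "separable_hilbert_space H \<longleftrightarrow> hilbert_space H \<and> separable_space (top_of_set H)"

section \<open>Operators\<close>

text \<open>
  An operator from \<open>H\<close> to \<open>K\<close> is a function on the ambient types of which only the values on \<open>H\<close>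
  matter; identities between operators are therefore stated pointwise on \<open>H\<close>.
\<close>

definition bounded_operator ::
    "'a::complex_inner set \<Rightarrow> 'b::complex_inner set \<Rightarrow> ('a \<Rightarrow> 'b) \<Rightarrow> bool" where
  "bounded_operator H K A \<longleftrightarrow>
     (\<forall>x\<in>H. A x \<in> K) \<and>
     (\<forall>x\<in>H. \<forall>y\<in>H. A (x + y) = A x + A y) \<and>
     (\<forall>c. \<forall>x\<in>H. A (c *\<^sub>C x) = c *\<^sub>C A x) \<and>
     (\<exists>B. \<forall>x\<in>H. norm (A x) \<le> B * norm x)"

definition contraction ::
    "'a::complex_inner set \<Rightarrow> 'b::complex_inner set \<Rightarrow> ('a \<Rightarrow> 'b) \<Rightarrow> bool" where
  "contraction H K A \<longleftrightarrow> bounded_operator H K A \<and> (\<forall>x\<in>H. norm (A x) \<le> norm x)"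

definition linear_isometry ::
    "'a::complex_inner set \<Rightarrow> 'b::complex_inner set \<Rightarrow> ('a \<Rightarrow> 'b) \<Rightarrow> bool" where
  "linear_isometry H K A \<longleftrightarrow> bounded_operator H K A \<and> (\<forall>x\<in>H. norm (A x) = norm x)"

definition hilbert_adjoint :: "'a::complex_inner set \<Rightarrow> ('a \<Rightarrow> 'a) \<Rightarrow> 'a \<Rightarrow> 'a" where
  "hilbert_adjoint H A y = (THE z. z \<in> H \<and> (\<forall>x\<in>H. cinner (A x) y = cinner x z))"

definition orthogonal_projection :: "'a::complex_inner set \<Rightarrow> 'a \<Rightarrow> 'a" where
  "orthogonal_projection M x = (THE y. y \<in> M \<and> (\<forall>z\<in>M. cinner (x - y) z = 0))"

section \<open>Right LCM monoids and their representations\<close>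

text \<open>The principal right ideal of \<open>p\<close> is the left coset \<open>p <# carrier P\<close> of the library.\<close>

locale right_lcm_monoid = monoid P for P (structure) +
  assumes left_cancel:
    "\<lbrakk>p \<in> carrier P; q \<in> carrier P; r \<in> carrier P; p \<otimes> q = p \<otimes> r\<rbrakk> \<Longrightarrow> q = r"
  and right_lcm:
    "\<lbrakk>p \<in> carrier P; q \<in> carrier P\<rbrakk> \<Longrightarrow>
       (p <# carrier P) \<inter> (q <# carrier P) = {} \<or>
       (\<exists>r\<in>carrier P. (p <# carrier P) \<inter> (q <# carrier P) = r <# carrier P)"

text \<open>\<open>left_quotient P p r\<close> is $p^{-1}r$, meaningful for \<open>r \<in> p <# carrier P\<close>.\<close>

definition left_quotient :: "('p, 'm) monoid_scheme \<Rightarrow> 'p \<Rightarrow> 'p \<Rightarrow> 'p" where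
  "left_quotient P p r = (THE s. s \<in> carrier P \<and> p \<otimes>\<^bsub>P\<^esub> s = r)"

definition operator_rep ::
    "('p, 'm) monoid_scheme \<Rightarrow> 'a::complex_inner set \<Rightarrow> ('p \<Rightarrow> 'a \<Rightarrow> 'a) \<Rightarrow> bool" where
  "operator_rep P H T \<longleftrightarrow>
     (\<forall>p\<in>carrier P. bounded_operator H H (T p)) \<and>
     (\<forall>x\<in>H. T \<one>\<^bsub>P\<^esub> x = x) \<and>
     (\<forall>p\<in>carrier P. \<forall>q\<in>carrier P. \<forall>x\<in>H. T (p \<otimes>\<^bsub>P\<^esub> q) x = T p (T q x))"

definition contractive_rep ::
    "('p, 'm) monoid_scheme \<Rightarrow> 'a::complex_inner set \<Rightarrow> ('p \<Rightarrow> 'a \<Rightarrow> 'a) \<Rightarrow> bool" where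
  "contractive_rep P H T \<longleftrightarrow> operator_rep P H T \<and> (\<forall>p\<in>carrier P. contraction H H (T p))"

definition isometric_rep ::
    "('p, 'm) monoid_scheme \<Rightarrow> 'a::complex_inner set \<Rightarrow> ('p \<Rightarrow> 'a \<Rightarrow> 'a) \<Rightarrow> bool" where
  "isometric_rep P H V \<longleftrightarrow> operator_rep P H V \<and> (\<forall>p\<in>carrier P. linear_isometry H H (V p))"

definition nica_covariant ::
    "('p, 'm) monoid_scheme \<Rightarrow> 'a::complex_inner set \<Rightarrow> ('p \<Rightarrow> 'a \<Rightarrow> 'a) \<Rightarrow> bool" where
  "nica_covariant P K V \<longleftrightarrow>
     (\<forall>p\<in>carrier P. \<forall>q\<in>carrier P.
        (\<forall>r\<in>carrier P.
           (p <#\<^bsub>P\<^esub> carrier P) \<inter> (q <#\<^bsub>P\<^esub> carrier P) = r <#\<^bsub>P\<^esub> carrier P \<longrightarrow>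
           (\<forall>x\<in>K. V p (hilbert_adjoint K (V p) (V q (hilbert_adjoint K (V q) x))) =
                   V r (hilbert_adjoint K (V r) x))) \<and>
        ((p <#\<^bsub>P\<^esub> carrier P) \<inter> (q <#\<^bsub>P\<^esub> carrier P) = {} \<longrightarrow>
           (\<forall>x\<in>K. V p (hilbert_adjoint K (V p) (V q (hilbert_adjoint K (V q) x))) = 0)))"

section \<open>Dilations\<close>

text \<open>
  In the following, the inclusion of \<open>H\<close> into \<open>K\<close> is a linear isometry \<open>J\<close>, so that \<open>J ` H\<close> is
  the copy of \<open>H\<close> inside \<open>K\<close>.
\<close>

definition isometric_dilation ::
    "('p, 'm) monoid_scheme \<Rightarrow> 'a::complex_inner set \<Rightarrow> ('p \<Rightarrow> 'a \<Rightarrow> 'a) \<Rightarrow>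
     'b::complex_inner set \<Rightarrow> ('a \<Rightarrow> 'b) \<Rightarrow> ('p \<Rightarrow> 'b \<Rightarrow> 'b) \<Rightarrow> bool" where
  "isometric_dilation P H T K J V \<longleftrightarrow>
     hilbert_space K \<and> linear_isometry H K J \<and> isometric_rep P K V \<and>
     (\<forall>p\<in>carrier P. \<forall>h\<in>H. orthogonal_projection (J ` H) (V p (J h)) = J (T p h))"

definition co_extension ::
    "('p, 'm) monoid_scheme \<Rightarrow> 'a::complex_inner set \<Rightarrow> ('p \<Rightarrow> 'a \<Rightarrow> 'a) \<Rightarrow>
     'b::complex_inner set \<Rightarrow> ('a \<Rightarrow> 'b) \<Rightarrow> ('p \<Rightarrow> 'b \<Rightarrow> 'b) \<Rightarrow> bool" where
  "co_extension P H T K J V \<longleftrightarrow>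
     isometric_dilation P H T K J V \<and>
     (\<forall>p\<in>carrier P. \<forall>y\<in>J ` H. hilbert_adjoint K (V p) y \<in> J ` H)"

definition nica_covariant_co_extension ::
    "('p, 'm) monoid_scheme \<Rightarrow> 'a::complex_inner set \<Rightarrow> ('p \<Rightarrow> 'a \<Rightarrow> 'a) \<Rightarrow>
     'b::complex_inner set \<Rightarrow> ('a \<Rightarrow> 'b) \<Rightarrow> ('p \<Rightarrow> 'b \<Rightarrow> 'b) \<Rightarrow> bool" where
  "nica_covariant_co_extension P H T K J V \<longleftrightarrow>
     co_extension P H T K J V \<and> nica_covariant P K V"

definition star_regular_dilation ::
    "('p, 'm) monoid_scheme \<Rightarrow> 'a::complex_inner set \<Rightarrow> ('p \<Rightarrow> 'a \<Rightarrow> 'a) \<Rightarrow>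
     'b::complex_inner set \<Rightarrow> ('a \<Rightarrow> 'b) \<Rightarrow> ('p \<Rightarrow> 'b \<Rightarrow> 'b) \<Rightarrow> bool" where
  "star_regular_dilation P H T K J V \<longleftrightarrow>
     isometric_dilation P H T K J V \<and>
     (\<forall>p\<in>carrier P. \<forall>q\<in>carrier P.
        (\<forall>r\<in>carrier P.
           (p <#\<^bsub>P\<^esub> carrier P) \<inter> (q <#\<^bsub>P\<^esub> carrier P) = r <#\<^bsub>P\<^esub> carrier P \<longrightarrow>
           (\<forall>h\<in>H. orthogonal_projection (J ` H) (hilbert_adjoint K (V p) (V q (J h))) =
                   J (T (left_quotient P p r)
                        (hilbert_adjoint H (T (left_quotient P q r)) h)))) \<and>
        ((p <#\<^bsub>P\<^esub> carrier P) \<inter> (q <#\<^bsub>P\<^esub> carrier P) = {} \<longrightarrow>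
           (\<forall>h\<in>H. orthogonal_projection (J ` H) (hilbert_adjoint K (V p) (V q (J h))) = 0)))"

section \<open>Free products of monoids\<close>

text \<open>
  The free product is the monoid of words in the disjoint union of the two carriers modulo the
  congruence that deletes identities and multiplies adjacent letters from the same factor.
\<close>

definition free_words ::
    "('q, 'm) monoid_scheme \<Rightarrow> ('p, 'n) monoid_scheme \<Rightarrow> ('q + 'p) list set" where
  "free_words Q P = lists (carrier Q <+> carrier P)"

inductive free_product_step ::
    "('q, 'm) monoid_scheme \<Rightarrow> ('p, 'n) monoid_scheme \<Rightarrow>
     ('q + 'p) list \<Rightarrow> ('q + 'p) list \<Rightarrow> bool"
  for Q P where
  one_left: "\<lbrakk>u \<in> free_words Q P; v \<in> free_words Q P\<rbrakk> \<Longrightarrow>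
     free_product_step Q P (u @ [Inl \<one>\<^bsub>Q\<^esub>] @ v) (u @ v)"
| one_right: "\<lbrakk>u \<in> free_words Q P; v \<in> free_words Q P\<rbrakk> \<Longrightarrow>
     free_product_step Q P (u @ [Inr \<one>\<^bsub>P\<^esub>] @ v) (u @ v)"
| mult_left: "\<lbrakk>u \<in> free_words Q P; v \<in> free_words Q P; a \<in> carrier Q; b \<in> carrier Q\<rbrakk> \<Longrightarrow>
     free_product_step Q P (u @ [Inl a, Inl b] @ v) (u @ [Inl (a \<otimes>\<^bsub>Q\<^esub> b)] @ v)"
| mult_right: "\<lbrakk>u \<in> free_words Q P; v \<in> free_words Q P; p \<in> carrier P; q \<in> carrier P\<rbrakk> \<Longrightarrow>
     free_product_step Q P (u @ [Inr p, Inr q] @ v) (u @ [Inr (p \<otimes>\<^bsub>P\<^esub> q)] @ v)"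

definition free_product_rel ::
    "('q, 'm) monoid_scheme \<Rightarrow> ('p, 'n) monoid_scheme \<Rightarrow>
     (('q + 'p) list \<times> ('q + 'p) list) set" where
  "free_product_rel Q P =
     {(u, v). u \<in> free_words Q P \<and> v \<in> free_words Q P \<and> equivclp (free_product_step Q P) u v}"

definition free_product ::
    "('q, 'm) monoid_scheme \<Rightarrow> ('p, 'n) monoid_scheme \<Rightarrow> ('q + 'p) list set monoid" where
  "free_product Q P =
     \<lparr>carrier = free_words Q P // free_product_rel Q P,
      mult = (\<lambda>X Y. \<Union>u\<in>X. \<Union>v\<in>Y. free_product_rel Q P `` {u @ v}),
      one = free_product_rel Q P `` {[]}\<rparr>"

fun word_operator ::
    "('q \<Rightarrow> 'a \<Rightarrow> 'a) \<Rightarrow> ('p \<Rightarrow> 'a \<Rightarrow> 'a) \<Rightarrow> ('q + 'p) list \<Rightarrow> 'a \<Rightarrow> 'a" where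
  "word_operator R T [] = id"
| "word_operator R T (Inl q # w) = R q \<circ> word_operator R T w"
| "word_operator R T (Inr p # w) = T p \<circ> word_operator R T w"

text \<open>
  The representation \<open>R * T\<close> of the free product.  By the lemma \<open>free_product_rep_class\<close> below,
  the choice of a word in the class \<open>X\<close> does not matter on the Hilbert space on which \<open>R\<close> and \<open>T\<close>
  are representations.
\<close>

definition free_product_rep ::
    "('q \<Rightarrow> 'a \<Rightarrow> 'a) \<Rightarrow> ('p \<Rightarrow> 'a \<Rightarrow> 'a) \<Rightarrow> ('q + 'p) list set \<Rightarrow> 'a \<Rightarrow> 'a" where
  "free_product_rep R T X = word_operator R T (SOME w. w \<in> X)"

definition nat_monoid :: "nat monoid" where
  "nat_monoid = \<lparr>carrier = UNIV, mult = (+), one = 0\<rparr>"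

definition nat_rep :: "('a \<Rightarrow> 'a) \<Rightarrow> nat \<Rightarrow> 'a \<Rightarrow> 'a" where
  "nat_rep S n = S ^^ n"

definition nat2_rep :: "('a \<Rightarrow> 'a) \<Rightarrow> ('a \<Rightarrow> 'a) \<Rightarrow> nat \<times> nat \<Rightarrow> 'a \<Rightarrow> 'a" where
  "nat2_rep S1 S2 = (\<lambda>(n, m). (S1 ^^ n) \<circ> (S2 ^^ m))"

lemma word_operator_append:
  "word_operator R T (u @ v) = word_operator R T u \<circ> word_operator R T v"
  by (induction R T u rule: word_operator.induct) (auto simp: comp_assoc)

lemma word_operator_in_space:
  assumes "operator_rep Q H R" "operator_rep P H T" "w \<in> free_words Q P" "x \<in> H"
  shows "word_operator R T w x \<in> H"
  using assms
  by (induction R T w rule: word_operator.induct)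
     (auto simp: free_words_def operator_rep_def bounded_operator_def)

lemma word_operator_step:
  assumes "operator_rep Q H R" "operator_rep P H T" "free_product_step Q P u v" "x \<in> H"
  shows "word_operator R T u x = word_operator R T v x"
  using assms(3)
proof cases
  case (one_left u v)
  then have "word_operator R T v x \<in> H"
    using assms word_operator_in_space by blast
  then show ?thesis
    using one_left assms by (simp add: word_operator_append operator_rep_def)
next
  case (one_right u v)
  then have "word_operator R T v x \<in> H"
    using assms word_operator_in_space by blast
  then show ?thesis
    using one_right assms by (simp add: word_operator_append operator_rep_def)
next
  case (mult_left u v a b)
  then have "word_operator R T v x \<in> H"
    using assms word_operator_in_space by blast
  then show ?thesis
    using mult_left assms by (simp add: word_operator_append operator_rep_def)
next
  case (mult_right u v p q)
  then have "word_operator R T v x \<in> H"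
    using assms word_operator_in_space by blast
  then show ?thesis
    using mult_right assms by (simp add: word_operator_append operator_rep_def)
qed

lemma free_product_rep_class:
  assumes "operator_rep Q H R" "operator_rep P H T" "w \<in> free_words Q P" "x \<in> H"
  shows "free_product_rep R T (free_product_rel Q P `` {w}) x = word_operator R T w x"
proof -
  have *: "word_operator R T u x = word_operator R T v x"
    if "equivclp (free_product_step Q P) u v" for u v
    using that
  proof (induction rule: equivclp_induct)
    case base
    show ?case by simp
  next
    case (step v v')
    from step.hyps(2) have "word_operator R T v x = word_operator R T v' x"
      by (auto dest: word_operator_step[OF assms(1,2) _ assms(4)])
    with step.IH show ?case by simp
  qed
  have "w \<in> free_product_rel Q P `` {w}"
    using assms by (simp add: free_product_rel_def)
  then have "(SOME v. v \<in> free_product_rel Q P `` {w}) \<in> free_product_rel Q P `` {w}"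
    by (rule someI)
  moreover have "free_product_rel Q P `` {w} \<subseteq> Collect (equivclp (free_product_step Q P) w)"
    by (auto simp: free_product_rel_def)
  ultimately have "equivclp (free_product_step Q P) w (SOME v. v \<in> free_product_rel Q P `` {w})"
    by blast
  from *[OF this] show ?thesis
    by (simp add: free_product_rep_def)
qed

section \<open>The Hilbert space of square-summable complex sequences\<close>

text \<open>
  A type that hosts all separable Hilbert spaces: each is isometrically isomorphic to a closed
  subspace of \<open>ell2\<close>.
\<close>

typedef ell2 = "{f :: nat \<Rightarrow> complex. summable (\<lambda>n. (cmod (f n))\<^sup>2)}"
  morphisms ell2_nth Abs_ell2
  by (rule exI[of _ "\<lambda>_. 0"]) simp

lemma summable_ell2_nth: "summable (\<lambda>n. (cmod (ell2_nth x n))\<^sup>2)"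
  using ell2_nth[of x] by simp

lemma ell2_eqI: "(\<And>n. ell2_nth x n = ell2_nth y n) \<Longrightarrow> x = y"
  by (metis ext ell2_nth_inject)

lemma cmod_add_square_le: "(cmod (a + b))\<^sup>2 \<le> 2 * (cmod a)\<^sup>2 + 2 * (cmod b)\<^sup>2"
proof -
  have "(cmod (a + b))\<^sup>2 \<le> (cmod a + cmod b)\<^sup>2"
    by (intro power_mono norm_triangle_ineq) simp
  also have "\<dots> \<le> 2 * (cmod a)\<^sup>2 + 2 * (cmod b)\<^sup>2"
    using zero_le_power2[of "cmod a - cmod b"] by (simp add: power2_sum power2_diff)
  finally show ?thesis .
qed

lemma summable_ell2_add:
  "summable (\<lambda>n. (cmod (ell2_nth x n + ell2_nth y n))\<^sup>2)"
  by (rule summable_comparison_test'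
        [where g = "\<lambda>n. 2 * (cmod (ell2_nth x n))\<^sup>2 + 2 * (cmod (ell2_nth y n))\<^sup>2" and N = 0])
     (auto intro!: summable_add summable_mult summable_ell2_nth cmod_add_square_le)

lemma summable_ell2_scale: "summable (\<lambda>n. (cmod (c * ell2_nth x n))\<^sup>2)"
  by (auto simp: norm_mult power_mult_distrib intro!: summable_mult summable_ell2_nth)

lemma summable_ell2_inner: "summable (\<lambda>n. ell2_nth x n * cnj (ell2_nth y n))"
proof (rule summable_comparison_test'
    [where g = "\<lambda>n. (cmod (ell2_nth x n))\<^sup>2 + (cmod (ell2_nth y n))\<^sup>2" and N = 0])
  show "summable (\<lambda>n. (cmod (ell2_nth x n))\<^sup>2 + (cmod (ell2_nth y n))\<^sup>2)"
    by (intro summable_add summable_ell2_nth)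
  show "norm (ell2_nth x n * cnj (ell2_nth y n)) \<le> (cmod (ell2_nth x n))\<^sup>2 + (cmod (ell2_nth y n))\<^sup>2"
    for n
  proof -
    have "2 * (cmod (ell2_nth x n) * cmod (ell2_nth y n)) \<le>
        (cmod (ell2_nth x n))\<^sup>2 + (cmod (ell2_nth y n))\<^sup>2"
      using sum_squares_bound[of "cmod (ell2_nth x n)" "cmod (ell2_nth y n)"] by simp
    moreover have "0 \<le> cmod (ell2_nth x n) * cmod (ell2_nth y n)"
      by simp
    ultimately have "cmod (ell2_nth x n) * cmod (ell2_nth y n) \<le>
        (cmod (ell2_nth x n))\<^sup>2 + (cmod (ell2_nth y n))\<^sup>2"
      by linarith
    then show ?thesis
      by (simp add: norm_mult)
  qed
qed

instantiation ell2 :: complex_inner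
begin

definition "0 = Abs_ell2 (\<lambda>_. 0)"
definition "x + y = Abs_ell2 (\<lambda>n. ell2_nth x n + ell2_nth y n)"
definition "- x = Abs_ell2 (\<lambda>n. - ell2_nth x n)"
definition "x - y = (x + - y :: ell2)"
definition "scaleC c x = Abs_ell2 (\<lambda>n. c * ell2_nth x n)"
definition "scaleR r (x :: ell2) = scaleC (complex_of_real r) x"
definition "cinner x y = (\<Sum>n. ell2_nth x n * cnj (ell2_nth y n))"
definition "inner x (y :: ell2) = Re (cinner x y)"
definition "norm x = sqrt (inner x (x :: ell2))"
definition "sgn x = inverse (norm x) *\<^sub>R (x :: ell2)"
definition "dist x y = norm (x - y :: ell2)"
definition "uniformity = (INF e\<in>{0<..}. principal {(x, y :: ell2). dist x y < e})"
definition "open (U :: ell2 set) \<longleftrightarrow>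
  (\<forall>x\<in>U. eventually (\<lambda>(x', y). x' = x \<longrightarrow> y \<in> U) uniformity)"

lemma ell2_nth_zero [simp]: "ell2_nth 0 n = 0"
  by (simp add: zero_ell2_def Abs_ell2_inverse)

lemma ell2_nth_add [simp]: "ell2_nth (x + y) n = ell2_nth x n + ell2_nth y n"
  by (simp add: plus_ell2_def Abs_ell2_inverse summable_ell2_add)

lemma ell2_nth_minus [simp]: "ell2_nth (- x) n = - ell2_nth x n"
  by (simp add: uminus_ell2_def Abs_ell2_inverse summable_ell2_nth)

lemma ell2_nth_diff [simp]: "ell2_nth (x - y) n = ell2_nth x n - ell2_nth y n"
  by (simp add: minus_ell2_def)

lemma ell2_nth_scaleC [simp]: "ell2_nth (scaleC c x) n = c * ell2_nth x n"
  by (simp add: scaleC_ell2_def Abs_ell2_inverse summable_ell2_scale)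

lemma ell2_nth_scaleR [simp]: "ell2_nth (scaleR r x) n = complex_of_real r * ell2_nth x n"
  by (simp add: scaleR_ell2_def)

lemma inner_ell2_self: "inner x x = (\<Sum>n. (cmod (ell2_nth x n))\<^sup>2)"
proof -
  have "cinner x x = complex_of_real (\<Sum>n. (cmod (ell2_nth x n))\<^sup>2)"
    unfolding cinner_ell2_def
    using suminf_of_real[OF summable_ell2_nth[of x], where 'a = complex]
    by (simp add: complex_norm_square[symmetric])
  then show ?thesis
    by (simp add: inner_ell2_def)
qed

instance
proof
  fix x y z :: ell2 and a b :: real and c d :: complex
  show "x + y + z = x + (y + z)" "x + y = y + x" "0 + x = x" "- x + x = 0" "x - y = x + - y"
    "a *\<^sub>R (x + y) = a *\<^sub>R x + a *\<^sub>R y" "(a + b) *\<^sub>R x = a *\<^sub>R x + b *\<^sub>R x"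
    "a *\<^sub>R b *\<^sub>R x = (a * b) *\<^sub>R x" "1 *\<^sub>R x = x"
    "c *\<^sub>C (x + y) = c *\<^sub>C x + c *\<^sub>C y" "(c + d) *\<^sub>C x = c *\<^sub>C x + d *\<^sub>C x"
    "c *\<^sub>C d *\<^sub>C x = (c * d) *\<^sub>C x" "complex_of_real a *\<^sub>C x = a *\<^sub>R x"
    by (rule ell2_eqI; simp add: algebra_simps)+
  show "sgn x = inverse (norm x) *\<^sub>R x" "dist x y = norm (x - y)"
    "uniformity = (INF e\<in>{0<..}. principal {(x, y :: ell2). dist x y < e})"
    "norm x = sqrt (inner x x)" "Re (cinner x y) = inner x y"
    by (simp_all only: sgn_ell2_def dist_ell2_def uniformity_ell2_def norm_ell2_def inner_ell2_def)
  show "open U = (\<forall>x\<in>U. eventually (\<lambda>(x', y). x' = x \<longrightarrow> y \<in> U) uniformity)" for U :: "ell2 set"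
    by (simp only: open_ell2_def)
  show comm: "cinner x y = cnj (cinner y x)" for x y :: ell2
    using bounded_linear.suminf[OF bounded_linear_cnj summable_ell2_inner, of y x]
    by (simp add: cinner_ell2_def mult.commute)
  show add: "cinner (x + y) z = cinner x z + cinner y z"
    by (simp add: cinner_ell2_def distrib_right suminf_add[OF summable_ell2_inner summable_ell2_inner])
  show scale: "cinner (c *\<^sub>C x) y = c * cinner x y" for c
    by (simp add: cinner_ell2_def mult.assoc suminf_mult[OF summable_ell2_inner])
  show "inner x y = inner y x"
    by (simp add: inner_ell2_def comm[of x y])
  show "inner (x + y) z = inner x z + inner y z"
    by (simp add: inner_ell2_def add)
  show "inner (a *\<^sub>R x) y = a * inner x y"
    by (simp add: inner_ell2_def scaleR_ell2_def scale)
  show "0 \<le> inner x x"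
    by (simp add: inner_ell2_self suminf_nonneg summable_ell2_nth)
  show "inner x x = 0 \<longleftrightarrow> x = 0"
    by (auto simp: inner_ell2_self suminf_eq_zero_iff summable_ell2_nth intro: ell2_eqI)
qed

end

lemma norm_ell2_square: "(norm x)\<^sup>2 = (\<Sum>n. (cmod (ell2_nth x n))\<^sup>2)"
  by (metis inner_ell2_self power2_norm_eq_inner)

lemma sum_le_norm_ell2: "(\<Sum>n<N. (cmod (ell2_nth x n))\<^sup>2) \<le> (norm x)\<^sup>2"
  unfolding norm_ell2_square by (intro sum_le_suminf summable_ell2_nth) auto

lemma cmod_ell2_nth_le: "cmod (ell2_nth x n) \<le> norm x"
proof -
  have "(cmod (ell2_nth x n))\<^sup>2 \<le> (\<Sum>i<Suc n. (cmod (ell2_nth x i))\<^sup>2)"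
    by (rule member_le_sum) auto
  also have "\<dots> \<le> (norm x)\<^sup>2"
    by (rule sum_le_norm_ell2)
  finally show ?thesis
    by simp
qed

instance ell2 :: complete_space
proof
  fix X :: "nat \<Rightarrow> ell2"
  assume X: "Cauchy X"
  have "Cauchy (\<lambda>k. ell2_nth (X k) n)" for n
  proof (rule metric_CauchyI)
    fix e :: real assume "0 < e"
    then obtain M where M: "\<forall>k\<ge>M. \<forall>l\<ge>M. dist (X k) (X l) < e"
      using X by (meson metric_CauchyD)
    then show "\<exists>M. \<forall>k\<ge>M. \<forall>l\<ge>M. dist (ell2_nth (X k) n) (ell2_nth (X l) n) < e"
      by (metis cmod_ell2_nth_le dist_norm ell2_nth_diff order_le_less_trans)
  qed
  then have "\<forall>n. \<exists>l. (\<lambda>k. ell2_nth (X k) n) \<longlonglongrightarrow> l"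
    by (simp add: Cauchy_convergent_iff convergent_def)
  then obtain f where f: "\<And>n. (\<lambda>k. ell2_nth (X k) n) \<longlonglongrightarrow> f n"
    by metis
  have tail: "\<exists>M. \<forall>k\<ge>M. \<forall>N. (\<Sum>n<N. (cmod (ell2_nth (X k) n - f n))\<^sup>2) \<le> e\<^sup>2" if "0 < e" for e
  proof -
    obtain M where M: "\<forall>k\<ge>M. \<forall>l\<ge>M. dist (X k) (X l) < e"
      using X \<open>0 < e\<close> by (meson metric_CauchyD)
    have "(\<Sum>n<N. (cmod (ell2_nth (X k) n - f n))\<^sup>2) \<le> e\<^sup>2" if "k \<ge> M" for k N
    proof (rule LIMSEQ_le_const2)
      show "(\<lambda>l. \<Sum>n<N. (cmod (ell2_nth (X k) n - ell2_nth (X l) n))\<^sup>2)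
              \<longlonglongrightarrow> (\<Sum>n<N. (cmod (ell2_nth (X k) n - f n))\<^sup>2)"
        by (intro tendsto_intros f)
      have "(\<Sum>n<N. (cmod (ell2_nth (X k) n - ell2_nth (X l) n))\<^sup>2) \<le> e\<^sup>2" if "l \<ge> M" for l
      proof -
        have "(\<Sum>n<N. (cmod (ell2_nth (X k) n - ell2_nth (X l) n))\<^sup>2) \<le> (norm (X k - X l))\<^sup>2"
          using sum_le_norm_ell2[where N = N and x = "X k - X l"] by simp
        also have "\<dots> \<le> e\<^sup>2"
          using M \<open>k \<ge> M\<close> that by (intro power_mono) (auto simp: dist_norm less_imp_le)
        finally show ?thesis .
      qed
      then show "\<exists>L. \<forall>l\<ge>L. (\<Sum>n<N. (cmod (ell2_nth (X k) n - ell2_nth (X l) n))\<^sup>2) \<le> e\<^sup>2"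
        by blast
    qed
    then show ?thesis by blast
  qed
  have diff: "summable (\<lambda>n. (cmod (ell2_nth (X k) n - f n))\<^sup>2)"
    if "\<forall>N. (\<Sum>n<N. (cmod (ell2_nth (X k) n - f n))\<^sup>2) \<le> e" for k e
    using that by (intro bounded_imp_summable[where B = e]) (auto simp del: sum.lessThan_Suc
        simp: lessThan_Suc_atMost[symmetric])
  obtain M where "\<forall>N. (\<Sum>n<N. (cmod (ell2_nth (X M) n - f n))\<^sup>2) \<le> 1\<^sup>2"
    using tail[of 1] by auto
  then have "summable (\<lambda>n. (cmod (ell2_nth (X M) n - f n))\<^sup>2)"
    by (rule diff)
  then have d: "ell2_nth (Abs_ell2 (\<lambda>n. ell2_nth (X M) n - f n)) = (\<lambda>n. ell2_nth (X M) n - f n)"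
    by (simp add: Abs_ell2_inverse)
  define x where "x = X M - Abs_ell2 (\<lambda>n. ell2_nth (X M) n - f n)"
  have x: "ell2_nth x n = f n" for n
    by (simp add: x_def d)
  have "X \<longlonglongrightarrow> x"
  proof (rule metric_LIMSEQ_I)
    fix e :: real assume "0 < e"
    then obtain L where L: "\<forall>k\<ge>L. \<forall>N. (\<Sum>n<N. (cmod (ell2_nth (X k) n - f n))\<^sup>2) \<le> (e / 2)\<^sup>2"
      using tail[of "e / 2"] by auto
    have "dist (X k) x < e" if "k \<ge> L" for k
    proof -
      have "(norm (X k - x))\<^sup>2 \<le> (e / 2)\<^sup>2"
        unfolding norm_ell2_square using L that
        by (intro suminf_le_const summable_ell2_nth) (simp add: x)
      then have "norm (X k - x) \<le> e / 2"
        by (rule power2_le_imp_le) (use \<open>0 < e\<close> in simp)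
      then show ?thesis
        using \<open>0 < e\<close> by (simp add: dist_norm)
    qed
    then show "\<exists>L. \<forall>k\<ge>L. dist (X k) x < e"
      by blast
  qed
  then show "convergent X"
    by (auto simp: convergent_def)
qed

end

theory Submission
  imports Defs
begin

text \<open>
  On the minimal space of a \<open>*\<close>-regular dilation, the dilation is a Nica-covariant co-extension.
  The two given dilations contain the same minimal dilation space \<open>H\<^sub>0\<close> of \<open>T\<close>, and the compressions
  of the two isometries to \<open>H\<^sub>0\<close> are again commuting contractions that co-extend \<open>S1\<close> and \<open>S2\<close>:
  a vector in their ranges is determined by its projection to the original space.

  So it remains to dilate from \<open>H\<^sub>0\<close>, as in Ando's theorem.  Let \<open>X\<close> be the direct sum of the two
  given spaces, let \<open>D1, D2 : H\<^sub>0 \<rightarrow> X\<close> be the defect parts of the two isometries, and adjoin to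
  \<open>H\<^sub>0\<close> one copy of \<open>X\<close> for every word in \<open>P\<close>.  There \<open>W\<close> acts on the first letter, and both
  isometries prepend the letter \<open>1\<close>; they are \<open>S1 + D1\<close> and \<open>S2 + D2\<close> on \<open>H\<^sub>0\<close>.  The two
  products differ only in the vectors \<open>D1 S2 x + V D2 x\<close> and \<open>D2 S1 x + V D1 x\<close>.  Both families
  generate orthogonal reducing subspaces with the same Gram matrix, so exchanging these subspaces
  is a symmetry \<open>G\<close> that commutes with \<open>W\<close>, fixes \<open>H\<^sub>0\<close> and turns \<open>V1 V2\<close> into \<open>V2 V1\<close>.
  Then \<open>V1 G\<close> and \<open>G V2\<close> commute.
\<close>

section \<open>Closed subspaces of complex inner product spaces\<close>

text \<open>In Ando's theorem for one pair of contractions, any unitary matching the two defect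
  families serves. Here the matching operator \<open>G\<close> must also commute with
  \<open>W\<close>, since otherwise \<open>G V2\<close> could lose the relations behind
  Nica-covariance, and with the common action \<open>c\<close> of both products on the added
  summands. It therefore moves the closed span of all words in \<open>W\<close> and \<open>c\<close>
  applied to the two families, and inner products of arbitrary pairs of such words have to be
  controlled. This is where the free structure helps: words are compared letter by letter, and only
  pairs of one-letter words involve the defects. Their inner products are symmetric in the two
  indices exactly because the compressions commute. \<open>X\<close> is a direct sum so that the two
  defects and all their translates are mutually orthogonal; then the mixed terms vanish and the
  exchange is consistent. Invertible elements of \<open>P\<close> are the other obstacle. They
  generate the whole monoid as an ideal, so ideals cannot separate their translates, and
  orthogonality of these has to be carried along separately. Finally, \<open>G\<close> is its own
  inverse, so \<open>V1 G G V2\<close> is \<open>V1 V2\<close>, which equals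
  \<open>G V2 V1 G\<close>.\<close>

lemma cinner_add_right: "cinner x (y + z) = cinner x y + cinner x z"
  for x :: "'a::complex_inner"
  by (metis cinner_add_left cinner_commute complex_cnj_add)

lemma cinner_scaleC_right: "cinner x (c *\<^sub>C y) = cnj c * cinner x y"
  for x :: "'a::complex_inner"
  by (metis cinner_scaleC_left cinner_commute complex_cnj_mult)

lemma scaleC_one [simp]: "1 *\<^sub>C x = x"
  using scaleC_of_real[of 1 x] by simp

lemma scaleC_minus_one [simp]: "(- 1) *\<^sub>C x = - x"
  using scaleC_of_real[of "-1" x] by simp

lemma scaleC_zero_left [simp]: "0 *\<^sub>C x = 0"
  using scaleC_of_real[of 0 x] by simp

lemma scaleC_zero_right [simp]: "c *\<^sub>C 0 = 0"
  using scaleC_add_right[of c 0 0] by simp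

lemma cinner_zero_left [simp]: "cinner 0 x = 0"
  using cinner_scaleC_left[of 0 0 x] by simp

lemma cinner_zero_right [simp]: "cinner x 0 = 0"
  using cinner_scaleC_right[of x 0 0] by simp

lemma cinner_minus_left: "cinner (- x) y = - cinner x y"
  using cinner_scaleC_left[of "-1" x y] by simp

lemma cinner_minus_right: "cinner x (- y) = - cinner x y"
  using cinner_scaleC_right[of x "-1" y] by simp

lemma cinner_diff_left: "cinner (x - y) z = cinner x z - cinner y z"
  using cinner_add_left[of x "-y" z] by (simp add: cinner_minus_left)

lemma cinner_diff_right: "cinner x (y - z) = cinner x y - cinner x z"
  using cinner_add_right[of x y "-z"] by (simp add: cinner_minus_right)

lemmas cinner_simps = cinner_add_left cinner_add_right cinner_diff_left cinner_diff_right
  cinner_minus_left cinner_minus_right cinner_scaleC_left cinner_scaleC_right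

lemma cinner_self: "cinner x x = complex_of_real ((norm x)\<^sup>2)"
proof -
  have "Im (cinner x x) = 0"
    using cinner_commute[of x x] by (metis complex_cnj_cancel_iff equal_neg_zero cnj.simps(2))
  then show ?thesis
    by (simp add: complex_eq_iff Re_cinner power2_norm_eq_inner)
qed

lemma cinner_self_eq_zero [simp]: "cinner x x = 0 \<longleftrightarrow> x = 0"
  by (simp add: cinner_self)

text \<open>Lets continuity and polarization be quoted for the real inner product, since the
  imaginary part is again a real inner product with a rotated argument.\<close>

lemma cinner_conv_inner: "cinner x y = Complex (inner x y) (inner x (\<i> *\<^sub>C y))"
  by (simp add: complex_eq_iff Re_cinner[symmetric] cinner_simps)

lemma norm_scaleC: "norm (c *\<^sub>C x) = cmod c * norm x"
proof -
  have "complex_of_real ((norm (c *\<^sub>C x))\<^sup>2) = (c * cnj c) * complex_of_real ((norm x)\<^sup>2)"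
    unfolding cinner_self[symmetric] by (simp add: cinner_simps)
  also have "\<dots> = complex_of_real ((cmod c * norm x)\<^sup>2)"
    by (simp add: complex_norm_square[symmetric] power_mult_distrib)
  finally have "(norm (c *\<^sub>C x))\<^sup>2 = (cmod c * norm x)\<^sup>2"
    using of_real_eq_iff by blast
  then show ?thesis
    by (simp add: power2_eq_iff_nonneg)
qed

lemma scaleC_scaleR: "c *\<^sub>C (r *\<^sub>R x) = r *\<^sub>R (c *\<^sub>C x)"
  by (simp add: scaleC_of_real[symmetric] scaleC_scaleC mult.commute)

lemma bounded_linear_scaleC: "bounded_linear (\<lambda>x. c *\<^sub>C x)"
  by (rule bounded_linear_intro[where K = "cmod c"])
     (simp_all add: scaleC_add_right scaleC_scaleR norm_scaleC mult.commute)

lemma tendsto_cinner: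
  assumes "(f \<longlongrightarrow> a) F" "(g \<longlongrightarrow> b) F"
  shows "((\<lambda>x. cinner (f x) (g x)) \<longlongrightarrow> cinner a b) F"
  unfolding cinner_conv_inner
  by (intro tendsto_Complex tendsto_inner assms
      bounded_linear.tendsto[OF bounded_linear_scaleC])

lemma continuous_on_cinner:
  "\<lbrakk>continuous_on S f; continuous_on S g\<rbrakk> \<Longrightarrow> continuous_on S (\<lambda>x. cinner (f x) (g x))"
  unfolding continuous_on_def by (blast intro: tendsto_cinner)

lemma norm_cinner_le: "cmod (cinner x y) \<le> norm x * norm y"
proof (cases "cinner x y = 0")
  case False
  \<comment> \<open>A unimodular factor that rotates \<open>cinner x y\<close> onto the positive
    real axis, where the real Cauchy-Schwarz inequality applies.\<close>
  define c where "c = cnj (cinner x y) / cmod (cinner x y)"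
  have c: "cmod c = 1" "c * cinner x y = cmod (cinner x y)"
    using False by (simp_all add: c_def norm_divide complex_norm_square[symmetric] power2_eq_square mult.commute[of "cnj _"])
  have "cmod (cinner x y) = Re (cinner (c *\<^sub>C x) y)"
    using c by (simp add: cinner_simps)
  also have "\<dots> \<le> norm (c *\<^sub>C x) * norm y"
    by (simp add: Re_cinner norm_cauchy_schwarz)
  finally show ?thesis
    by (simp add: norm_scaleC c)
qed simp

definition csubspace :: "'a::complex_inner set \<Rightarrow> bool" where
  "csubspace S \<longleftrightarrow> 0 \<in> S \<and> (\<forall>x\<in>S. \<forall>y\<in>S. x + y \<in> S) \<and> (\<forall>c. \<forall>x\<in>S. c *\<^sub>C x \<in> S)"

lemma hilbert_space_iff: "hilbert_space H \<longleftrightarrow> csubspace H \<and> complete H"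
  by (auto simp: hilbert_space_def csubspace_def)

lemma hilbert_space_csubspace: "hilbert_space H \<Longrightarrow> csubspace H"
  and hilbert_space_closed: "hilbert_space H \<Longrightarrow> closed H"
  by (auto simp: hilbert_space_iff complete_imp_closed)

lemma csubspaceD:
  assumes "csubspace S"
  shows csubspace_0: "0 \<in> S" and csubspace_add: "x \<in> S \<Longrightarrow> y \<in> S \<Longrightarrow> x + y \<in> S"
    and csubspace_scale: "x \<in> S \<Longrightarrow> c *\<^sub>C x \<in> S"
  using assms by (auto simp: csubspace_def)

lemma csubspace_diff: "csubspace S \<Longrightarrow> x \<in> S \<Longrightarrow> y \<in> S \<Longrightarrow> x - y \<in> S"
  using csubspace_add[of S x "(-1) *\<^sub>C y"] csubspace_scale[of S y "-1"] by simp

lemma csubspace_subspace: "csubspace S \<Longrightarrow> subspace S"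
  unfolding subspace_def by (metis csubspaceD scaleC_of_real)

lemma hilbert_space_closed_subset:
  assumes "hilbert_space H" "csubspace S" "closed S" "S \<subseteq> H"
  shows "hilbert_space S"
  using assms complete_Int_closed[of H S] by (auto simp: hilbert_space_iff Int_absorb1)

text \<open>The closed linear span, taken as a hull: a property passes from generators to the span
  once the vectors having it form a closed subspace.\<close>

definition ccspan :: "'a::complex_inner set \<Rightarrow> 'a set" where
  "ccspan S = (\<lambda>M. csubspace M \<and> closed M) hull S"

lemma csubspace_ccspan: "csubspace (ccspan S)" and closed_ccspan: "closed (ccspan S)"
proof -
  have "csubspace (ccspan S) \<and> closed (ccspan S)"
    unfolding ccspan_def by (rule hull_in) (auto simp: csubspace_def)
  then show "csubspace (ccspan S)" "closed (ccspan S)" by auto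
qed

lemma ccspan_superset: "S \<subseteq> ccspan S"
  unfolding ccspan_def by (rule hull_subset)

lemma ccspan_base: "x \<in> S \<Longrightarrow> x \<in> ccspan S"
  using ccspan_superset by blast

lemma ccspan_minimal: "\<lbrakk>S \<subseteq> M; csubspace M; closed M\<rbrakk> \<Longrightarrow> ccspan S \<subseteq> M"
  unfolding ccspan_def by (rule hull_minimal) auto

lemma ccspan_mono: "S \<subseteq> T \<Longrightarrow> ccspan S \<subseteq> ccspan T"
  unfolding ccspan_def by (rule hull_mono)

lemma ccspan_subset_hilbert: "\<lbrakk>S \<subseteq> H; hilbert_space H\<rbrakk> \<Longrightarrow> ccspan S \<subseteq> H"
  by (rule ccspan_minimal) (auto simp: hilbert_space_csubspace hilbert_space_closed)

lemma hilbert_space_ccspan: "\<lbrakk>S \<subseteq> H; hilbert_space H\<rbrakk> \<Longrightarrow> hilbert_space (ccspan S)"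
  by (rule hilbert_space_closed_subset[of H])
     (auto simp: csubspace_ccspan closed_ccspan dest: ccspan_subset_hilbert)

lemma hilbert_space_UNIV_ell2: "hilbert_space (UNIV :: ell2 set)"
  by (simp add: hilbert_space_def complete_UNIV)

lemma ccspan_cinner_eq_right:
  assumes "x \<in> ccspan S" "\<And>s. s \<in> S \<Longrightarrow> cinner a s = cinner b s"
  shows "cinner a x = cinner b x"
proof -
  have "ccspan S \<subseteq> {x. cinner a x = cinner b x}"
  proof (rule ccspan_minimal)
    show "closed {x. cinner a x = cinner b x}"
      by (intro closed_Collect_eq continuous_on_cinner continuous_intros)
  qed (auto simp: csubspace_def cinner_simps assms)
  then show ?thesis using assms(1) by auto
qed

lemma ccspan_cinner_eq_left:
  assumes "x \<in> ccspan S" "\<And>s. s \<in> S \<Longrightarrow> cinner s a = cinner s b"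
  shows "cinner x a = cinner x b"
  using ccspan_cinner_eq_right[OF assms(1), of a b] assms(2)
  by (metis cinner_commute)

lemma ccspan_cinner_zero:
  assumes "x \<in> ccspan S" "\<And>s. s \<in> S \<Longrightarrow> cinner a s = 0"
  shows "cinner a x = 0"
  using ccspan_cinner_eq_right[OF assms(1), of a 0] assms(2) by simp

lemma ccspan_cinner_zero2:
  assumes "x \<in> ccspan S" "y \<in> ccspan S'" "\<And>s s'. s \<in> S \<Longrightarrow> s' \<in> S' \<Longrightarrow> cinner s s' = 0"
  shows "cinner x y = 0"
proof (rule ccspan_cinner_zero[OF assms(2)])
  fix s' assume "s' \<in> S'"
  then have "cinner s' x = 0"
    by (intro ccspan_cinner_zero[OF assms(1)]) (metis assms(3) cinner_commute complex_cnj_zero)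
  then show "cinner x s' = 0" by (metis cinner_commute complex_cnj_zero)
qed

lemma cinner_ext:
  assumes "csubspace M" "x \<in> M" "y \<in> M" "\<And>z. z \<in> M \<Longrightarrow> cinner z x = cinner z y"
  shows "x = y"
proof -
  have "cinner (x - y) (x - y) = 0"
    using assms(4)[OF csubspace_diff[OF assms(1-3)]] by (simp add: cinner_simps)
  then show ?thesis by simp
qed

lemma ccspan_ext:
  assumes "x \<in> ccspan S" "y \<in> ccspan S" "\<And>s. s \<in> S \<Longrightarrow> cinner s x = cinner s y"
  shows "x = y"
  using assms(1,2)
  by (rule cinner_ext[OF csubspace_ccspan]) (blast intro: ccspan_cinner_eq_left assms(3))

section \<open>Projections and adjoints\<close>

text \<open>A minimizing sequence is Cauchy by the parallelogram law, and at a nearest point no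
  multiple of \<open>z\<close> can reduce the distance, which forces orthogonality.\<close>

lemma projection_exists:
  fixes M :: "'a::complex_inner set"
  assumes M: "hilbert_space M"
  shows "\<exists>y\<in>M. \<forall>z\<in>M. cinner (x - y) z = 0"
proof -
  have sub: "csubspace M" and comp: "complete M"
    using M by (auto simp: hilbert_space_iff)
  have "0 \<in> M" using sub by (rule csubspace_0)
  define d where "d = (INF y\<in>M. norm (x - y))"
  have bdd: "bdd_below ((\<lambda>y. norm (x - y)) ` M)"
    by (rule bdd_belowI[of _ 0]) auto
  have d: "d \<le> norm (x - y)" if "y \<in> M" for y
    unfolding d_def by (rule cINF_lower[OF bdd that])
  have d0: "0 \<le> d"
    unfolding d_def by (rule cINF_greatest) (use \<open>0 \<in> M\<close> in auto)
  have "\<exists>y\<in>M. norm (x - y) < d + 1 / Suc n" for n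
    using cINF_less_iff[of M "\<lambda>y. norm (x - y)" "d + 1 / Suc n"] bdd \<open>0 \<in> M\<close>
    by (auto simp: d_def)
  then obtain y where y: "\<And>n. y n \<in> M" "\<And>n. norm (x - y n) < d + 1 / Suc n"
    by metis
  have half: "(1/2) *\<^sub>R (a + b) \<in> M" if "a \<in> M" "b \<in> M" for a b
    using that sub by (metis csubspace_add csubspace_scale scaleC_of_real)
  \<comment> \<open>Parallelogram law for \<open>x - a\<close> and \<open>x - b\<close>; the
    midpoint of \<open>a\<close> and \<open>b\<close> lies in \<open>M\<close>, hence at distance at
    least \<open>d\<close> from \<open>x\<close>.\<close>
  have para: "(norm (a - b))\<^sup>2 \<le> 2 * (norm (x - a))\<^sup>2 + 2 * (norm (x - b))\<^sup>2 - 4 * d\<^sup>2"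
    if "a \<in> M" "b \<in> M" for a b
  proof -
    have "d\<^sup>2 \<le> (norm (x - (1/2) *\<^sub>R (a + b)))\<^sup>2"
      by (intro power_mono d half that d0)
    also have "\<dots> = (norm ((1/2) *\<^sub>R ((x - a) + (x - b))))\<^sup>2"
      by (rule arg_cong[where f = "\<lambda>u. (norm u)\<^sup>2"]) (simp add: algebra_simps flip: scaleR_add_left)
    also have "\<dots> = (norm ((x - a) + (x - b)))\<^sup>2 / 4"
      by (simp add: power2_eq_square)
    finally have "4 * d\<^sup>2 \<le> (norm ((x - a) + (x - b)))\<^sup>2" by simp
    moreover have "(norm ((x - a) + (x - b)))\<^sup>2 + (norm ((x - b) - (x - a)))\<^sup>2 =
        2 * (norm (x - a))\<^sup>2 + 2 * (norm (x - b))\<^sup>2"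
      by (simp add: power2_norm_eq_inner inner_add_left inner_add_right inner_diff_left
          inner_diff_right inner_commute)
    ultimately show ?thesis by simp
  qed
  have "Cauchy y"
  proof (rule metric_CauchyI)
    fix e :: real assume "0 < e"
    have "(\<lambda>n. 4 * (d + 1 / Suc n)\<^sup>2 - 4 * d\<^sup>2) \<longlonglongrightarrow> 4 * (d + 0)\<^sup>2 - 4 * d\<^sup>2"
      by (intro tendsto_intros LIMSEQ_Suc[OF lim_1_over_n])
    then have "(\<lambda>n. 4 * (d + 1 / Suc n)\<^sup>2 - 4 * d\<^sup>2) \<longlonglongrightarrow> 0" by simp
    then have "eventually (\<lambda>n. 4 * (d + 1 / Suc n)\<^sup>2 - 4 * d\<^sup>2 < e\<^sup>2) sequentially"
      by (rule order_tendstoD) (use \<open>0 < e\<close> in simp)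
    then obtain N where N: "4 * (d + 1 / Suc N)\<^sup>2 - 4 * d\<^sup>2 < e\<^sup>2"
      by (auto simp: eventually_sequentially)
    have near: "(norm (x - y n))\<^sup>2 \<le> (d + 1 / Suc N)\<^sup>2" if "n \<ge> N" for n
    proof (intro power_mono)
      have "1 / Suc n \<le> 1 / Suc N" using that by (simp add: field_simps)
      then show "norm (x - y n) \<le> d + 1 / Suc N" using y(2)[of n] by linarith
    qed simp
    have "dist (y m) (y n) < e" if "m \<ge> N" "n \<ge> N" for m n
    proof -
      have "(norm (y m - y n))\<^sup>2 < e\<^sup>2"
        using para[OF y(1) y(1), of m n] near[OF that(1)] near[OF that(2)] N by linarith
      then show ?thesis
        using \<open>0 < e\<close> by (simp add: dist_norm power2_less_imp_less)
    qed
    then show "\<exists>N. \<forall>m\<ge>N. \<forall>n\<ge>N. dist (y m) (y n) < e" by blast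
  qed
  then obtain l where l: "l \<in> M" "y \<longlonglongrightarrow> l"
    using comp y(1) by (auto simp: complete_def)
  have "norm (x - l) \<le> d"
  proof (rule LIMSEQ_le)
    show "(\<lambda>n. norm (x - y n)) \<longlonglongrightarrow> norm (x - l)"
      by (intro tendsto_intros l)
    have "(\<lambda>n. d + 1 / Suc n) \<longlonglongrightarrow> d + 0"
      by (intro tendsto_intros LIMSEQ_Suc[OF lim_1_over_n])
    then show "(\<lambda>n. d + 1 / Suc n) \<longlonglongrightarrow> d" by simp
    show "\<exists>N. \<forall>n\<ge>N. norm (x - y n) \<le> d + 1 / Suc n"
      using y(2) less_imp_le by blast
  qed
  have "cinner (x - l) z = 0" if "z \<in> M" for z
  proof (cases "z = 0")
    case False
    \<comment> \<open>The coefficient of the projection of \<open>x - l\<close> onto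
      \<open>z\<close>; subtracting this multiple lowers the squared norm by exactly the quantity
      that has to vanish.\<close>
    define c where "c = cinner (x - l) z / (norm z)\<^sup>2"
    have "l + c *\<^sub>C z \<in> M"
      using l(1) that sub by (simp add: csubspaceD)
    then have "norm (x - l) \<le> norm ((x - l) - c *\<^sub>C z)"
      using d[of "l + c *\<^sub>C z"] \<open>norm (x - l) \<le> d\<close> by (simp add: algebra_simps)
    then have "(norm (x - l))\<^sup>2 \<le> (norm ((x - l) - c *\<^sub>C z))\<^sup>2"
      by (intro power_mono) auto
    moreover have "complex_of_real ((norm ((x - l) - c *\<^sub>C z))\<^sup>2) =
        complex_of_real ((norm (x - l))\<^sup>2 - (cmod (cinner (x - l) z))\<^sup>2 / (norm z)\<^sup>2)"
    proof -
      have zx: "cinner z (x - l) = cnj (cinner (x - l) z)"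
        by (rule cinner_commute)
      have "complex_of_real ((norm ((x - l) - c *\<^sub>C z))\<^sup>2) =
          cinner (x - l) (x - l) - cnj c * cinner (x - l) z - c * cinner z (x - l)
            + c * cnj c * cinner z z"
        unfolding cinner_self[symmetric] cinner_diff_left[of "x - l"] cinner_diff_right[of _ "x - l"]
        by (simp add: cinner_scaleC_left cinner_scaleC_right)
      also have "\<dots> = cinner (x - l) (x - l) - cinner (x - l) z * cnj (cinner (x - l) z) / (norm z)\<^sup>2"
        using False unfolding zx cinner_self[of z] c_def
        by (simp add: field_simps power2_eq_square)
      finally show ?thesis
        by (simp add: cinner_self complex_norm_square of_real_power[symmetric] del: of_real_power)
    qed
    then have "(norm ((x - l) - c *\<^sub>C z))\<^sup>2 =
        (norm (x - l))\<^sup>2 - (cmod (cinner (x - l) z))\<^sup>2 / (norm z)\<^sup>2"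
      using of_real_eq_iff by blast
    ultimately have "(cmod (cinner (x - l) z))\<^sup>2 / (norm z)\<^sup>2 \<le> 0" by simp
    then show ?thesis
      using False by (simp add: divide_le_0_iff)
  qed simp
  then show ?thesis using l(1) by blast
qed

lemma orthogonal_projection_unique:
  assumes "csubspace M" "y \<in> M" "\<And>z. z \<in> M \<Longrightarrow> cinner (x - y) z = 0"
  shows "orthogonal_projection M x = y"
  unfolding orthogonal_projection_def
proof (rule the_equality)
  fix y' assume y': "y' \<in> M \<and> (\<forall>z\<in>M. cinner (x - y') z = 0)"
  have "cinner (y - y') (y - y') = 0"
    using assms(3)[OF csubspace_diff[OF assms(1,2)], of y'] y'
      csubspace_diff[OF assms(1,2), of y']
    by (smt (verit) cinner_diff_left diff_add_cancel diff_diff_eq2 right_minus_eq)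
  then show "y' = y" by simp
qed (use assms in auto)

lemma orthogonal_projection:
  assumes "hilbert_space M"
  shows orthogonal_projection_in: "orthogonal_projection M x \<in> M"
    and orthogonal_projection_orth: "z \<in> M \<Longrightarrow> cinner (x - orthogonal_projection M x) z = 0"
    and orthogonal_projection_cinner: "z \<in> M \<Longrightarrow> cinner (orthogonal_projection M x) z = cinner x z"
proof -
  obtain y where "y \<in> M" "\<And>z. z \<in> M \<Longrightarrow> cinner (x - y) z = 0"
    using projection_exists[OF assms, of x] by blast
  moreover from this have "orthogonal_projection M x = y"
    by (intro orthogonal_projection_unique hilbert_space_csubspace assms)
  ultimately show "orthogonal_projection M x \<in> M"
    "z \<in> M \<Longrightarrow> cinner (x - orthogonal_projection M x) z = 0"
    "z \<in> M \<Longrightarrow> cinner (orthogonal_projection M x) z = cinner x z"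
    by (auto simp: cinner_diff_left)
qed

section \<open>Bounded operators on closed subspaces and closed spans\<close>

lemma bounded_operatorD:
  assumes "bounded_operator H K A"
  shows bounded_operator_in: "x \<in> H \<Longrightarrow> A x \<in> K"
    and bounded_operator_add: "x \<in> H \<Longrightarrow> y \<in> H \<Longrightarrow> A (x + y) = A x + A y"
    and bounded_operator_scale: "x \<in> H \<Longrightarrow> A (c *\<^sub>C x) = c *\<^sub>C A x"
    and bounded_operator_bound: "\<exists>B\<ge>0. \<forall>x\<in>H. norm (A x) \<le> B * norm x"
proof -
  obtain B where B: "\<forall>x\<in>H. norm (A x) \<le> B * norm x"
    using assms by (auto simp: bounded_operator_def)
  then have "\<forall>x\<in>H. norm (A x) \<le> max B 0 * norm x"
    by (meson max.cobounded1 mult_right_mono norm_ge_zero order_trans)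
  then show "\<exists>B\<ge>0. \<forall>x\<in>H. norm (A x) \<le> B * norm x"
    by (intro exI[of _ "max B 0"]) simp
qed (use assms in \<open>auto simp: bounded_operator_def\<close>)

lemma bounded_operator_zero: "bounded_operator H K A \<Longrightarrow> 0 \<in> H \<Longrightarrow> A 0 = 0"
  using bounded_operator_scale[of H K A 0 0] by simp

lemma bounded_operator_diff:
  assumes "bounded_operator H K A" "csubspace H" "x \<in> H" "y \<in> H"
  shows "A (x - y) = A x - A y"
  using bounded_operator_add[OF assms(1), of "x - y" y] csubspace_diff[OF assms(2)] assms(3,4)
  by simp

lemma bounded_operator_continuous:
  assumes "bounded_operator H K A" "csubspace H"
  shows "continuous_on H A"
proof -
  obtain B where B: "B \<ge> 0" "\<forall>x\<in>H. norm (A x) \<le> B * norm x"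
    using bounded_operator_bound[OF assms(1)] by blast
  have "B-lipschitz_on H A"
    by (rule lipschitz_onI)
       (auto simp: dist_norm B csubspace_diff[OF assms(2)] simp flip: bounded_operator_diff[OF assms])
  then show ?thesis by (rule lipschitz_on_continuous_on)
qed

lemma bounded_operator_subset:
  "\<lbrakk>bounded_operator H K A; H' \<subseteq> H; \<And>x. x \<in> H' \<Longrightarrow> A x \<in> K'\<rbrakk> \<Longrightarrow> bounded_operator H' K' A"
  unfolding bounded_operator_def by (meson subsetD)

lemma bounded_operator_comp:
  assumes "bounded_operator H K A" "bounded_operator K L B"
  shows "bounded_operator H L (\<lambda>x. B (A x))"
proof -
  obtain C D where "C \<ge> 0" "\<forall>x\<in>H. norm (A x) \<le> C * norm x" "D \<ge> 0" "\<forall>x\<in>K. norm (B x) \<le> D * norm x"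
    using bounded_operator_bound[OF assms(1)] bounded_operator_bound[OF assms(2)] by auto
  then have "norm (B (A x)) \<le> (D * C) * norm x" if "x \<in> H" for x
    by (metis assms(1) bounded_operator_in mult.assoc mult_left_mono order_trans that)
  then show ?thesis
    unfolding bounded_operator_def
    by (intro conjI exI[of _ "D * C"])
       (simp_all add: bounded_operatorD[OF assms(1)] bounded_operatorD[OF assms(2)])
qed

text \<open>The vectors on which two continuous linear maps agree form a closed subspace.\<close>

lemma bounded_operator_eq_on_ccspan:
  assumes "bounded_operator M K A" "bounded_operator M K' B" "hilbert_space M"
    and "S \<subseteq> M" "\<And>s. s \<in> S \<Longrightarrow> A s = B s" "x \<in> ccspan S"
  shows "A x = B x"
proof -
  have M: "csubspace M" "closed M"
    using assms(3) by (auto simp: hilbert_space_csubspace hilbert_space_closed)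
  have "ccspan S \<subseteq> {x \<in> M. A x - B x = 0}"
  proof (rule ccspan_minimal)
    show "csubspace {x \<in> M. A x - B x = 0}"
      using M(1) bounded_operatorD[OF assms(1)] bounded_operatorD[OF assms(2)]
        bounded_operator_zero[OF assms(1)] bounded_operator_zero[OF assms(2)]
      by (auto simp: csubspace_def)
    show "closed {x \<in> M. A x - B x = 0}"
      by (intro continuous_closed_preimage_constant continuous_on_diff M(2)
          bounded_operator_continuous[OF assms(1) M(1)] bounded_operator_continuous[OF assms(2) M(1)])
  qed (use assms(4,5) in auto)
  with assms(6) show ?thesis by auto
qed

lemma bounded_operator_ccspan_in:
  assumes "bounded_operator M K A" "hilbert_space M" "S \<subseteq> M"
    and "csubspace N" "closed N" "\<And>s. s \<in> S \<Longrightarrow> A s \<in> N" "x \<in> ccspan S"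
  shows "A x \<in> N"
proof -
  have M: "csubspace M" "closed M"
    using assms(2) by (auto simp: hilbert_space_csubspace hilbert_space_closed)
  have "ccspan S \<subseteq> M \<inter> A -` N"
  proof (rule ccspan_minimal)
    show "csubspace (M \<inter> A -` N)"
      using M(1) assms(4) bounded_operatorD[OF assms(1)] bounded_operator_zero[OF assms(1)]
      by (auto simp: csubspace_def)
    show "closed (M \<inter> A -` N)"
      by (rule continuous_closed_preimage[OF bounded_operator_continuous[OF assms(1) M(1)] M(2) assms(5)])
  qed (use assms(3,6) in auto)
  with assms(7) show ?thesis by auto
qed

text \<open>For nonzero \<open>f\<close>, let \<open>e\<close> be the component of some
  \<open>x0\<close> orthogonal to the kernel. Each \<open>x\<close> differs from a multiple of
  \<open>e\<close> by a kernel vector, so pairing with \<open>e\<close> determines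
  \<open>f x\<close>.\<close>

lemma riesz:
  fixes f :: "'a::complex_inner \<Rightarrow> complex"
  assumes H: "hilbert_space H"
    and add: "\<And>x y. x \<in> H \<Longrightarrow> y \<in> H \<Longrightarrow> f (x + y) = f x + f y"
    and scale: "\<And>c x. x \<in> H \<Longrightarrow> f (c *\<^sub>C x) = c * f x"
    and bound: "\<And>x. x \<in> H \<Longrightarrow> cmod (f x) \<le> B * norm x"
  shows "\<exists>z\<in>H. \<forall>x\<in>H. f x = cinner x z"
proof (cases "\<forall>x\<in>H. f x = 0")
  case True
  then show ?thesis
    by (intro bexI[of _ 0]) (auto simp: csubspace_0 hilbert_space_csubspace H)
next
  case False
  then obtain x0 where x0: "x0 \<in> H" "f x0 \<noteq> 0" by blast
  have sub: "csubspace H" "closed H"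
    using H by (auto simp: hilbert_space_csubspace hilbert_space_closed)
  have diff: "f (x - y) = f x - f y" if "x \<in> H" "y \<in> H" for x y
    using add[of "x - y" y] that csubspace_diff[OF sub(1)] by simp
  have f0: "f 0 = 0"
    using scale[of 0 0] csubspace_0[OF sub(1)] by simp
  have "\<bar>B\<bar>-lipschitz_on H f"
  proof (rule lipschitz_onI)
    fix x y assume "x \<in> H" "y \<in> H"
    then have "cmod (f x - f y) \<le> B * norm (x - y)"
      using bound[of "x - y"] diff csubspace_diff[OF sub(1)] by metis
    also have "\<dots> \<le> \<bar>B\<bar> * norm (x - y)"
      by (intro mult_right_mono) auto
    finally show "dist (f x) (f y) \<le> \<bar>B\<bar> * dist x y" by (simp add: dist_norm)
  qed simp
  then have "continuous_on H f" by (rule lipschitz_on_continuous_on)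
  then have "closed {x \<in> H. f x = 0}"
    using sub(2) by (rule continuous_closed_preimage_constant)
  then have N: "hilbert_space {x \<in> H. f x = 0}"
    by (intro hilbert_space_closed_subset[OF H])
       (use sub(1) in \<open>auto simp: csubspace_def add scale f0\<close>)
  obtain n where n: "n \<in> H" "f n = 0" "\<And>z. z \<in> H \<Longrightarrow> f z = 0 \<Longrightarrow> cinner (x0 - n) z = 0"
    using projection_exists[OF N, of x0] by auto
  define e where "e = x0 - n"
  have e: "e \<in> H" "f e \<noteq> 0"
    using x0 n csubspace_diff[OF sub(1)] by (auto simp: e_def diff)
  then have "e \<noteq> 0" using f0 by auto
  have "f x = cinner x (cnj (f e / (norm e)\<^sup>2) *\<^sub>C e)" if "x \<in> H" for x
  proof -
    have "x - (f x / f e) *\<^sub>C e \<in> H" "f (x - (f x / f e) *\<^sub>C e) = 0"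
      using that e csubspace_diff[OF sub(1)] csubspace_scale[OF sub(1)]
      by (auto simp: diff scale)
    then have "cinner e (x - (f x / f e) *\<^sub>C e) = 0"
      using n(3) by (auto simp: e_def)
    then have "cinner (x - (f x / f e) *\<^sub>C e) e = 0"
      by (metis cinner_commute complex_cnj_zero)
    then have "cinner x e = f x / f e * (norm e)\<^sup>2"
      by (simp add: cinner_simps cinner_self)
    then show ?thesis
      using e \<open>e \<noteq> 0\<close> by (simp add: cinner_simps)
  qed
  then show ?thesis
    using csubspace_scale[OF sub(1) e(1)] by blast
qed

text \<open>The formula of \<open>hilbert_adjoint\<close> with different types for source and
  target, so that embeddings have adjoints too. The adjoint of an isometric embedding is the
  orthogonal projection onto its image, read back in the source.\<close>

definition adjt :: "'a::complex_inner set \<Rightarrow> ('a \<Rightarrow> 'b::complex_inner) \<Rightarrow> 'b \<Rightarrow> 'a" where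
  "adjt H A y = (THE z. z \<in> H \<and> (\<forall>x\<in>H. cinner (A x) y = cinner x z))"

lemma hilbert_adjoint_adjt: "hilbert_adjoint H A = adjt H A"
  by (simp add: fun_eq_iff hilbert_adjoint_def adjt_def)

lemma adjt_unique:
  assumes "csubspace H" "z \<in> H" "\<And>x. x \<in> H \<Longrightarrow> cinner (A x) y = cinner x z"
  shows "adjt H A y = z"
  unfolding adjt_def
proof (rule the_equality)
  fix z' assume "z' \<in> H \<and> (\<forall>x\<in>H. cinner (A x) y = cinner x z')"
  then show "z' = z"
    using assms by (intro cinner_ext[OF assms(1)]) auto
qed (use assms in auto)

lemma adjt:
  assumes H: "hilbert_space H" and A: "bounded_operator H K A"
  shows adjt_in: "adjt H A y \<in> H"
    and adjt_cinner: "x \<in> H \<Longrightarrow> cinner (A x) y = cinner x (adjt H A y)"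
    and adjt_cinner': "x \<in> H \<Longrightarrow> cinner y (A x) = cinner (adjt H A y) x"
proof -
  obtain B where B: "B \<ge> 0" "\<forall>x\<in>H. norm (A x) \<le> B * norm x"
    using bounded_operator_bound[OF A] by blast
  have "\<exists>z\<in>H. \<forall>x\<in>H. cinner (A x) y = cinner x z"
  proof (rule riesz[OF H])
    fix x assume "x \<in> H"
    have "cmod (cinner (A x) y) \<le> norm (A x) * norm y" by (rule norm_cinner_le)
    also have "\<dots> \<le> (B * norm x) * norm y"
      using B \<open>x \<in> H\<close> by (intro mult_right_mono) auto
    finally show "cmod (cinner (A x) y) \<le> (B * norm y) * norm x" by (simp add: mult_ac)
  qed (auto simp: bounded_operatorD[OF A] cinner_simps)
  then obtain z where z: "z \<in> H" "\<And>x. x \<in> H \<Longrightarrow> cinner (A x) y = cinner x z" by blast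
  then have "adjt H A y = z"
    by (intro adjt_unique hilbert_space_csubspace H)
  with z show "adjt H A y \<in> H" "x \<in> H \<Longrightarrow> cinner (A x) y = cinner x (adjt H A y)" by auto
  with z show "x \<in> H \<Longrightarrow> cinner y (A x) = cinner (adjt H A y) x"
    by (metis cinner_commute)
qed

lemma bounded_operator_adjt:
  assumes H: "hilbert_space H" and A: "bounded_operator H K A"
  shows "bounded_operator UNIV H (adjt H A)"
proof -
  obtain B where B: "B \<ge> 0" "\<forall>x\<in>H. norm (A x) \<le> B * norm x"
    using bounded_operator_bound[OF A] by blast
  have "norm (adjt H A y) \<le> B * norm y" for y
  proof (cases "adjt H A y = 0")
    case False
    have "(norm (adjt H A y))\<^sup>2 = cmod (cinner (adjt H A y) (adjt H A y))"
      by (simp add: cinner_self norm_power)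
    also have "\<dots> = cmod (cinner (A (adjt H A y)) y)"
      using adjt_cinner[OF assms adjt_in[OF assms]] by simp
    also have "\<dots> \<le> norm (A (adjt H A y)) * norm y" by (rule norm_cinner_le)
    also have "\<dots> \<le> B * norm (adjt H A y) * norm y"
      by (intro mult_right_mono B(2)[rule_format] adjt_in[OF assms]) simp
    finally show ?thesis
      using False by (simp add: power2_eq_square mult.commute mult.left_commute)
  qed (use B in simp)
  moreover have "adjt H A (x + y) = adjt H A x + adjt H A y" for x y
    by (rule adjt_unique)
       (auto simp: hilbert_space_csubspace H csubspace_add adjt[OF assms] cinner_simps)
  moreover have "adjt H A (c *\<^sub>C x) = c *\<^sub>C adjt H A x" for c x
    by (rule adjt_unique)
       (auto simp: hilbert_space_csubspace H csubspace_scale adjt[OF assms] cinner_simps)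
  ultimately show ?thesis
    unfolding bounded_operator_def by (auto simp: adjt_in[OF assms])
qed

lemma adjt_comp:
  assumes "hilbert_space H" "hilbert_space K" "bounded_operator H K A" "bounded_operator K L B"
  shows "adjt H (\<lambda>x. B (A x)) y = adjt H A (adjt K B y)"
  by (rule adjt_unique)
     (use assms in \<open>auto simp: hilbert_space_csubspace adjt_in adjt_cinner bounded_operator_in\<close>)

lemma adjt_cong: "(\<And>x. x \<in> H \<Longrightarrow> A x = B x) \<Longrightarrow> adjt H A = adjt H B"
  by (rule ext) (simp add: adjt_def cong: conj_cong ball_cong)

section \<open>Linear isometries\<close>

lemma linear_isometry_bounded: "linear_isometry H K A \<Longrightarrow> bounded_operator H K A"
  by (simp add: linear_isometry_def)

text \<open>Polarization: additivity and preserved norms give the real inner product, and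
  multiplying \<open>y\<close> by the imaginary unit gives the imaginary part.\<close>

lemma linear_isometry_cinner:
  assumes "linear_isometry H K A" "csubspace H" "x \<in> H" "y \<in> H"
  shows "cinner (A x) (A y) = cinner x y"
proof -
  have re: "inner (A x) (A y) = inner x y" if "x \<in> H" "y \<in> H" for x y
  proof -
    have "norm (A x + A y) = norm (x + y)" "norm (A x) = norm x" "norm (A y) = norm y"
      using assms(1) that csubspace_add[OF assms(2) that]
      by (auto simp: linear_isometry_def bounded_operator_def simp flip: bounded_operator_add)
    moreover have "(norm (u + v))\<^sup>2 = (norm u)\<^sup>2 + (norm v)\<^sup>2 + 2 * inner u v" for u v :: "'c::real_inner"
      by (simp add: power2_norm_eq_inner inner_add_left inner_add_right inner_commute)
    ultimately show ?thesis
      by (metis add_left_cancel mult_left_cancel zero_neq_numeral)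
  qed
  show ?thesis
    unfolding cinner_conv_inner using re[OF assms(3,4)] re[OF assms(3) csubspace_scale[OF assms(2,4)]]
      bounded_operator_scale[OF linear_isometry_bounded[OF assms(1)] assms(4)] by simp
qed

lemma linear_isometryI:
  assumes "\<And>x. x \<in> H \<Longrightarrow> A x \<in> K"
    and "\<And>x y. x \<in> H \<Longrightarrow> y \<in> H \<Longrightarrow> A (x + y) = A x + A y"
    and "\<And>c x. x \<in> H \<Longrightarrow> A (c *\<^sub>C x) = c *\<^sub>C A x"
    and "\<And>x. x \<in> H \<Longrightarrow> norm (A x) = norm x"
  shows "linear_isometry H K A"
  unfolding linear_isometry_def bounded_operator_def
  using assms by (auto intro!: exI[of _ 1])

lemma norm_eq_of_cinner_eq: "cinner x x = cinner y y \<Longrightarrow> norm x = norm y"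
  by (metis cinner_self of_real_eq_iff norm_ge_zero power2_eq_iff_nonneg)

text \<open>Linearity is forced: the squared norm of \<open>A (x + y) - (A x + A y)\<close> expands
  into preserved inner products that cancel, and likewise for scalars.\<close>

lemma linear_isometry_of_cinner:
  fixes A :: "'a::complex_inner \<Rightarrow> 'b::complex_inner"
  assumes "csubspace H" "\<And>x. x \<in> H \<Longrightarrow> A x \<in> K"
    and eq: "\<And>x y. x \<in> H \<Longrightarrow> y \<in> H \<Longrightarrow> cinner (A x) (A y) = cinner x y"
  shows "linear_isometry H K A"
proof (rule linear_isometryI)
  show "norm (A x) = norm x" if "x \<in> H" for x
    by (rule norm_eq_of_cinner_eq) (simp add: eq that)
  show "A (x + y) = A x + A y" if "x \<in> H" "y \<in> H" for x y
  proof -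
    have "cinner (A (x + y) - (A x + A y)) (A (x + y) - (A x + A y)) = 0"
      using that csubspace_add[OF assms(1) that] by (simp add: cinner_simps eq)
    then show ?thesis by simp
  qed
  show "A (c *\<^sub>C x) = c *\<^sub>C A x" if "x \<in> H" for c x
  proof -
    have "cinner (A (c *\<^sub>C x) - c *\<^sub>C A x) (A (c *\<^sub>C x) - c *\<^sub>C A x) = 0"
      using that csubspace_scale[OF assms(1) that] by (simp add: cinner_simps eq)
    then show ?thesis by simp
  qed
qed (use assms in auto)

lemma linear_isometry_comp:
  "\<lbrakk>linear_isometry H K A; linear_isometry K L B\<rbrakk> \<Longrightarrow> linear_isometry H L (\<lambda>x. B (A x))"
  unfolding linear_isometry_def by (auto intro: bounded_operator_comp simp: bounded_operator_in)

lemma linear_isometry_hilbert_image: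
  assumes "linear_isometry H K A" "hilbert_space H"
  shows "hilbert_space (A ` H)"
proof -
  have H: "csubspace H" and A: "bounded_operator H K A"
    using assms by (auto simp: hilbert_space_csubspace linear_isometry_bounded)
  have "csubspace (A ` H)"
    unfolding csubspace_def
  proof (intro conjI ballI allI)
    show "0 \<in> A ` H"
      using bounded_operator_zero[OF A] csubspace_0[OF H] by force
    show "x + y \<in> A ` H" if "x \<in> A ` H" "y \<in> A ` H" for x y
    proof -
      obtain u v where "u \<in> H" "v \<in> H" "x = A u" "y = A v" using \<open>x \<in> A ` H\<close> \<open>y \<in> A ` H\<close> by blast
      then show ?thesis
        using csubspace_add[OF H] bounded_operator_add[OF A] by (intro image_eqI[of _ _ "u + v"]) simp_all
    qed
    show "c *\<^sub>C x \<in> A ` H" if "x \<in> A ` H" for c x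
    proof -
      obtain u where "u \<in> H" "x = A u" using \<open>x \<in> A ` H\<close> by blast
      then show ?thesis
        using csubspace_scale[OF H] bounded_operator_scale[OF A] by (intro image_eqI[of _ _ "c *\<^sub>C u"]) simp_all
    qed
  qed
  moreover have "complete (A ` H)"
    unfolding complete_def
  proof (intro allI impI, elim conjE)
    fix f assume f: "\<forall>n::nat. f n \<in> A ` H" "Cauchy f"
    define g where "g n = (SOME h. h \<in> H \<and> f n = A h)" for n
    have g: "g n \<in> H" "f n = A (g n)" for n
      using someI_ex[of "\<lambda>h. h \<in> H \<and> f n = A h"] f(1) unfolding g_def by blast+
    have "dist (f m) (f n) = dist (g m) (g n)" for m n
    proof -
      have "norm (A (g m - g n)) = norm (g m - g n)"
        using assms(1) csubspace_diff[OF H g(1) g(1)] by (auto simp: linear_isometry_def)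
      then show ?thesis
        using bounded_operator_diff[OF A H g(1) g(1), of m n] by (simp add: dist_norm g(2)[symmetric])
    qed
    then have "Cauchy g"
      using f(2) by (simp add: Cauchy_def)
    then obtain l where l: "l \<in> H" "g \<longlonglongrightarrow> l"
      using assms(2) g(1) by (auto simp: hilbert_space_iff complete_def)
    have "(\<lambda>n. A (g n)) \<longlonglongrightarrow> A l"
      by (rule continuous_on_tendsto_compose[OF bounded_operator_continuous[OF A H] l(2,1)])
         (simp add: g)
    moreover have "f = (\<lambda>n. A (g n))" using g(2) by (simp add: fun_eq_iff)
    ultimately show "\<exists>l\<in>A ` H. f \<longlonglongrightarrow> l"
      using l(1) by auto
  qed
  ultimately show ?thesis by (simp add: hilbert_space_iff)
qed

section \<open>Families of vectors with the same Gram matrix\<close>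

text \<open>The direct sum serves twice: it contains the graphs of isometries, and it is the
  coefficient space that holds both defect parts.\<close>

instantiation prod :: (complex_inner, complex_inner) complex_inner
begin

definition "scaleC c x = (c *\<^sub>C fst x, c *\<^sub>C snd x)"
definition "cinner x y = cinner (fst x) (fst y) + cinner (snd x) (snd y)"

instance
proof
  fix x y z :: "'a \<times> 'b" and c d :: complex and r :: real
  show "c *\<^sub>C (x + y) = c *\<^sub>C x + c *\<^sub>C y" "(c + d) *\<^sub>C x = c *\<^sub>C x + d *\<^sub>C x"
    "c *\<^sub>C d *\<^sub>C x = (c * d) *\<^sub>C x" "complex_of_real r *\<^sub>C x = r *\<^sub>R x"
    by (auto simp: scaleC_prod_def prod_eq_iff scaleC_add_right scaleC_add_left scaleC_scaleC scaleC_of_real)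
  show "cinner x y = cnj (cinner y x)"
    by (simp add: cinner_prod_def cinner_commute[of "fst x"] cinner_commute[of "snd x"])
  show "cinner (x + y) z = cinner x z + cinner y z" "cinner (c *\<^sub>C x) y = c * cinner x y"
    by (simp_all add: cinner_prod_def scaleC_prod_def cinner_simps distrib_left)
  show "Re (cinner x y) = inner x y"
    by (simp add: cinner_prod_def inner_prod_def Re_cinner)
qed

end

lemma fst_scaleC [simp]: "fst (c *\<^sub>C x) = c *\<^sub>C fst x"
  and snd_scaleC [simp]: "snd (c *\<^sub>C x) = c *\<^sub>C snd x"
  by (simp_all add: scaleC_prod_def)

lemma hilbert_space_Times:
  assumes "hilbert_space H" "hilbert_space K"
  shows "hilbert_space (H \<times> K)"
proof -
  have "complete (H \<times> K)"
    unfolding complete_def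
  proof (intro allI impI, elim conjE)
    fix f assume f: "\<forall>n::nat. f n \<in> H \<times> K" "Cauchy f"
    have "Cauchy (\<lambda>n. fst (f n))" "Cauchy (\<lambda>n. snd (f n))"
      using f(2) by (auto simp: Cauchy_fst Cauchy_snd)
    then obtain a b where "a \<in> H" "(\<lambda>n. fst (f n)) \<longlonglongrightarrow> a" "b \<in> K" "(\<lambda>n. snd (f n)) \<longlonglongrightarrow> b"
      using f(1) assms unfolding hilbert_space_iff complete_def mem_Times_iff
      by (metis (no_types, lifting))
    then show "\<exists>l\<in>H \<times> K. f \<longlonglongrightarrow> l"
      using tendsto_Pair[of "\<lambda>n. fst (f n)" a sequentially "\<lambda>n. snd (f n)" b]
      by (intro bexI[of _ "(a, b)"]) auto
  qed
  then show ?thesis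
    using assms by (auto simp: hilbert_space_iff csubspace_def mem_Times_iff)
qed

text \<open>A map that scales norms by a constant on the span has a complete, hence closed, image;
  so forming the closed span commutes with it.\<close>

lemma ccspan_image:
  fixes f :: "'a::complex_inner \<Rightarrow> 'b::complex_inner"
  assumes f: "bounded_linear f" and scale: "\<And>c x. f (c *\<^sub>C x) = c *\<^sub>C f x"
    and hilbert: "hilbert_space (ccspan S)" and c: "0 < c"
    and norm: "\<And>x. x \<in> ccspan S \<Longrightarrow> norm x = c * norm (f x)"
  shows "f ` ccspan S = ccspan (f ` S)"
proof
  have lin: "f 0 = 0" "f (x + y) = f x + f y" for x y
    using bounded_linear.linear[OF f] by (simp_all add: linear_0 linear_add)
  have "csubspace (f ` ccspan S)"
    unfolding csubspace_def
  proof (intro conjI ballI allI)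
    show "0 \<in> f ` ccspan S"
      using lin(1) csubspace_0[OF csubspace_ccspan, of S] by (metis image_eqI)
    fix x assume "x \<in> f ` ccspan S"
    then obtain u where u: "u \<in> ccspan S" "x = f u" by blast
    then show "c *\<^sub>C x \<in> f ` ccspan S" for c
      using csubspace_scale[OF csubspace_ccspan u(1)] by (auto simp flip: scale)
    fix y assume "y \<in> f ` ccspan S"
    then show "x + y \<in> f ` ccspan S"
      using csubspace_add[OF csubspace_ccspan u(1)] u(2) by (auto simp flip: lin(2))
  qed
  moreover have "complete (f ` ccspan S)"
    using hilbert c
    by (intro complete_isometric_image[of "1 / c"] csubspace_subspace csubspace_ccspan f)
       (auto simp: hilbert_space_iff norm)
  ultimately show "ccspan (f ` S) \<subseteq> f ` ccspan S"
    by (intro ccspan_minimal complete_imp_closed image_mono ccspan_superset)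
  have "ccspan S \<subseteq> f -` ccspan (f ` S)"
  proof (rule ccspan_minimal)
    show "csubspace (f -` ccspan (f ` S))"
      using csubspaceD[OF csubspace_ccspan] by (auto simp: csubspace_def lin scale)
    show "closed (f -` ccspan (f ` S))"
      using closed_vimage[OF closed_ccspan] linear_continuous_on[OF f] by blast
  qed (auto intro: ccspan_base[OF imageI])
  then show "f ` ccspan S \<subseteq> ccspan (f ` S)" by blast
qed

text \<open>The isometry is read off its graph, the closed span of the pairs \<open>(X i, Y i)\<close>.\<close>

theorem gram_isometry:
  fixes X :: "'i \<Rightarrow> 'a::complex_inner" and Y :: "'i \<Rightarrow> 'b::complex_inner"
  assumes H: "hilbert_space H" "\<And>i. i \<in> I \<Longrightarrow> X i \<in> H"
    and K: "hilbert_space K" "\<And>i. i \<in> I \<Longrightarrow> Y i \<in> K"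
    and gram: "\<And>i j. i \<in> I \<Longrightarrow> j \<in> I \<Longrightarrow> cinner (X i) (X j) = cinner (Y i) (Y j)"
  obtains A where "linear_isometry (ccspan (X ` I)) (ccspan (Y ` I)) A"
    and "\<And>i. i \<in> I \<Longrightarrow> A (X i) = Y i" and "A ` ccspan (X ` I) = ccspan (Y ` I)"
proof -
  define g where "g = ccspan ((\<lambda>i. (X i, Y i)) ` I)"
  have sub: "(\<lambda>i. (X i, Y i)) ` I \<subseteq> H \<times> K"
    using H(2) K(2) by auto
  have g: "hilbert_space g"
    unfolding g_def by (rule hilbert_space_ccspan[OF sub hilbert_space_Times[OF H(1) K(1)]])
  have gen: "(X i, Y i) \<in> g" if "i \<in> I" for i
    unfolding g_def using that by (intro ccspan_base) auto
  have eq: "cinner (fst u) (fst v) = cinner (snd u) (snd v)" if "u \<in> g" "v \<in> g" for u v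
  proof -
    \<comment> \<open>The sign turns equality of the two coordinate pairings into orthogonality to
      \<open>(fst u, - snd u)\<close>, which passes to the closed span; it is applied in one
      argument and then in the other.\<close>
    have *: "cinner (fst u, - snd u) v = cinner (0 :: 'a \<times> 'b) v"
      if "v \<in> ccspan ((\<lambda>i. (X i, Y i)) ` I)" "\<And>i. i \<in> I \<Longrightarrow> cinner (fst u) (X i) = cinner (snd u) (Y i)"
      for u v
      using that(1)
    proof (rule ccspan_cinner_eq_right)
      show "cinner (fst u, - snd u) s = cinner 0 s" if "s \<in> (\<lambda>i. (X i, Y i)) ` I" for s
        using that that(1) \<open>\<And>i. i \<in> I \<Longrightarrow> cinner (fst u) (X i) = cinner (snd u) (Y i)\<close>
        by (auto simp: cinner_prod_def cinner_simps)
    qed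
    have 1: "cinner (X i) (fst v) = cinner (Y i) (snd v)" if "i \<in> I" "v \<in> g" for i v
      using *[of v "(X i, Y i)"] that gram by (simp add: g_def cinner_prod_def cinner_simps)
    have "cinner (fst u) (X i) = cinner (snd u) (Y i)" if "i \<in> I" for i
      using 1[OF that \<open>u \<in> g\<close>] by (metis cinner_commute)
    then show ?thesis
      using *[of v u] \<open>v \<in> g\<close> by (simp add: g_def cinner_prod_def cinner_simps)
  qed
  \<comment> \<open>The two coordinates of a point of the graph have equal norms, so each projection
    scales norms by a fixed factor. This makes the images closed and the graph
    single-valued.\<close>
  have norm_fst: "norm u = sqrt 2 * norm (fst u)" and norm_snd: "norm u = sqrt 2 * norm (snd u)"
    if "u \<in> g" for u
  proof -
    have "norm (fst u) = norm (snd u)"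
      using eq[OF that that] by (rule norm_eq_of_cinner_eq)
    moreover have "(norm u)\<^sup>2 = (norm (fst u))\<^sup>2 + (norm (snd u))\<^sup>2"
      by (simp add: norm_prod_def)
    ultimately have "(norm u)\<^sup>2 = (sqrt 2 * norm (fst u))\<^sup>2" "(norm u)\<^sup>2 = (sqrt 2 * norm (snd u))\<^sup>2"
      by (simp_all add: power_mult_distrib)
    then show "norm u = sqrt 2 * norm (fst u)" "norm u = sqrt 2 * norm (snd u)"
      by (simp_all add: power2_eq_iff_nonneg)
  qed
  have gsub: "csubspace g" using g by (rule hilbert_space_csubspace)
  have fst_g: "fst ` g = ccspan (X ` I)"
    unfolding g_def
    by (subst ccspan_image[of fst _ "sqrt 2"])
       (use g norm_fst bounded_linear_fst in \<open>auto simp: g_def image_image\<close>)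
  have snd_g: "snd ` g = ccspan (Y ` I)"
    unfolding g_def
    by (subst ccspan_image[of snd _ "sqrt 2"])
       (use g norm_snd bounded_linear_snd in \<open>auto simp: g_def image_image\<close>)
  have uniq: "snd u = snd v" if "u \<in> g" "v \<in> g" "fst u = fst v" for u v
  proof -
    have "norm (u - v) = sqrt 2 * norm (fst (u - v))"
      using csubspace_diff[OF gsub that(1,2)] by (rule norm_fst)
    then have "norm (u - v) = 0" using that(3) by simp
    then show ?thesis by simp
  qed
  define A where "A x = snd (SOME u. u \<in> g \<and> fst u = x)" for x
  have A: "A (fst u) = snd u" if "u \<in> g" for u
  proof -
    have "(SOME v. v \<in> g \<and> fst v = fst u) \<in> g \<and> fst (SOME v. v \<in> g \<and> fst v = fst u) = fst u"
      by (rule someI[of _ u]) (simp add: that)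
    then show ?thesis unfolding A_def using uniq that by blast
  qed
  show ?thesis
  proof (rule that)
    show "linear_isometry (ccspan (X ` I)) (ccspan (Y ` I)) A"
    proof (rule linear_isometry_of_cinner[OF csubspace_ccspan])
      show "A x \<in> ccspan (Y ` I)" if "x \<in> ccspan (X ` I)" for x
        using that A snd_g unfolding fst_g[symmetric] by force
      show "cinner (A x) (A y) = cinner x y" if "x \<in> ccspan (X ` I)" "y \<in> ccspan (X ` I)" for x y
        using that A eq unfolding fst_g[symmetric] by force
    qed
    show "A (X i) = Y i" if "i \<in> I" for i
      using A[OF gen[OF that]] by simp
    show "A ` ccspan (X ` I) = ccspan (Y ` I)"
      unfolding fst_g[symmetric] snd_g[symmetric] using A by (force simp: image_iff)
  qed
qed

section \<open>Embeddings into \<open>ell2\<close>\<close>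

lemma cinner_sum_left: "cinner (\<Sum>i\<in>A. f i) y = (\<Sum>i\<in>A. cinner (f i) y)"
  by (induction A rule: infinite_finite_induct) (auto simp: cinner_simps)

text \<open>Since \<open>sgn 0 = 0\<close>, a vector that depends on its predecessors contributes the zero vector.\<close>

function gram_schmidt :: "(nat \<Rightarrow> 'a::complex_inner) \<Rightarrow> nat \<Rightarrow> 'a" where
  "gram_schmidt X n =
     sgn (X n - (\<Sum>k\<in>{..<n}. cinner (X n) (gram_schmidt X k) *\<^sub>C gram_schmidt X k))"
  by auto
termination
  by (relation "Wellfounded.measure snd") auto

declare gram_schmidt.simps [simp del]

lemma gram_schmidt_orth: "m < n \<Longrightarrow> cinner (gram_schmidt X n) (gram_schmidt X m) = 0"
proof (induction n arbitrary: m rule: less_induct)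
  case (less n)
  let ?e = "gram_schmidt X"
  define r where "r = X n - (\<Sum>k<n. cinner (X n) (?e k) *\<^sub>C ?e k)"
  have orth: "cinner (?e k) (?e m) = 0" if "k < n" "k \<noteq> m" for k
  proof (cases "m < k")
    case False
    then have "cinner (?e m) (?e k) = 0"
      using less that by simp
    then show ?thesis by (metis cinner_commute complex_cnj_zero)
  qed (use less that in auto)
  \<comment> \<open>Covers both values of \<open>sgn\<close>: either the vector has norm one, or it
    is zero and then \<open>c\<close> is zero as well.\<close>
  have idem: "c * cinner (?e m) (?e m) = c" if "c = cinner (X n) (?e m)" for c
  proof (cases "?e m = 0")
    case False
    then have "norm (?e m) = 1"
      unfolding gram_schmidt.simps[of X m] by (auto simp: norm_sgn)
    then show ?thesis by (simp add: cinner_self)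
  qed (simp add: that)
  have "cinner r (?e m) = cinner (X n) (?e m) - (\<Sum>k<n. cinner (X n) (?e k) * cinner (?e k) (?e m))"
    by (simp add: r_def cinner_simps cinner_sum_left)
  also have "(\<Sum>k<n. cinner (X n) (?e k) * cinner (?e k) (?e m)) =
      (\<Sum>k\<in>{m}. cinner (X n) (?e k) * cinner (?e k) (?e m))"
    using less.prems by (intro sum.mono_neutral_right) (auto simp: orth)
  finally have "cinner r (?e m) = 0" by (simp add: idem)
  moreover have "?e n = complex_of_real (inverse (norm r)) *\<^sub>C r"
    unfolding gram_schmidt.simps[of X n] r_def[symmetric] scaleC_of_real by (rule sgn_div_norm)
  ultimately show ?case by (simp add: cinner_simps)
qed

text \<open>The residual \<open>r\<close> is its norm times its normalization, also for
  \<open>r = 0\<close>; so nothing is lost where the system degenerates.\<close>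

lemma gram_schmidt_expand:
  "X n = (\<Sum>k\<le>n. cinner (X n) (gram_schmidt X k) *\<^sub>C gram_schmidt X k)"
proof -
  let ?e = "gram_schmidt X"
  define s where "s = (\<Sum>k<n. cinner (X n) (?e k) *\<^sub>C ?e k)"
  define r where "r = X n - s"
  have e: "?e n = complex_of_real (inverse (norm r)) *\<^sub>C r"
    unfolding gram_schmidt.simps[of X n] r_def s_def scaleC_of_real by (rule sgn_div_norm)
  have "cinner (?e k) (?e n) = 0" if "k < n" for k
    using gram_schmidt_orth[OF that, of X] by (metis cinner_commute complex_cnj_zero)
  then have "cinner s (?e n) = 0"
    by (simp add: s_def cinner_sum_left cinner_simps)
  then have "cinner (X n) (?e n) = cinner r (?e n)"
    by (simp add: r_def cinner_simps)
  then have "cinner (X n) (?e n) *\<^sub>C ?e n = r"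
    by (cases "r = 0") (simp_all add: e cinner_simps scaleC_scaleC cinner_self power2_eq_square field_simps)
  then have "X n = s + cinner (X n) (?e n) *\<^sub>C ?e n"
    by (simp add: r_def)
  then show ?thesis
    by (simp add: s_def lessThan_Suc_atMost[symmetric])
qed

text \<open>The coefficients of \<open>X n\<close> in the Gram-Schmidt system vanish beyond index
  \<open>n\<close>, so they are square-summable and all inner products become finite sums.\<close>

lemma ell2_gram:
  fixes X :: "nat \<Rightarrow> 'a::complex_inner"
  obtains Y :: "nat \<Rightarrow> ell2" where "\<And>m n. cinner (Y m) (Y n) = cinner (X m) (X n)"
proof -
  let ?e = "gram_schmidt X"
  have zero: "cinner (X n) (?e k) = 0" if "n < k" for n k
  proof -
    have "cinner (?e j) (?e k) = 0" if "j \<le> n" for j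
      using gram_schmidt_orth[of j k X] \<open>n < k\<close> that by (metis cinner_commute complex_cnj_zero order_le_less_trans)
    then show ?thesis
      by (subst gram_schmidt_expand) (simp add: cinner_sum_left cinner_simps)
  qed
  define Y where "Y n = Abs_ell2 (\<lambda>k. cinner (X n) (?e k))" for n
  have Y: "ell2_nth (Y n) k = cinner (X n) (?e k)" for n k
  proof -
    have "summable (\<lambda>k. (cmod (cinner (X n) (?e k)))\<^sup>2)"
      by (rule summable_finite[of "{..n}"]) (auto simp: zero not_le)
    then show ?thesis by (simp add: Y_def Abs_ell2_inverse)
  qed
  have "cinner (Y m) (Y n) = cinner (X m) (X n)" for m n
  proof -
    have "cinner (Y m) (Y n) = (\<Sum>k\<le>m. cinner (X m) (?e k) * cnj (cinner (X n) (?e k)))"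
      unfolding cinner_ell2_def Y by (rule suminf_finite) (auto simp: zero not_le)
    also have "\<dots> = (\<Sum>k\<le>m. cinner (X m) (?e k) * cinner (?e k) (X n))"
      by (simp flip: cinner_commute)
    also have "\<dots> = cinner (\<Sum>k\<le>m. cinner (X m) (?e k) *\<^sub>C ?e k) (X n)"
      by (simp add: cinner_sum_left cinner_simps)
    finally show ?thesis
      by (simp flip: gram_schmidt_expand)
  qed
  then show ?thesis by (rule that)
qed

text \<open>An enumeration of \<open>S\<close> has a family in \<open>ell2\<close> with the same
  Gram matrix, and \<open>gram_isometry\<close> extends the assignment. The empty set has no
  enumeration, but its span is zero.\<close>

lemma ell2_embedding:
  fixes S :: "'a::complex_inner set"
  assumes "hilbert_space H" "S \<subseteq> H" "countable S"
  obtains B where "linear_isometry (ccspan S) (UNIV :: ell2 set) B"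
proof (cases "S = {}")
  case True
  have "linear_isometry (ccspan S) (UNIV :: ell2 set) (\<lambda>_. 0)"
  proof (rule linear_isometry_of_cinner[OF csubspace_ccspan])
    show "cinner 0 0 = cinner x y" if "x \<in> ccspan S" "y \<in> ccspan S" for x y
      using ccspan_cinner_zero[OF that(2)] True by simp
  qed simp
  then show ?thesis by (rule that)
next
  case False
  define X where "X = from_nat_into S"
  have X: "X ` UNIV = S"
    using False assms(3) by (simp add: X_def)
  obtain Y :: "nat \<Rightarrow> ell2" where Y: "\<And>m n. cinner (Y m) (Y n) = cinner (X m) (X n)"
    by (rule ell2_gram[of X]) blast
  obtain A where "linear_isometry (ccspan (X ` UNIV)) (ccspan (Y ` UNIV)) A"
    by (rule gram_isometry[OF assms(1) _ hilbert_space_UNIV_ell2, of UNIV X Y])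
       (use X assms(2) Y in auto)
  then have "linear_isometry (ccspan S) UNIV A"
    unfolding X linear_isometry_def by (auto intro: bounded_operator_subset[where H = "ccspan S"])
  then show ?thesis by (rule that)
qed

lemma separable_hilbert_space_ccspan:
  assumes "separable_hilbert_space H"
  obtains C where "countable C" "C \<subseteq> H" "ccspan C = H"
proof -
  have H: "hilbert_space H" using assms by (simp add: separable_hilbert_space_def)
  obtain C where C: "countable C" "C \<subseteq> H" "top_of_set H closure_of C = H"
    using assms by (auto simp: separable_hilbert_space_def separable_space_def)
  have "H \<subseteq> closure C"
    using C(2,3) by (auto simp: closure_of_subtopology Int_absorb1)
  also have "\<dots> \<subseteq> ccspan C"
    by (rule closure_minimal[OF ccspan_superset closed_ccspan])
  finally show ?thesis
    using that[OF C(1,2)] ccspan_subset_hilbert[OF C(2) H] by blast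
qed

lemma strict_mono_prod_encode: "strict_mono (\<lambda>b. prod_encode (a, b))"
  by (rule strict_mono_Suc_iff[THEN iffD2]) (simp add: prod_encode_def)

text \<open>Pairing of indices splits \<open>ell2\<close> into countably many mutually orthogonal
  copies of itself, enough room for all summands of the dilation space.\<close>

definition ell2_copy :: "nat \<Rightarrow> ell2 \<Rightarrow> ell2" where
  "ell2_copy a x = Abs_ell2 (\<lambda>n. if fst (prod_decode n) = a then ell2_nth x (snd (prod_decode n)) else 0)"

lemma ell2_nth_copy:
  "ell2_nth (ell2_copy a x) n = (if fst (prod_decode n) = a then ell2_nth x (snd (prod_decode n)) else 0)"
proof -
  let ?f = "\<lambda>n. (cmod (if fst (prod_decode n) = a then ell2_nth x (snd (prod_decode n)) else 0))\<^sup>2"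
  have "summable (\<lambda>b. ?f (prod_encode (a, b))) \<longleftrightarrow> summable ?f"
  proof (rule summable_mono_reindex[OF strict_mono_prod_encode])
    fix n assume "n \<notin> range (\<lambda>b. prod_encode (a, b))"
    then have "fst (prod_decode n) \<noteq> a"
      by (metis prod.collapse prod_decode_inverse range_eqI)
    then show "?f n = 0" by simp
  qed
  then have "summable ?f"
    by (simp add: summable_ell2_nth)
  then show ?thesis by (simp add: ell2_copy_def Abs_ell2_inverse)
qed

lemma cinner_ell2_copy:
  "cinner (ell2_copy a x) (ell2_copy b y) = (if a = b then cinner x y else 0)"
proof (cases "a = b")
  case True
  let ?f = "\<lambda>n. ell2_nth (ell2_copy a x) n * cnj (ell2_nth (ell2_copy a y) n)"
  have "(\<Sum>c. ?f (prod_encode (a, c))) = (\<Sum>n. ?f n)"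
  proof (rule suminf_mono_reindex[OF strict_mono_prod_encode])
    fix n assume "n \<notin> range (\<lambda>b. prod_encode (a, b))"
    then have "fst (prod_decode n) \<noteq> a"
      by (metis prod.collapse prod_decode_inverse range_eqI)
    then show "?f n = 0" by (simp add: ell2_nth_copy)
  qed
  then show ?thesis
    using True by (simp add: cinner_ell2_def ell2_nth_copy)
next
  case False
  then have "(\<lambda>n. ell2_nth (ell2_copy a x) n * cnj (ell2_nth (ell2_copy b y) n)) = (\<lambda>_. 0)"
    by (auto simp: ell2_nth_copy fun_eq_iff)
  then show ?thesis
    using False by (simp add: cinner_ell2_def)
qed

section \<open>Nica-covariance and least common multiples\<close>

lemma l_coset_iff: "x \<in> p <#\<^bsub>P\<^esub> A \<longleftrightarrow> (\<exists>a\<in>A. x = p \<otimes>\<^bsub>P\<^esub> a)"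
  by (auto simp: l_coset_def)

text \<open>Keeps the cofactors \<open>a\<close> and \<open>b\<close> in place of the least common
  multiple. They are its two left quotients, and Nica-covariance becomes a rule for moving the
  adjoint at \<open>p\<close> past the isometry at \<open>q\<close>.\<close>

definition lcm_pair :: "('q, 'm) monoid_scheme \<Rightarrow> 'q \<Rightarrow> 'q \<Rightarrow> 'q \<Rightarrow> 'q \<Rightarrow> bool" where
  "lcm_pair Q p q a b \<longleftrightarrow> a \<in> carrier Q \<and> b \<in> carrier Q \<and> p \<otimes>\<^bsub>Q\<^esub> a = q \<otimes>\<^bsub>Q\<^esub> b \<and>
     (p <#\<^bsub>Q\<^esub> carrier Q) \<inter> (q <#\<^bsub>Q\<^esub> carrier Q) = (p \<otimes>\<^bsub>Q\<^esub> a) <#\<^bsub>Q\<^esub> carrier Q"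

definition disjoint_ideals :: "('q, 'm) monoid_scheme \<Rightarrow> 'q \<Rightarrow> 'q \<Rightarrow> bool" where
  "disjoint_ideals Q p q \<longleftrightarrow> (p <#\<^bsub>Q\<^esub> carrier Q) \<inter> (q <#\<^bsub>Q\<^esub> carrier Q) = {}"

lemma lcm_pair_sym: "lcm_pair Q p q a b \<Longrightarrow> lcm_pair Q q p b a"
  by (auto simp: lcm_pair_def Int_commute)

lemma disjoint_ideals_sym: "disjoint_ideals Q p q \<Longrightarrow> disjoint_ideals Q q p"
  by (auto simp: disjoint_ideals_def)

context monoid
begin

lemma l_coset_self: "p \<in> carrier G \<Longrightarrow> p \<in> p <# carrier G"
  by (auto simp: l_coset_iff intro!: bexI[of _ \<one>])

lemma l_coset_mult_subset:
  assumes "p \<in> carrier G" "q \<in> carrier G"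
  shows "(p \<otimes> q) <# carrier G \<subseteq> p <# carrier G"
  using assms m_assoc[of p q] m_closed[of q] unfolding l_coset_iff subset_iff by metis

end

context right_lcm_monoid
begin

lemma lcm_pair_generator:
  assumes "p \<in> carrier P" "q \<in> carrier P" "r \<in> carrier P"
    and "(p <# carrier P) \<inter> (q <# carrier P) = r <# carrier P"
  shows "\<exists>a b. lcm_pair P p q a b \<and> r = p \<otimes> a"
proof -
  have "r \<in> r <# carrier P"
    by (rule l_coset_self[OF assms(3)])
  then have "r \<in> p <# carrier P" "r \<in> q <# carrier P"
    using assms(4) by auto
  then obtain a b where "a \<in> carrier P" "r = p \<otimes> a" "b \<in> carrier P" "r = q \<otimes> b"
    by (auto simp: l_coset_iff)
  then have "lcm_pair P p q a b"
    using assms(4) by (simp add: lcm_pair_def)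
  with \<open>r = p \<otimes> a\<close> show ?thesis by blast
qed

lemma lcm_cases:
  assumes "p \<in> carrier P" "q \<in> carrier P"
  obtains "disjoint_ideals P p q" | a b where "lcm_pair P p q a b"
  using right_lcm[OF assms] lcm_pair_generator[OF assms] unfolding disjoint_ideals_def by blast

lemma left_cancel_iff:
  "\<lbrakk>p \<in> carrier P; q \<in> carrier P; r \<in> carrier P\<rbrakk> \<Longrightarrow> p \<otimes> q = p \<otimes> r \<longleftrightarrow> q = r"
  using left_cancel by blast

text \<open>Left cancellation makes a right inverse two-sided.\<close>

lemma unit_of_mult: "\<lbrakk>p \<in> carrier P; r \<in> carrier P; p \<otimes> r = \<one>\<rbrakk> \<Longrightarrow> p \<in> Units P"
proof -
  assume *: "p \<in> carrier P" "r \<in> carrier P" "p \<otimes> r = \<one>"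
  then have "p \<otimes> (r \<otimes> p) = p \<otimes> \<one>" by (simp flip: m_assoc)
  then have "r \<otimes> p = \<one>" using * left_cancel[of p "r \<otimes> p" \<one>] by simp
  then show ?thesis using * by (auto simp: Units_def)
qed

lemma left_quotient_mult: "p \<in> carrier P \<Longrightarrow> a \<in> carrier P \<Longrightarrow> left_quotient P p (p \<otimes> a) = a"
  unfolding left_quotient_def by (rule the_equality) (auto dest: left_cancel)

text \<open>After cancelling \<open>q\<close>, a multiple of \<open>q \<otimes> x\<close> in the
  ideal of \<open>p\<close> becomes a common multiple of \<open>b\<close> and \<open>x\<close>; so
  least common multiples with products are found in two stages.\<close>

lemma lcm_pair_mult_right:
  assumes "lcm_pair P p q a b" "lcm_pair P b x c d"
    and "p \<in> carrier P" "q \<in> carrier P" "x \<in> carrier P"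
  shows "lcm_pair P p (q \<otimes> x) (a \<otimes> c) d"
proof -
  have c: "a \<in> carrier P" "b \<in> carrier P" "c \<in> carrier P" "d \<in> carrier P"
    and eq: "p \<otimes> a = q \<otimes> b" "b \<otimes> c = x \<otimes> d"
    using assms by (auto simp: lcm_pair_def)
  have eq': "p \<otimes> (a \<otimes> c) = (q \<otimes> x) \<otimes> d"
    by (metis assms(3-5) c eq m_assoc)
  have "(p <# carrier P) \<inter> ((q \<otimes> x) <# carrier P) \<subseteq> (p \<otimes> (a \<otimes> c)) <# carrier P"
  proof
    fix y assume y: "y \<in> (p <# carrier P) \<inter> ((q \<otimes> x) <# carrier P)"
    then obtain f where f: "f \<in> carrier P" "y = q \<otimes> x \<otimes> f"
      by (auto simp: l_coset_iff)
    then have "y \<in> q <# carrier P"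
      using assms(4,5) by (auto simp: l_coset_iff m_assoc)
    then have "y \<in> (q \<otimes> b) <# carrier P"
      using y assms(1) by (auto simp: lcm_pair_def)
    then obtain g where g: "g \<in> carrier P" "y = q \<otimes> (b \<otimes> g)"
      using assms(4) c by (auto simp: l_coset_iff m_assoc)
    then have "x \<otimes> f = b \<otimes> g"
      using f assms c left_cancel[of q "x \<otimes> f" "b \<otimes> g"] by (simp add: m_assoc)
    then have "b \<otimes> g \<in> (b <# carrier P) \<inter> (x <# carrier P)"
      using f(1) g(1) by (auto simp: l_coset_iff) metis
    then have "b \<otimes> g \<in> (b \<otimes> c) <# carrier P"
      using assms(2) by (auto simp: lcm_pair_def)
    then obtain h where h: "h \<in> carrier P" "b \<otimes> g = b \<otimes> c \<otimes> h"
      by (auto simp: l_coset_iff)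
    have "y = p \<otimes> (a \<otimes> c) \<otimes> h"
      using g h eq assms c by (metis m_assoc m_closed)
    then show "y \<in> (p \<otimes> (a \<otimes> c)) <# carrier P"
      using h by (auto simp: l_coset_iff)
  qed
  moreover have "(p \<otimes> (a \<otimes> c)) <# carrier P \<subseteq> p <# carrier P"
    using assms c by (intro l_coset_mult_subset) auto
  moreover have "(p \<otimes> (a \<otimes> c)) <# carrier P \<subseteq> (q \<otimes> x) <# carrier P"
    unfolding eq' using assms c by (intro l_coset_mult_subset) auto
  ultimately show ?thesis
    using eq' c by (auto simp: lcm_pair_def)
qed

text \<open>The same cancellation: a common multiple of \<open>p\<close> and
  \<open>q \<otimes> x\<close> would give one of \<open>b\<close> and \<open>x\<close>.\<close>

lemma disjoint_ideals_mult_right: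
  assumes "lcm_pair P p q a b" "disjoint_ideals P b x"
    and "p \<in> carrier P" "q \<in> carrier P" "x \<in> carrier P"
  shows "disjoint_ideals P p (q \<otimes> x)"
proof -
  have False if y: "y \<in> p <# carrier P" "y \<in> (q \<otimes> x) <# carrier P" for y
  proof -
    have b: "b \<in> carrier P" "p \<otimes> a = q \<otimes> b" using assms(1) by (auto simp: lcm_pair_def)
    obtain f where f: "f \<in> carrier P" "y = q \<otimes> x \<otimes> f"
      using y by (auto simp: l_coset_iff)
    then have "y \<in> q <# carrier P"
      using assms(4,5) by (auto simp: l_coset_iff m_assoc)
    then have "y \<in> (q \<otimes> b) <# carrier P"
      using y assms(1) by (auto simp: lcm_pair_def)
    then obtain g where g: "g \<in> carrier P" "y = q \<otimes> (b \<otimes> g)"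
      using assms(4) b by (auto simp: l_coset_iff m_assoc)
    then have "x \<otimes> f = b \<otimes> g"
      using f assms b left_cancel[of q "x \<otimes> f" "b \<otimes> g"] by (simp add: m_assoc)
    then have "b \<otimes> g \<in> (b <# carrier P) \<inter> (x <# carrier P)"
      using f(1) g(1) by (auto simp: l_coset_iff) metis
    then show False using assms(2) by (auto simp: disjoint_ideals_def)
  qed
  then show ?thesis by (auto simp: disjoint_ideals_def)
qed

lemma disjoint_ideals_mult_right':
  assumes "disjoint_ideals P p q" "p \<in> carrier P" "q \<in> carrier P" "x \<in> carrier P"
  shows "disjoint_ideals P p (q \<otimes> x)"
  using assms(1) l_coset_mult_subset[OF assms(3,4)] by (auto simp: disjoint_ideals_def)

end

section \<open>Isometric representations and the exchange rule for adjoints\<close>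

lemma operator_repD:
  assumes "operator_rep Q H R"
  shows operator_rep_bounded: "p \<in> carrier Q \<Longrightarrow> bounded_operator H H (R p)"
    and operator_rep_one: "x \<in> H \<Longrightarrow> R \<one>\<^bsub>Q\<^esub> x = x"
    and operator_rep_mult: "\<lbrakk>p \<in> carrier Q; q \<in> carrier Q; x \<in> H\<rbrakk> \<Longrightarrow> R (p \<otimes>\<^bsub>Q\<^esub> q) x = R p (R q x)"
    and operator_rep_in: "\<lbrakk>p \<in> carrier Q; x \<in> H\<rbrakk> \<Longrightarrow> R p x \<in> H"
  using assms by (auto simp: operator_rep_def bounded_operator_def)

lemma operator_rep_adjt_mult:
  assumes "hilbert_space H" "operator_rep Q H R" "p \<in> carrier Q" "q \<in> carrier Q"
  shows "adjt H (R (p \<otimes>\<^bsub>Q\<^esub> q)) y = adjt H (R q) (adjt H (R p) y)"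
proof -
  have "adjt H (R (p \<otimes>\<^bsub>Q\<^esub> q)) = adjt H (\<lambda>x. R p (R q x))"
    by (rule adjt_cong) (simp add: operator_rep_mult[OF assms(2)] assms)
  then show ?thesis
    using adjt_comp[OF assms(1,1) operator_rep_bounded[OF assms(2,4)] operator_rep_bounded[OF assms(2,3)]]
    by simp
qed

locale isometric_representation = monoid Q for Q (structure) +
  fixes K :: "'a::complex_inner set" and V :: "'b \<Rightarrow> 'a \<Rightarrow> 'a"
  assumes K: "hilbert_space K" and isometric: "isometric_rep Q K V"
begin

lemma csubspace_K: "csubspace K"
  using K by (rule hilbert_space_csubspace)

lemma rep: "operator_rep Q K V"
  using isometric by (simp add: isometric_rep_def)

lemmas V_bounded = operator_rep_bounded[OF rep]
lemmas V_one = operator_rep_one[OF rep]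
lemmas V_mult = operator_rep_mult[OF rep]
lemmas V_in = operator_rep_in[OF rep]

lemma V_isometry: "p \<in> carrier Q \<Longrightarrow> linear_isometry K K (V p)"
  using isometric by (simp add: isometric_rep_def)

lemma V_cinner: "\<lbrakk>p \<in> carrier Q; x \<in> K; y \<in> K\<rbrakk> \<Longrightarrow> cinner (V p x) (V p y) = cinner x y"
  by (rule linear_isometry_cinner[OF V_isometry csubspace_K])

abbreviation "Vs p \<equiv> adjt K (V p)"

lemma Vs_in: "p \<in> carrier Q \<Longrightarrow> Vs p y \<in> K"
  by (rule adjt_in[OF K V_bounded])

lemma Vs_cinner: "\<lbrakk>p \<in> carrier Q; x \<in> K\<rbrakk> \<Longrightarrow> cinner x (Vs p y) = cinner (V p x) y"
  by (rule adjt_cinner[OF K V_bounded, symmetric])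

lemma Vs_cinner': "\<lbrakk>p \<in> carrier Q; x \<in> K\<rbrakk> \<Longrightarrow> cinner (Vs p y) x = cinner y (V p x)"
  by (rule adjt_cinner'[OF K V_bounded, symmetric])

lemma Vs_bounded: "p \<in> carrier Q \<Longrightarrow> bounded_operator K K (Vs p)"
  by (rule bounded_operator_subset[OF bounded_operator_adjt[OF K V_bounded]]) (auto simp: Vs_in)

lemma Vs_V: "\<lbrakk>p \<in> carrier Q; x \<in> K\<rbrakk> \<Longrightarrow> Vs p (V p x) = x"
  by (rule adjt_unique[OF csubspace_K]) (auto simp: V_cinner)

lemma Vs_mult: "\<lbrakk>p \<in> carrier Q; q \<in> carrier Q\<rbrakk> \<Longrightarrow> Vs (p \<otimes> q) y = Vs q (Vs p y)"
  by (rule operator_rep_adjt_mult[OF K rep])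

lemma Vs_one: "y \<in> K \<Longrightarrow> Vs \<one> y = y"
  by (rule adjt_unique[OF csubspace_K]) (auto simp: V_one)

lemma Vs_eq_zeroI:
  assumes "p \<in> carrier Q" "\<And>z. z \<in> K \<Longrightarrow> cinner y (V p z) = 0"
  shows "Vs p y = 0"
  using assms(2)[OF Vs_in[OF assms(1)]] Vs_cinner'[OF assms(1) Vs_in[OF assms(1)], of y y]
  by simp

lemma Vs_eqI:
  assumes "p \<in> carrier Q" "z \<in> K" "\<And>x. x \<in> K \<Longrightarrow> cinner (V p x) y = cinner x z"
  shows "Vs p y = z"
  by (rule adjt_unique[OF csubspace_K assms(2,3)])

text \<open>A least common multiple is determined only up to invertible factors, so its range
  projection must not depend on the generator. Each of the two projections absorbs the other, and
  self-adjointness makes them equal.\<close>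

lemma range_projection_cong:
  assumes r: "r \<in> carrier Q" "r' \<in> carrier Q" and x: "x \<in> K"
    and eq: "r <# carrier Q = r' <# carrier Q"
  shows "V r (Vs r x) = V r' (Vs r' x)"
proof -
  have sub: "V a (Vs a (V b (Vs b z))) = V b (Vs b z)"
    if "a \<in> carrier Q" "b \<in> carrier Q" "b \<in> a <# carrier Q" "z \<in> K" for a b z
  proof -
    obtain c where c: "c \<in> carrier Q" "b = a \<otimes> c"
      using \<open>b \<in> a <# carrier Q\<close> by (auto simp: l_coset_iff)
    then show ?thesis
      using that by (simp add: V_mult Vs_in Vs_V V_in)
  qed
  have mem: "r \<in> r <# carrier Q" "r' \<in> r' <# carrier Q"
    using r by (auto intro: l_coset_self)
  have adj: "cinner z (V a (Vs a y)) = cinner (V a (Vs a z)) y" if "a \<in> carrier Q" "z \<in> K" "y \<in> K" for a y z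
    using that by (simp add: Vs_in flip: Vs_cinner Vs_cinner')
  show ?thesis
  proof (rule cinner_ext[OF csubspace_K])
    fix z assume z: "z \<in> K"
    have "cinner z (V r (Vs r x)) = cinner z (V r' (Vs r' (V r (Vs r x))))"
      using sub[of r' r x] r mem eq x by simp
    also have "\<dots> = cinner (V r (Vs r (V r' (Vs r' z)))) x"
      using r x z by (simp add: adj V_in Vs_in)
    also have "\<dots> = cinner (V r' (Vs r' z)) x"
      using sub[of r r' z] r mem eq z by simp
    finally show "cinner z (V r (Vs r x)) = cinner z (V r' (Vs r' x))"
      using r x z by (simp add: adj)
  qed (use r x in \<open>auto simp: V_in Vs_in\<close>)
qed

text \<open>One least common multiple per pair is enough, by \<open>range_projection_cong\<close>;
  the exchange rule merges the product of two range projections into a single one.\<close>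

lemma nica_covariantI:
  assumes "\<And>p q. \<lbrakk>p \<in> carrier Q; q \<in> carrier Q\<rbrakk> \<Longrightarrow>
    (\<exists>a b. lcm_pair Q p q a b \<and> (\<forall>x\<in>K. Vs p (V q x) = V a (Vs b x))) \<or>
    disjoint_ideals Q p q \<and> (\<forall>x\<in>K. Vs p (V q x) = 0)"
  shows "nica_covariant Q K V"
  unfolding nica_covariant_def hilbert_adjoint_adjt
proof (intro ballI conjI impI)
  fix p q r x
  assume pq: "p \<in> carrier Q" "q \<in> carrier Q" and r: "r \<in> carrier Q" and x: "x \<in> K"
    and eq: "(p <# carrier Q) \<inter> (q <# carrier Q) = r <# carrier Q"
  have "r \<in> r <# carrier Q"
    by (rule l_coset_self[OF r])
  then have "\<not> disjoint_ideals Q p q"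
    using eq by (auto simp: disjoint_ideals_def)
  then obtain a b where ab: "lcm_pair Q p q a b" "\<And>x. x \<in> K \<Longrightarrow> Vs p (V q x) = V a (Vs b x)"
    using assms[OF pq] by blast
  then have c: "a \<in> carrier Q" "b \<in> carrier Q" "p \<otimes> a = q \<otimes> b"
    by (auto simp: lcm_pair_def)
  have "V p (Vs p (V q (Vs q x))) = V (p \<otimes> a) (Vs (q \<otimes> b) x)"
    using ab(2)[of "Vs q x"] pq c(1,2) x by (simp add: Vs_in V_mult Vs_mult)
  also have "\<dots> = V r (Vs r x)"
    unfolding c(3)[symmetric] using ab(1) eq pq c r x
    by (intro range_projection_cong) (auto simp: lcm_pair_def)
  finally show "V p (Vs p (V q (Vs q x))) = V r (Vs r x)" .
next
  fix p q x
  assume pq: "p \<in> carrier Q" "q \<in> carrier Q" and x: "x \<in> K"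
    and eq: "(p <# carrier Q) \<inter> (q <# carrier Q) = {}"
  then have "\<not> lcm_pair Q p q a b" for a b
    using l_coset_self[of "p \<otimes> a"] pq by (auto simp: lcm_pair_def)
  then have "Vs p (V q (Vs q x)) = 0"
    using assms[OF pq] Vs_in[OF pq(2)] by blast
  then show "V p (Vs p (V q (Vs q x))) = 0"
    using bounded_operator_zero[OF V_bounded[OF pq(1)] csubspace_0[OF csubspace_K]] by simp
qed

text \<open>The identity for range projections is evaluated at \<open>V q x\<close> and followed by
  \<open>Vs p\<close>; the isometries then cancel against their adjoints.\<close>

lemma nica_lcm:
  assumes "nica_covariant Q K V" "lcm_pair Q p q a b" "p \<in> carrier Q" "q \<in> carrier Q" "x \<in> K"
  shows "Vs p (V q x) = V a (Vs b x)"
proof -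
  have c: "a \<in> carrier Q" "b \<in> carrier Q" "p \<otimes> a = q \<otimes> b"
    using assms(2) by (auto simp: lcm_pair_def)
  have "V p (Vs p (V q (Vs q (V q x)))) = V (p \<otimes> a) (Vs (p \<otimes> a) (V q x))"
    using assms c V_in unfolding nica_covariant_def hilbert_adjoint_adjt lcm_pair_def by blast
  then have "Vs p (V p (Vs p (V q x))) = Vs p (V (p \<otimes> a) (Vs (q \<otimes> b) (V q x)))"
    using assms(4,5) c(3) by (simp add: Vs_V)
  then show ?thesis
    using assms(3-5) c(1,2) by (simp add: Vs_V V_in Vs_in V_mult Vs_mult)
qed

lemma nica_disjoint:
  assumes "nica_covariant Q K V" "disjoint_ideals Q p q" "p \<in> carrier Q" "q \<in> carrier Q" "x \<in> K"
  shows "Vs p (V q x) = 0"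
proof -
  have "V p (Vs p (V q (Vs q (V q x)))) = 0"
    using assms V_in unfolding nica_covariant_def hilbert_adjoint_adjt disjoint_ideals_def by blast
  then have "Vs p (V p (Vs p (V q x))) = Vs p 0"
    using assms by (simp add: Vs_V)
  then show ?thesis
    using assms bounded_operator_zero[OF Vs_bounded csubspace_0[OF csubspace_K], of p]
    by (simp add: Vs_V V_in Vs_in)
qed

lemma nica_disjoint_cinner:
  assumes "nica_covariant Q K V" "disjoint_ideals Q p q" "p \<in> carrier Q" "q \<in> carrier Q"
    "x \<in> K" "y \<in> K"
  shows "cinner (V p x) (V q y) = 0"
  using nica_disjoint[OF assms(1-4,6)] Vs_cinner[OF assms(3,5), of "V q y"] by simp

text \<open>At an invertible element the isometry is onto, hence unitary.\<close>

lemma Vs_unit: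
  assumes "u \<in> Units Q" "x \<in> K"
  shows "Vs u x = V (inv u) x"
proof -
  have "V u (V (inv u) x) = x"
    using assms V_mult[of u "inv u" x] by (simp add: V_one Units_closed)
  then have "Vs u x = Vs u (V u (V (inv u) x))" by simp
  then show ?thesis using assms by (simp add: Vs_V V_in Units_closed)
qed

end

section \<open>Minimal *-regular dilations\<close>

locale star_regular = right_lcm_monoid Q for Q (structure) +
  fixes H :: "'h::complex_inner set" and R :: "'b \<Rightarrow> 'h \<Rightarrow> 'h"
    and L :: "'k::complex_inner set" and I :: "'h \<Rightarrow> 'k" and U :: "'b \<Rightarrow> 'k \<Rightarrow> 'k"
  assumes H: "hilbert_space H" and rep_R: "operator_rep Q H R"
    and regular: "star_regular_dilation Q H R L I U"
begin

lemma dil: "isometric_dilation Q H R L I U"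
  using regular by (simp add: star_regular_dilation_def)

lemma L: "hilbert_space L" and I: "linear_isometry H L I" and iso_U: "isometric_rep Q L U"
  using dil by (auto simp: isometric_dilation_def)

sublocale big: isometric_representation Q L U
  by unfold_locales (fact L, fact iso_U)

lemma I_in: "h \<in> H \<Longrightarrow> I h \<in> L"
  by (rule bounded_operator_in[OF linear_isometry_bounded[OF I]])

lemma I_cinner: "h \<in> H \<Longrightarrow> k \<in> H \<Longrightarrow> cinner (I h) (I k) = cinner h k"
  by (rule linear_isometry_cinner[OF I hilbert_space_csubspace[OF H]])

lemma IH: "hilbert_space (I ` H)"
  by (rule linear_isometry_hilbert_image[OF I H])

lemma R_adj_in: "p \<in> carrier Q \<Longrightarrow> adjt H (R p) h \<in> H"
  by (rule adjt_in[OF H operator_rep_bounded[OF rep_R]])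

text \<open>Regularity prescribes all inner products between translates of the copy of
  \<open>H\<close> in terms of \<open>R\<close> alone; the left quotients in its formula are the
  cofactors \<open>a\<close> and \<open>b\<close>.\<close>

lemma gram_lcm:
  assumes "lcm_pair Q p q a b" "p \<in> carrier Q" "q \<in> carrier Q" "h \<in> H" "k \<in> H"
  shows "cinner (U q (I h)) (U p (I k)) = cinner (adjt H (R b) h) (adjt H (R a) k)"
proof -
  have c: "a \<in> carrier Q" "b \<in> carrier Q" "p \<otimes> a = q \<otimes> b"
    using assms(1) by (auto simp: lcm_pair_def)
  have "cinner (U q (I h)) (U p (I k)) = cinner (big.Vs p (U q (I h))) (I k)"
    using assms by (simp add: I_in big.Vs_cinner')
  also have "\<dots> = cinner (orthogonal_projection (I ` H) (big.Vs p (U q (I h)))) (I k)"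
    using assms by (simp add: orthogonal_projection_cinner[OF IH])
  also have "orthogonal_projection (I ` H) (big.Vs p (U q (I h))) =
      I (R (left_quotient Q p (p \<otimes> a)) (adjt H (R (left_quotient Q q (p \<otimes> a))) h))"
    using regular assms c unfolding star_regular_dilation_def hilbert_adjoint_adjt lcm_pair_def
    by blast
  also have "\<dots> = I (R a (adjt H (R b) h))"
    using assms c left_quotient_mult[of p a] left_quotient_mult[of q b] by simp
  also have "cinner \<dots> (I k) = cinner (R a (adjt H (R b) h)) k"
    using assms c R_adj_in by (simp add: I_cinner operator_rep_in[OF rep_R])
  finally show ?thesis
    using assms c R_adj_in by (simp add: adjt_cinner[OF H operator_rep_bounded[OF rep_R]])
qed

lemma gram_disjoint:
  assumes "disjoint_ideals Q p q" "p \<in> carrier Q" "q \<in> carrier Q" "h \<in> H" "k \<in> H"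
  shows "cinner (U q (I h)) (U p (I k)) = 0"
proof -
  have "cinner (U q (I h)) (U p (I k)) = cinner (big.Vs p (U q (I h))) (I k)"
    using assms by (simp add: I_in big.Vs_cinner')
  also have "\<dots> = cinner (orthogonal_projection (I ` H) (big.Vs p (U q (I h)))) (I k)"
    using assms by (simp add: orthogonal_projection_cinner[OF IH])
  also have "orthogonal_projection (I ` H) (big.Vs p (U q (I h))) = 0"
    using regular assms unfolding star_regular_dilation_def hilbert_adjoint_adjt disjoint_ideals_def
    by blast
  finally show ?thesis by simp
qed

definition gens :: "'k set" where
  "gens = (\<lambda>(x, h). U x (I h)) ` (carrier Q \<times> H)"

definition M :: "'k set" where
  "M = ccspan gens"

lemma gens_subset: "gens \<subseteq> L"
  by (auto simp: gens_def big.V_in I_in)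

lemma M: "hilbert_space M"
  unfolding M_def by (rule hilbert_space_ccspan[OF gens_subset L])

lemma M_subset: "M \<subseteq> L"
  unfolding M_def by (rule ccspan_subset_hilbert[OF gens_subset L])

lemma gens_M: "x \<in> carrier Q \<Longrightarrow> h \<in> H \<Longrightarrow> U x (I h) \<in> M"
  unfolding M_def by (rule ccspan_base) (auto simp: gens_def)

lemma I_M: "h \<in> H \<Longrightarrow> I h \<in> M"
  using gens_M[of \<one> h] by (simp add: big.V_one I_in)

lemma U_M: "p \<in> carrier Q \<Longrightarrow> x \<in> M \<Longrightarrow> U p x \<in> M"
proof -
  assume p: "p \<in> carrier Q" and "x \<in> M"
  then have "x \<in> ccspan gens" by (simp add: M_def)
  have "U p x \<in> ccspan gens"
  proof (rule bounded_operator_ccspan_in[OF big.V_bounded[OF p] L gens_subset csubspace_ccspan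
        closed_ccspan _ \<open>x \<in> ccspan gens\<close>])
    fix s assume "s \<in> gens"
    then obtain y h where "y \<in> carrier Q" "h \<in> H" "s = U y (I h)" by (auto simp: gens_def)
    then show "U p s \<in> ccspan gens"
      using gens_M[of "p \<otimes> y" h] p by (simp add: big.V_mult I_in M_def)
  qed
  then show ?thesis by (simp add: M_def)
qed

lemma isometric_M: "isometric_rep Q M U"
  unfolding isometric_rep_def operator_rep_def linear_isometry_def
  using big.V_isometry big.V_one big.V_mult M_subset U_M
  by (auto simp: linear_isometry_def intro: bounded_operator_subset[OF big.V_bounded])

sublocale min: isometric_representation Q M U
  by unfold_locales (fact M, fact isometric_M)

lemma M_eqI:
  assumes "bounded_operator M K A" "bounded_operator M K' B"
    and "\<And>y h. y \<in> carrier Q \<Longrightarrow> h \<in> H \<Longrightarrow> A (U y (I h)) = B (U y (I h))" "x \<in> M"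
  shows "A x = B x"
proof (rule bounded_operator_eq_on_ccspan[OF assms(1,2) M])
  show "gens \<subseteq> M" unfolding M_def by (rule ccspan_superset)
  show "x \<in> ccspan gens" using assms(4) by (simp add: M_def)
qed (auto simp: gens_def assms(3))

text \<open>Tested on a generator \<open>U y (I k)\<close>, the left side pairs
  \<open>U (p \<otimes> y)\<close> with \<open>U x\<close>. By \<open>lcm_pair_mult_right\<close>
  their least common multiple is that of \<open>p\<close> and \<open>x\<close> continued by that of
  \<open>a\<close> and \<open>y\<close>, so the Gram formula factors through
  \<open>adjt H (R b) h\<close>.\<close>

lemma adj_generator:
  assumes "lcm_pair Q p x a b" "p \<in> carrier Q" "x \<in> carrier Q" "h \<in> H"
  shows "min.Vs p (U x (I h)) = U a (I (adjt H (R b) h))"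
  unfolding M_def
proof (rule ccspan_ext[where S = gens])
  have c: "a \<in> carrier Q" "b \<in> carrier Q" "p \<otimes> a = x \<otimes> b"
    using assms(1) by (auto simp: lcm_pair_def)
  show "adjt (ccspan gens) (U p) (U x (I h)) \<in> ccspan gens"
    using min.Vs_in[OF assms(2)] by (simp add: M_def)
  show "U a (I (adjt H (R b) h)) \<in> ccspan gens"
    using gens_M[of a "adjt H (R b) h"] c R_adj_in by (simp add: M_def)
  fix s assume "s \<in> gens"
  then obtain y k where y: "y \<in> carrier Q" "k \<in> H" "s = U y (I k)" by (auto simp: gens_def)
  have "cinner s (min.Vs p (U x (I h))) = cinner (U (p \<otimes> y) (I k)) (U x (I h))"
    using assms y by (simp add: min.Vs_cinner gens_M min.V_mult I_M)
  also have "\<dots> = cinner (U y (I k)) (U a (I (adjt H (R b) h)))"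
    using c(1) y(1)
  proof (cases rule: lcm_cases)
    case 1
    then have "disjoint_ideals Q x (p \<otimes> y)"
      using disjoint_ideals_mult_right[OF lcm_pair_sym[OF assms(1)]] assms y by blast
    then show ?thesis
      using 1 gram_disjoint assms y c R_adj_in by simp
  next
    case (2 c' d)
    then have cd: "c' \<in> carrier Q" "d \<in> carrier Q" by (auto simp: lcm_pair_def)
    have "lcm_pair Q x (p \<otimes> y) (b \<otimes> c') d"
      using lcm_pair_mult_right[OF lcm_pair_sym[OF assms(1)] 2] assms y by blast
    then have "cinner (U (p \<otimes> y) (I k)) (U x (I h)) =
        cinner (adjt H (R d) k) (adjt H (R (b \<otimes> c')) h)"
      using gram_lcm assms y by blast
    also have "\<dots> = cinner (adjt H (R d) k) (adjt H (R c') (adjt H (R b) h))"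
      by (simp add: operator_rep_adjt_mult[OF H rep_R c(2) cd(1)])
    also have "\<dots> = cinner (U y (I k)) (U a (I (adjt H (R b) h)))"
      by (rule gram_lcm[OF 2 c(1) y(1,2) R_adj_in[OF c(2)], symmetric])
    finally show ?thesis .
  qed
  finally show "cinner s (adjt (ccspan gens) (U p) (U x (I h))) = cinner s (U a (I (adjt H (R b) h)))"
    using y by (simp add: M_def)
qed

lemma adj_generator_disjoint:
  assumes "disjoint_ideals Q p x" "p \<in> carrier Q" "x \<in> carrier Q" "h \<in> H"
  shows "min.Vs p (U x (I h)) = 0"
  unfolding M_def
proof (rule ccspan_ext[where S = gens])
  show "adjt (ccspan gens) (U p) (U x (I h)) \<in> ccspan gens"
    using min.Vs_in[OF assms(2)] by (simp add: M_def)
  fix s assume "s \<in> gens"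
  then obtain y k where y: "y \<in> carrier Q" "k \<in> H" "s = U y (I k)" by (auto simp: gens_def)
  have "cinner s (min.Vs p (U x (I h))) = cinner (U (p \<otimes> y) (I k)) (U x (I h))"
    using assms y by (simp add: min.Vs_cinner gens_M min.V_mult I_M)
  also have "\<dots> = 0"
    using gram_disjoint disjoint_ideals_mult_right' disjoint_ideals_sym[OF assms(1)] assms y by simp
  finally show "cinner s (adjt (ccspan gens) (U p) (U x (I h))) = cinner s 0"
    by (simp add: M_def)
qed (simp add: csubspace_0 csubspace_ccspan)

text \<open>Both sides are evaluated on generators \<open>U y (I h)\<close> by
  \<open>adj_generator\<close>: the cofactors for \<open>p\<close> and \<open>q \<otimes> y\<close>
  are those of \<open>p\<close> and \<open>q\<close> followed by those of \<open>b\<close> and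
  \<open>y\<close>.\<close>

theorem nica_covariant_M: "nica_covariant Q M U"
proof (rule min.nica_covariantI)
  fix p q assume pq: "p \<in> carrier Q" "q \<in> carrier Q"
  have comp: "bounded_operator M M (\<lambda>x. min.Vs p (U q x))"
    by (rule bounded_operator_comp[OF min.V_bounded[OF pq(2)] min.Vs_bounded[OF pq(1)]])
  show "(\<exists>a b. lcm_pair Q p q a b \<and> (\<forall>x\<in>M. min.Vs p (U q x) = U a (min.Vs b x))) \<or>
    disjoint_ideals Q p q \<and> (\<forall>x\<in>M. min.Vs p (U q x) = 0)"
    using pq
  proof (cases rule: lcm_cases)
    case 1
    have "min.Vs p (U q x) = 0" if "x \<in> M" for x
    proof (rule M_eqI[OF comp _ _ that, of M "\<lambda>_. 0"])
      show "bounded_operator M M (\<lambda>_. 0)"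
        by (auto simp: bounded_operator_def csubspace_0[OF min.csubspace_K] intro: exI[of _ 0])
      show "min.Vs p (U q (U y (I h))) = 0" if "y \<in> carrier Q" "h \<in> H" for y h
        using adj_generator_disjoint[OF disjoint_ideals_mult_right'[OF 1 pq that(1)] pq(1) _ that(2)] that pq
        by (simp add: min.V_mult I_M)
    qed
    then show ?thesis using 1 by blast
  next
    case (2 a b)
    then have c: "a \<in> carrier Q" "b \<in> carrier Q" by (auto simp: lcm_pair_def)
    have "min.Vs p (U q x) = U a (min.Vs b x)" if "x \<in> M" for x
    proof (rule M_eqI[OF comp bounded_operator_comp[OF min.Vs_bounded[OF c(2)] min.V_bounded[OF c(1)]] _ that])
      fix y h assume y: "y \<in> carrier Q" "h \<in> H"
      have eq: "U q (U y (I h)) = U (q \<otimes> y) (I h)"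
        using y pq by (simp add: min.V_mult I_M)
      show "min.Vs p (U q (U y (I h))) = U a (min.Vs b (U y (I h)))"
        using c(2) y(1)
      proof (cases rule: lcm_cases)
        case 1
        then show ?thesis
          unfolding eq
          using adj_generator_disjoint[OF disjoint_ideals_mult_right[OF 2 1 pq y(1)] pq(1) _ y(2)]
            adj_generator_disjoint[OF 1 c(2) y] y pq
            bounded_operator_zero[OF min.V_bounded[OF c(1)] csubspace_0[OF min.csubspace_K]]
          by simp
      next
        case (2 c' d)
        then have cd: "c' \<in> carrier Q" "d \<in> carrier Q" by (auto simp: lcm_pair_def)
        show ?thesis
          unfolding eq adj_generator[OF 2 c(2) y]
            adj_generator[OF lcm_pair_mult_right[OF \<open>lcm_pair Q p q a b\<close> 2 pq y(1)] pq(1) m_closed[OF pq(2) y(1)] y(2)]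
          using c cd R_adj_in by (simp add: min.V_mult I_M)
      qed
    qed
    then show ?thesis using 2 by blast
  qed
qed

text \<open>The projection onto the image of \<open>I\<close>, with values read back in
  \<open>H\<close>.\<close>

abbreviation "proj \<equiv> adjt H I"

lemma proj_in: "proj x \<in> H"
  by (rule adjt_in[OF H linear_isometry_bounded[OF I]])

lemma proj_cinner: "h \<in> H \<Longrightarrow> cinner x (I h) = cinner (proj x) h"
  by (rule adjt_cinner'[OF H linear_isometry_bounded[OF I]])

lemma proj_bounded: "bounded_operator UNIV H proj"
  by (rule bounded_operator_adjt[OF H linear_isometry_bounded[OF I]])

text \<open>The co-extension property in dual form. On generators it is the dilation identity for
  \<open>p \<otimes> y\<close> and for \<open>y\<close>; continuity extends it to
  \<open>M\<close>.\<close>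

lemma proj_U:
  assumes p: "p \<in> carrier Q" and x: "x \<in> M"
  shows "proj (U p x) = R p (proj x)"
proof (rule M_eqI[OF _ _ _ x])
  have 1: "bounded_operator M H proj"
    by (rule bounded_operator_subset[OF proj_bounded]) (auto simp: proj_in)
  show "bounded_operator M H (\<lambda>x. proj (U p x))"
    by (rule bounded_operator_comp[OF min.V_bounded[OF p] 1])
  show "bounded_operator M H (\<lambda>x. R p (proj x))"
    by (rule bounded_operator_comp[OF 1 operator_rep_bounded[OF rep_R p]])
  have gen: "proj (U y (I h)) = R y h" if "y \<in> carrier Q" "h \<in> H" for y h
  proof (rule adjt_unique[OF hilbert_space_csubspace[OF H]])
    show "R y h \<in> H" by (rule operator_rep_in[OF rep_R that])
    fix k assume k: "k \<in> H"
    have "cinner (U y (I h)) (I k) = cinner (orthogonal_projection (I ` H) (U y (I h))) (I k)"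
      using k by (simp add: orthogonal_projection_cinner[OF IH])
    also have "\<dots> = cinner (I (R y h)) (I k)"
      using dil that by (simp add: isometric_dilation_def)
    also have "\<dots> = cinner (R y h) k"
      using k that by (simp add: I_cinner operator_rep_in[OF rep_R])
    finally show "cinner (I k) (U y (I h)) = cinner k (R y h)"
      by (metis cinner_commute)
  qed
  show "proj (U p (U y (I h))) = R p (proj (U y (I h)))" if "y \<in> carrier Q" "h \<in> H" for y h
    using gen[of "p \<otimes> y" h] gen[of y h] p that
    by (simp add: min.V_mult I_M operator_rep_mult[OF rep_R])
qed

end

section \<open>Free products\<close>

lemma free_words_append [simp]: "u @ v \<in> free_words Q P \<longleftrightarrow> u \<in> free_words Q P \<and> v \<in> free_words Q P"
  by (auto simp: free_words_def)

lemma free_words_simps [simp]: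
  "[] \<in> free_words Q P"
  "Inl q # w \<in> free_words Q P \<longleftrightarrow> q \<in> carrier Q \<and> w \<in> free_words Q P"
  "Inr p # w \<in> free_words Q P \<longleftrightarrow> p \<in> carrier P \<and> w \<in> free_words Q P"
  by (auto simp: free_words_def)

locale free_factors = Q: monoid Q + P: monoid P
  for Q :: "('q, 'm) monoid_scheme" and P :: "('p, 'n) monoid_scheme"
begin

abbreviation "words \<equiv> free_words Q P"
abbreviation "cls w \<equiv> free_product_rel Q P `` {w}"

lemma step_words: "free_product_step Q P u v \<Longrightarrow> u \<in> words \<and> v \<in> words"
  by (induction rule: free_product_step.induct) auto

lemma equiv_rel: "equiv words (free_product_rel Q P)"
proof (rule equivI)
  show "free_product_rel Q P \<subseteq> words \<times> words" by (auto simp: free_product_rel_def)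
  show "refl_on words (free_product_rel Q P)"
    by (auto simp: free_product_rel_def refl_on_def)
  show "sym (free_product_rel Q P)"
    by (auto simp: free_product_rel_def sym_def intro: equivclp_sym)
  show "trans (free_product_rel Q P)"
    by (auto simp: free_product_rel_def trans_def intro: equivclp_trans)
qed

lemma step_context:
  assumes "free_product_step Q P u v" "x \<in> words" "y \<in> words"
  shows "free_product_step Q P (x @ u @ y) (x @ v @ y)"
  using assms(1)
proof cases
  case (one_left a b)
  then show ?thesis
    using free_product_step.one_left[of "x @ a" Q P "b @ y"] assms by simp
next
  case (one_right a b)
  then show ?thesis
    using free_product_step.one_right[of "x @ a" Q P "b @ y"] assms by simp
next
  case (mult_left a b c d)
  then show ?thesis
    using free_product_step.mult_left[of "x @ a" Q P "b @ y" c d] assms by simp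
next
  case (mult_right a b c d)
  then show ?thesis
    using free_product_step.mult_right[of "x @ a" Q P "b @ y" c d] assms by simp
qed

lemma step_rel: "free_product_step Q P u v \<Longrightarrow> (u, v) \<in> free_product_rel Q P"
  using step_words by (auto simp: free_product_rel_def)

lemma rel_context:
  assumes "(u, v) \<in> free_product_rel Q P" "x \<in> words" "y \<in> words"
  shows "(x @ u @ y, x @ v @ y) \<in> free_product_rel Q P"
proof -
  have "equivclp (free_product_step Q P) u v" using assms(1) by (simp add: free_product_rel_def)
  then have "equivclp (free_product_step Q P) (x @ u @ y) (x @ v @ y)"
  proof (induction rule: equivclp_induct)
    case (step v v')
    then have "equivclp (free_product_step Q P) (x @ v @ y) (x @ v' @ y)"
      using step_context[OF _ assms(2,3)] by blast
    with step.IH show ?case by (rule equivclp_trans)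
  qed simp
  then show ?thesis using assms by (auto simp: free_product_rel_def)
qed

lemma rel_trans: "\<lbrakk>(u, v) \<in> free_product_rel Q P; (v, w) \<in> free_product_rel Q P\<rbrakk> \<Longrightarrow> (u, w) \<in> free_product_rel Q P"
  using equiv_rel by (meson equivE transE)

lemma rel_sym: "(u, v) \<in> free_product_rel Q P \<Longrightarrow> (v, u) \<in> free_product_rel Q P"
  using equiv_rel by (meson equivE symE)

lemma rel_refl: "u \<in> words \<Longrightarrow> (u, u) \<in> free_product_rel Q P"
  by (simp add: free_product_rel_def)

lemma cls_eqI: "(u, v) \<in> free_product_rel Q P \<Longrightarrow> cls u = cls v"
  by (rule equiv_class_eq[OF equiv_rel])

lemma carrier_free_product: "X \<in> carrier (free_product Q P) \<longleftrightarrow> (\<exists>w\<in>words. X = cls w)"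
  by (auto simp: free_product_def quotient_def)

lemma mult_cls:
  assumes "u \<in> words" "v \<in> words"
  shows "cls u \<otimes>\<^bsub>free_product Q P\<^esub> cls v = cls (u @ v)"
proof -
  have "cls (u' @ v') = cls (u @ v)" if "u' \<in> cls u" "v' \<in> cls v" for u' v'
  proof -
    have r: "(u, u') \<in> free_product_rel Q P" "(v, v') \<in> free_product_rel Q P" using that by auto
    then have w: "u' \<in> words" "v' \<in> words" by (auto simp: free_product_rel_def)
    have "(u @ v, u' @ v) \<in> free_product_rel Q P" "(u' @ v, u' @ v') \<in> free_product_rel Q P"
      using rel_context[OF r(1), of "[]" v] rel_context[OF r(2), of u' "[]"] assms w by simp_all
    then show ?thesis using rel_trans cls_eqI by metis
  qed
  moreover have "u \<in> cls u" "v \<in> cls v" using assms rel_refl by auto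
  ultimately show ?thesis
    unfolding free_product_def monoid.simps by blast
qed

lemma one_cls: "\<one>\<^bsub>free_product Q P\<^esub> = cls []"
  by (simp add: free_product_def)

lemma bounded_word:
  assumes "operator_rep Q H R" "operator_rep P H T" "w \<in> words"
  shows "bounded_operator H H (word_operator R T w)"
  using assms
proof (induction R T w rule: word_operator.induct)
  case (1 R T)
  then show ?case by (auto simp: bounded_operator_def intro: exI[of _ 1])
next
  case (2 R T q w)
  then show ?case
    using bounded_operator_comp[of H H "word_operator R T w" H "R q"]
    by (simp add: operator_rep_bounded comp_def)
next
  case (3 R T p w)
  then show ?case
    using bounded_operator_comp[of H H "word_operator R T w" H "T p"]
    by (simp add: operator_rep_bounded comp_def)
qed

lemma bounded_operator_cong:
  "(\<And>x. x \<in> H \<Longrightarrow> A x = B x) \<Longrightarrow> csubspace H \<Longrightarrow> bounded_operator H K A \<longleftrightarrow> bounded_operator H K B"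
  by (auto simp: bounded_operator_def csubspace_def)

lemma operator_rep_free_product:
  assumes "operator_rep Q H R" "operator_rep P H T" "csubspace H"
  shows "operator_rep (free_product Q P) H (free_product_rep R T)"
  unfolding operator_rep_def
proof (intro conjI ballI)
  note rep_cls = free_product_rep_class[OF assms(1,2)]
  show "bounded_operator H H (free_product_rep R T X)" if X: "X \<in> carrier (free_product Q P)" for X
  proof -
    obtain w where w: "w \<in> words" "X = cls w" using X by (auto simp: carrier_free_product)
    then show ?thesis
      using bounded_word[OF assms(1,2) w(1)] rep_cls[OF w(1)] assms(3)
        bounded_operator_cong[of H "free_product_rep R T X" "word_operator R T w"] by simp
  qed
  show "free_product_rep R T \<one>\<^bsub>free_product Q P\<^esub> x = x" if "x \<in> H" for x
    using rep_cls[of "[]" x] that by (simp add: one_cls)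
  fix X Y x assume "X \<in> carrier (free_product Q P)" "Y \<in> carrier (free_product Q P)" and x: "x \<in> H"
  then obtain u v where uv: "u \<in> words" "X = cls u" "v \<in> words" "Y = cls v"
    by (auto simp: carrier_free_product)
  show "free_product_rep R T (X \<otimes>\<^bsub>free_product Q P\<^esub> Y) x = free_product_rep R T X (free_product_rep R T Y x)"
    using uv x rep_cls word_operator_in_space[OF assms(1,2)]
    by (simp add: mult_cls word_operator_append)
qed

lemma isometric_rep_free_product:
  assumes "isometric_rep Q K R" "isometric_rep P K T" "csubspace K"
  shows "isometric_rep (free_product Q P) K (free_product_rep R T)"
proof -
  have rep: "operator_rep Q K R" "operator_rep P K T"
    using assms by (auto simp: isometric_rep_def)
  have norm: "norm (word_operator R T w x) = norm x" if "w \<in> words" "x \<in> K" for w x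
    using that(1)
  proof (induction w)
    case (Cons a w)
    have "word_operator R T w x \<in> K"
      using word_operator_in_space[OF rep _ that(2)] Cons.prems by (cases a) auto
    then show ?case
      using assms(1,2) Cons by (cases a) (auto simp: isometric_rep_def linear_isometry_def)
  qed simp
  have fp: "operator_rep (free_product Q P) K (free_product_rep R T)"
    by (rule operator_rep_free_product[OF rep assms(3)])
  then show ?thesis
    unfolding isometric_rep_def linear_isometry_def
    using norm free_product_rep_class[OF rep]
    by (auto simp: operator_rep_bounded carrier_free_product)
qed

lemma word_intertwine:
  assumes "\<And>q x. q \<in> carrier Q \<Longrightarrow> x \<in> K \<Longrightarrow> R' q x \<in> K \<and> A (R' q x) = R q (A x)"
    and "\<And>p x. p \<in> carrier P \<Longrightarrow> x \<in> K \<Longrightarrow> T' p x \<in> K \<and> A (T' p x) = T p (A x)"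
    and "w \<in> words" "x \<in> K"
  shows "word_operator R' T' w x \<in> K \<and> A (word_operator R' T' w x) = word_operator R T w (A x)"
  using assms(3)
proof (induction w)
  case (Cons a w)
  then show ?case
    using assms(1,2) by (cases a) auto
qed (use assms(4) in simp)

end

section \<open>The free product with the natural numbers\<close>

text \<open>The list \<open>[p\<^sub>0, \<dots>, p\<^sub>k]\<close> stands for \<open>p\<^sub>0 s p\<^sub>1 s \<dots> s p\<^sub>k\<close>, where \<open>s\<close> is the generator of
  the natural numbers; every element of the free product has exactly one such form.\<close>

primrec alt_mult :: "('p, 'm) monoid_scheme \<Rightarrow> 'p list \<Rightarrow> 'p list \<Rightarrow> 'p list" where
  "alt_mult P [] m = m"
| "alt_mult P (p # l) m = (if l = [] then (p \<otimes>\<^bsub>P\<^esub> hd m) # tl m else p # alt_mult P l m)"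

definition alt_monoid :: "('p, 'm) monoid_scheme \<Rightarrow> 'p list monoid" where
  "alt_monoid P = \<lparr>carrier = {l. l \<noteq> [] \<and> set l \<subseteq> carrier P}, mult = alt_mult P, one = [\<one>\<^bsub>P\<^esub>]\<rparr>"

lemma alt_monoid_simps [simp]:
  "l \<in> carrier (alt_monoid P) \<longleftrightarrow> l \<noteq> [] \<and> set l \<subseteq> carrier P"
  "mult (alt_monoid P) = alt_mult P" "one (alt_monoid P) = [\<one>\<^bsub>P\<^esub>]"
  by (simp_all add: alt_monoid_def)

text \<open>One \<open>S\<close> stands between consecutive letters. The empty list lies outside the
  carrier and acts as the identity by default.\<close>

primrec alt_rep :: "('p \<Rightarrow> 'a \<Rightarrow> 'a) \<Rightarrow> ('a \<Rightarrow> 'a) \<Rightarrow> 'p list \<Rightarrow> 'a \<Rightarrow> 'a" where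
  "alt_rep T S [] x = x"
| "alt_rep T S (p # l) x = (if l = [] then T p x else T p (S (alt_rep T S l x)))"

lemma alt_mult_eq_Nil [simp]: "alt_mult P l m = [] \<longleftrightarrow> l = [] \<and> m = []"
  by (cases l) auto

context right_lcm_monoid
begin

lemma alt_mult_closed: "\<lbrakk>set l \<subseteq> carrier P; m \<noteq> []; set m \<subseteq> carrier P\<rbrakk> \<Longrightarrow> set (alt_mult P l m) \<subseteq> carrier P"
  by (induction l) (cases m; auto)+

lemma alt_mult_assoc:
  "\<lbrakk>l \<noteq> []; set l \<subseteq> carrier P; m \<noteq> []; set m \<subseteq> carrier P; n \<noteq> []; set n \<subseteq> carrier P\<rbrakk> \<Longrightarrow>
     alt_mult P (alt_mult P l m) n = alt_mult P l (alt_mult P m n)"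
proof (induction l)
  case (Cons p l)
  show ?case
  proof (cases "l = []")
    case True
    then show ?thesis
      using Cons.prems by (cases m; cases n) (auto simp: m_assoc)
  next
    case False
    then show ?thesis using Cons by simp
  qed
qed simp

lemma alt_mult_one: "\<lbrakk>m \<noteq> []; set m \<subseteq> carrier P\<rbrakk> \<Longrightarrow> alt_mult P [\<one>] m = m"
  by (cases m) auto

lemma alt_mult_one_right: "\<lbrakk>l \<noteq> []; set l \<subseteq> carrier P\<rbrakk> \<Longrightarrow> alt_mult P l [\<one>] = l"
  by (induction l) auto

lemma monoid_alt: "monoid (alt_monoid P)"
  by (rule monoidI)
     (auto simp: alt_mult_assoc alt_mult_one[simplified] alt_mult_one_right dest: subsetD[OF alt_mult_closed])

lemma alt_mult_left_cancel:
  "\<lbrakk>l \<noteq> []; set l \<subseteq> carrier P; m \<noteq> []; set m \<subseteq> carrier P; n \<noteq> []; set n \<subseteq> carrier P;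
    alt_mult P l m = alt_mult P l n\<rbrakk> \<Longrightarrow> m = n"
proof (induction l)
  case (Cons p l)
  then show ?case
    by (cases "l = []"; cases m; cases n) (auto dest: left_cancel)
qed simp

lemma alt_ideal_single:
  assumes "p \<in> carrier P"
  shows "x \<in> [p] <#\<^bsub>alt_monoid P\<^esub> carrier (alt_monoid P) \<longleftrightarrow>
    (\<exists>h t. x = h # t \<and> h \<in> p <# carrier P \<and> set t \<subseteq> carrier P)"
proof
  assume "x \<in> [p] <#\<^bsub>alt_monoid P\<^esub> carrier (alt_monoid P)"
  then obtain m where "m \<noteq> []" "set m \<subseteq> carrier P" "x = alt_mult P [p] m"
    by (auto simp: l_coset_iff)
  then show "\<exists>h t. x = h # t \<and> h \<in> p <# carrier P \<and> set t \<subseteq> carrier P"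
    by (cases m) (auto simp: l_coset_iff)
next
  assume "\<exists>h t. x = h # t \<and> h \<in> p <# carrier P \<and> set t \<subseteq> carrier P"
  then obtain c t where "c \<in> carrier P" "x = (p \<otimes> c) # t" "set t \<subseteq> carrier P"
    by (auto simp: l_coset_iff)
  then show "x \<in> [p] <#\<^bsub>alt_monoid P\<^esub> carrier (alt_monoid P)"
    by (auto simp: l_coset_iff intro!: bexI[of _ "c # t"])
qed

text \<open>Once a separator follows the first letter, no right factor can reach that letter; so
  ideals of longer words are compared after deleting it.\<close>

lemma alt_ideal_Cons:
  assumes "l \<noteq> []"
  shows "x \<in> (p # l) <#\<^bsub>alt_monoid P\<^esub> carrier (alt_monoid P) \<longleftrightarrow>
    (\<exists>t. x = p # t \<and> t \<in> l <#\<^bsub>alt_monoid P\<^esub> carrier (alt_monoid P))"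
  using assms by (auto simp: l_coset_iff)

lemma alt_lcm_single:
  assumes "lcm_pair P p q a b" "p \<in> carrier P" "q \<in> carrier P"
  shows "lcm_pair (alt_monoid P) [p] [q] [a] [b]"
proof -
  have "p \<otimes> a \<in> carrier P" "(p <# carrier P) \<inter> (q <# carrier P) = (p \<otimes> a) <# carrier P"
    using assms by (auto simp: lcm_pair_def)
  then have "([p] <#\<^bsub>alt_monoid P\<^esub> carrier (alt_monoid P)) \<inter> ([q] <#\<^bsub>alt_monoid P\<^esub> carrier (alt_monoid P)) =
      [p \<otimes> a] <#\<^bsub>alt_monoid P\<^esub> carrier (alt_monoid P)"
    using assms(2,3) by (auto simp: alt_ideal_single set_eq_iff)
  then show ?thesis
    using assms by (auto simp: lcm_pair_def)
qed

lemma alt_disjoint_single: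
  "\<lbrakk>disjoint_ideals P p q; p \<in> carrier P; q \<in> carrier P\<rbrakk> \<Longrightarrow> disjoint_ideals (alt_monoid P) [p] [q]"
  by (auto simp: disjoint_ideals_def alt_ideal_single)

text \<open>The longer word is already a multiple of \<open>[p]\<close>, so it is itself the least
  common multiple and its own cofactor is \<open>[\<one>]\<close>.\<close>

lemma alt_lcm_single_Cons:
  assumes "p \<in> carrier P" "c \<in> carrier P" "m \<noteq> []" "set m \<subseteq> carrier P"
  shows "lcm_pair (alt_monoid P) [p] ((p \<otimes> c) # m) (c # m) [\<one>]"
proof -
  have "(p \<otimes> c) # m = alt_mult P [p] (c # m)" by simp
  moreover have "(alt_mult P [p] (c # m)) <#\<^bsub>alt_monoid P\<^esub> carrier (alt_monoid P) \<subseteq>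
      [p] <#\<^bsub>alt_monoid P\<^esub> carrier (alt_monoid P)"
    using monoid.l_coset_mult_subset[OF monoid_alt, of "[p]" "c # m"] assms by simp
  ultimately show ?thesis
    using assms alt_mult_one_right[of m] by (auto simp: lcm_pair_def)
qed

lemma alt_disjoint_single_Cons:
  "\<lbrakk>q \<notin> p <# carrier P; p \<in> carrier P; m \<noteq> []\<rbrakk> \<Longrightarrow> disjoint_ideals (alt_monoid P) [p] (q # m)"
  by (auto simp: disjoint_ideals_def alt_ideal_single alt_ideal_Cons)

lemma alt_lcm_Cons:
  assumes "lcm_pair (alt_monoid P) l m a b" "l \<noteq> []" "m \<noteq> []"
  shows "lcm_pair (alt_monoid P) (p # l) (p # m) a b"
  using assms unfolding lcm_pair_def
  by (auto simp: alt_ideal_Cons set_eq_iff)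

lemma alt_disjoint_Cons:
  "\<lbrakk>disjoint_ideals (alt_monoid P) l m; l \<noteq> []; m \<noteq> []\<rbrakk> \<Longrightarrow> disjoint_ideals (alt_monoid P) (p # l) (p # m)"
  by (auto simp: disjoint_ideals_def alt_ideal_Cons set_eq_iff)

lemma alt_disjoint_neq:
  "\<lbrakk>p \<noteq> q; l \<noteq> []; m \<noteq> []\<rbrakk> \<Longrightarrow> disjoint_ideals (alt_monoid P) (p # l) (q # m)"
  by (auto simp: disjoint_ideals_def alt_ideal_Cons)

text \<open>The pattern for every comparison of two words: strip equal first letters until these
  differ or one word is down to a single letter. \<open>sym\<close> covers the case where that is
  the second word.\<close>

lemma alt_pair_induct [consumes 2, case_names sym single single_Cons Cons neq]:
  assumes l: "l \<in> carrier (alt_monoid P)" and m: "m \<in> carrier (alt_monoid P)"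
    and sym: "\<And>l m. \<lbrakk>l \<in> carrier (alt_monoid P); m \<in> carrier (alt_monoid P); \<Phi> l m\<rbrakk> \<Longrightarrow> \<Phi> m l"
    and single: "\<And>p q. \<lbrakk>p \<in> carrier P; q \<in> carrier P\<rbrakk> \<Longrightarrow> \<Phi> [p] [q]"
    and single_Cons: "\<And>p q m. \<lbrakk>p \<in> carrier P; q \<in> carrier P; m \<in> carrier (alt_monoid P)\<rbrakk> \<Longrightarrow> \<Phi> [p] (q # m)"
    and Cons: "\<And>p l m. \<lbrakk>p \<in> carrier P; l \<in> carrier (alt_monoid P); m \<in> carrier (alt_monoid P); \<Phi> l m\<rbrakk>
      \<Longrightarrow> \<Phi> (p # l) (p # m)"
    and neq: "\<And>p q l m. \<lbrakk>p \<noteq> q; p \<in> carrier P; q \<in> carrier P; l \<in> carrier (alt_monoid P);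
      m \<in> carrier (alt_monoid P)\<rbrakk> \<Longrightarrow> \<Phi> (p # l) (q # m)"
  shows "\<Phi> l m"
  using l m
proof (induction l arbitrary: m)
  case (Cons p l)
  then obtain q m' where m: "m = q # m'" "q \<in> carrier P" "set m' \<subseteq> carrier P"
    by (cases m) auto
  have p: "p \<in> carrier P" "set l \<subseteq> carrier P" using Cons.prems by auto
  show ?case
  proof (cases "l = []"; cases "m' = []")
    assume "l \<noteq> []" "m' = []"
    then show ?thesis
      using sym[OF _ _ single_Cons[OF m(2) p(1), of l]] p m by simp
  next
    assume "l \<noteq> []" "m' \<noteq> []"
    then show ?thesis
      using Cons.IH[of m'] assms(6)[of p l m'] neq[of p q l m'] p m by (cases "p = q") simp_all
  qed (use single single_Cons p m in auto)
qed simp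

text \<open>Least common multiples in \<open>P\<close> are needed only when both words are down to
  one letter. A single letter meets a longer word exactly if the first letter of that word is a
  multiple of it, and words with different frozen first letters never meet.\<close>

lemma right_lcm_alt: "right_lcm_monoid (alt_monoid P)"
proof -
  have ex: "(\<exists>a b. lcm_pair (alt_monoid P) l m a b) \<or> disjoint_ideals (alt_monoid P) l m"
    if "l \<in> carrier (alt_monoid P)" "m \<in> carrier (alt_monoid P)" for l m
    using that
  proof (induction l m rule: alt_pair_induct)
    case (sym l m)
    then show ?case using lcm_pair_sym disjoint_ideals_sym by metis
  next
    case (single p q)
    then show ?case
      using lcm_cases[of p q] alt_lcm_single[of p q] alt_disjoint_single[of p q] by metis
  next
    case (single_Cons p q m)
    then show ?case
      using alt_lcm_single_Cons[of p _ m] alt_disjoint_single_Cons[of q p m]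
      by (cases "q \<in> p <# carrier P") (auto simp: l_coset_iff)
  next
    case (Cons p l m)
    then have "l \<noteq> []" "m \<noteq> []" by auto
    then show ?case
      using Cons alt_lcm_Cons[of l m] alt_disjoint_Cons[of l m p] by blast
  next
    case (neq p q l m)
    then show ?case using alt_disjoint_neq by auto
  qed
  have "right_lcm_monoid_axioms (alt_monoid P)"
  proof
    fix p q r assume "p \<in> carrier (alt_monoid P)" "q \<in> carrier (alt_monoid P)" "r \<in> carrier (alt_monoid P)"
      "p \<otimes>\<^bsub>alt_monoid P\<^esub> q = p \<otimes>\<^bsub>alt_monoid P\<^esub> r"
    then show "q = r" using alt_mult_left_cancel[of p q r] by simp
  next
    fix p q assume pq: "p \<in> carrier (alt_monoid P)" "q \<in> carrier (alt_monoid P)"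
    have "p \<otimes>\<^bsub>alt_monoid P\<^esub> a \<in> carrier (alt_monoid P)" if "lcm_pair (alt_monoid P) p q a b" for a b
      using monoid.m_closed[OF monoid_alt pq(1), of a] that by (auto simp: lcm_pair_def)
    then show "(p <#\<^bsub>alt_monoid P\<^esub> carrier (alt_monoid P)) \<inter> (q <#\<^bsub>alt_monoid P\<^esub> carrier (alt_monoid P)) = {} \<or>
        (\<exists>r\<in>carrier (alt_monoid P). (p <#\<^bsub>alt_monoid P\<^esub> carrier (alt_monoid P)) \<inter>
          (q <#\<^bsub>alt_monoid P\<^esub> carrier (alt_monoid P)) = r <#\<^bsub>alt_monoid P\<^esub> carrier (alt_monoid P))"
      using ex[OF pq] unfolding lcm_pair_def disjoint_ideals_def by blast
  qed
  then show ?thesis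
    using monoid_alt by (simp add: right_lcm_monoid_def)
qed

end

text \<open>Connects alternating lists, where ideals can be computed, with the quotient of words:
  regularity is pulled back along \<open>\<psi>\<close>, Nica-covariance is pushed forward.\<close>

locale monoid_iso = A: monoid A + B: monoid B
  for A :: "('a, 'm) monoid_scheme" and B :: "('b, 'n) monoid_scheme" +
  fixes \<psi> :: "'a \<Rightarrow> 'b"
  assumes bij: "bij_betw \<psi> (carrier A) (carrier B)"
    and mult: "\<lbrakk>x \<in> carrier A; y \<in> carrier A\<rbrakk> \<Longrightarrow> \<psi> (x \<otimes>\<^bsub>A\<^esub> y) = \<psi> x \<otimes>\<^bsub>B\<^esub> \<psi> y"
    and one: "\<psi> \<one>\<^bsub>A\<^esub> = \<one>\<^bsub>B\<^esub>"
begin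

lemma in_B: "x \<in> carrier A \<Longrightarrow> \<psi> x \<in> carrier B"
  using bij by (auto simp: bij_betw_def)

lemma eq_iff: "\<lbrakk>x \<in> carrier A; y \<in> carrier A\<rbrakk> \<Longrightarrow> \<psi> x = \<psi> y \<longleftrightarrow> x = y"
  using bij by (auto simp: bij_betw_def inj_on_def)

lemma B_E:
  assumes "y \<in> carrier B" obtains x where "x \<in> carrier A" "y = \<psi> x"
  using assms bij by (auto simp: bij_betw_def)

lemma ideal:
  assumes p: "p \<in> carrier A"
  shows "\<psi> p <#\<^bsub>B\<^esub> carrier B = \<psi> ` (p <#\<^bsub>A\<^esub> carrier A)"
proof (rule Set.set_eqI)
  fix y
  have "y \<in> \<psi> p <#\<^bsub>B\<^esub> carrier B \<longleftrightarrow> (\<exists>a\<in>carrier A. y = \<psi> p \<otimes>\<^bsub>B\<^esub> \<psi> a)"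
    unfolding l_coset_iff using B_E in_B by metis
  also have "\<dots> \<longleftrightarrow> y \<in> \<psi> ` (p <#\<^bsub>A\<^esub> carrier A)"
    using p by (auto simp: image_iff Bex_def l_coset_iff mult)
  finally show "y \<in> \<psi> p <#\<^bsub>B\<^esub> carrier B \<longleftrightarrow> y \<in> \<psi> ` (p <#\<^bsub>A\<^esub> carrier A)" .
qed

lemma ideal_Int:
  assumes "p \<in> carrier A" "q \<in> carrier A"
  shows "(\<psi> p <#\<^bsub>B\<^esub> carrier B) \<inter> (\<psi> q <#\<^bsub>B\<^esub> carrier B) =
    \<psi> ` ((p <#\<^bsub>A\<^esub> carrier A) \<inter> (q <#\<^bsub>A\<^esub> carrier A))"
proof -
  have "inj_on \<psi> (carrier A)" using bij by (simp add: bij_betw_def)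
  moreover have "p <#\<^bsub>A\<^esub> carrier A \<subseteq> carrier A" "q <#\<^bsub>A\<^esub> carrier A \<subseteq> carrier A"
    using assms by (auto simp: l_coset_iff)
  ultimately show ?thesis
    by (simp add: ideal assms inj_on_image_Int)
qed

lemma ideal_Int_eq:
  assumes "p \<in> carrier A" "q \<in> carrier A" "r \<in> carrier A"
  shows "(\<psi> p <#\<^bsub>B\<^esub> carrier B) \<inter> (\<psi> q <#\<^bsub>B\<^esub> carrier B) = \<psi> r <#\<^bsub>B\<^esub> carrier B \<longleftrightarrow>
    (p <#\<^bsub>A\<^esub> carrier A) \<inter> (q <#\<^bsub>A\<^esub> carrier A) = r <#\<^bsub>A\<^esub> carrier A"
  unfolding ideal_Int[OF assms(1,2)] ideal[OF assms(3)]
proof (rule inj_on_image_eq_iff)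
  show "inj_on \<psi> (carrier A)" using bij by (simp add: bij_betw_def)
qed (use assms in \<open>auto simp: l_coset_iff\<close>)

lemma ideal_Int_empty:
  assumes "p \<in> carrier A" "q \<in> carrier A"
  shows "(\<psi> p <#\<^bsub>B\<^esub> carrier B) \<inter> (\<psi> q <#\<^bsub>B\<^esub> carrier B) = {} \<longleftrightarrow>
    (p <#\<^bsub>A\<^esub> carrier A) \<inter> (q <#\<^bsub>A\<^esub> carrier A) = {}"
  unfolding ideal_Int[OF assms] by simp

lemma nica_covariant_transfer:
  assumes "nica_covariant A K V" and "hilbert_space K"
    and V: "\<And>p. p \<in> carrier A \<Longrightarrow> bounded_operator K K (V p)"
    and eq: "\<And>p x. p \<in> carrier A \<Longrightarrow> x \<in> K \<Longrightarrow> V' (\<psi> p) x = V p x"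
  shows "nica_covariant B K V'"
proof -
  have adj: "hilbert_adjoint K (V' (\<psi> p)) = adjt K (V p)" if "p \<in> carrier A" for p
    unfolding hilbert_adjoint_adjt by (rule adjt_cong) (simp add: eq that)
  have 1: "V' (\<psi> p) (adjt K (V p) x) = V p (adjt K (V p) x)" if "p \<in> carrier A" for p x
    by (rule eq[OF that adjt_in[OF assms(2) V[OF that]]])
  have in_K: "V p (adjt K (V p) x) \<in> K" if "p \<in> carrier A" for p x
    using bounded_operator_in[OF V[OF that] adjt_in[OF assms(2) V[OF that]]] .
  have nica: "(\<forall>r\<in>carrier A. (p <#\<^bsub>A\<^esub> carrier A) \<inter> (q <#\<^bsub>A\<^esub> carrier A) = r <#\<^bsub>A\<^esub> carrier A \<longrightarrow>
           (\<forall>x\<in>K. V p (adjt K (V p) (V q (adjt K (V q) x))) = V r (adjt K (V r) x))) \<and>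
        ((p <#\<^bsub>A\<^esub> carrier A) \<inter> (q <#\<^bsub>A\<^esub> carrier A) = {} \<longrightarrow>
           (\<forall>x\<in>K. V p (adjt K (V p) (V q (adjt K (V q) x))) = 0))"
    if "p \<in> carrier A" "q \<in> carrier A" for p q
    using assms(1) that unfolding nica_covariant_def hilbert_adjoint_adjt by blast
  show ?thesis
    unfolding nica_covariant_def
  proof (intro ballI)
    fix P Q assume "P \<in> carrier B" "Q \<in> carrier B"
    then obtain p q where pq: "p \<in> carrier A" "P = \<psi> p" "q \<in> carrier A" "Q = \<psi> q"
      by (metis B_E)
    show "(\<forall>r\<in>carrier B. (P <#\<^bsub>B\<^esub> carrier B) \<inter> (Q <#\<^bsub>B\<^esub> carrier B) = r <#\<^bsub>B\<^esub> carrier B \<longrightarrow>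
           (\<forall>x\<in>K. V' P (hilbert_adjoint K (V' P) (V' Q (hilbert_adjoint K (V' Q) x))) =
                   V' r (hilbert_adjoint K (V' r) x))) \<and>
        ((P <#\<^bsub>B\<^esub> carrier B) \<inter> (Q <#\<^bsub>B\<^esub> carrier B) = {} \<longrightarrow>
           (\<forall>x\<in>K. V' P (hilbert_adjoint K (V' P) (V' Q (hilbert_adjoint K (V' Q) x))) = 0))"
    proof (intro conjI ballI impI)
      fix R x assume R: "R \<in> carrier B" "(P <#\<^bsub>B\<^esub> carrier B) \<inter> (Q <#\<^bsub>B\<^esub> carrier B) = R <#\<^bsub>B\<^esub> carrier B"
        and x: "x \<in> K"
      from R(1) obtain r where r: "r \<in> carrier A" "R = \<psi> r" by (rule B_E)
      show "V' P (hilbert_adjoint K (V' P) (V' Q (hilbert_adjoint K (V' Q) x))) =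
          V' R (hilbert_adjoint K (V' R) x)"
        using nica[OF pq(1,3)] R(2) ideal_Int_eq[OF pq(1,3) r(1)] pq r x by (simp add: adj 1 in_K)
    next
      fix x assume "(P <#\<^bsub>B\<^esub> carrier B) \<inter> (Q <#\<^bsub>B\<^esub> carrier B) = {}" and x: "x \<in> K"
      then show "V' P (hilbert_adjoint K (V' P) (V' Q (hilbert_adjoint K (V' Q) x))) = 0"
        using nica[OF pq(1,3)] ideal_Int_empty[OF pq(1,3)] pq by (simp add: adj 1 in_K)
    qed
  qed
qed

lemma star_regular_transfer:
  assumes reg: "star_regular_dilation B H R L I U"
    and cancel: "\<And>p q r. \<lbrakk>p \<in> carrier A; q \<in> carrier A; r \<in> carrier A; p \<otimes>\<^bsub>A\<^esub> q = p \<otimes>\<^bsub>A\<^esub> r\<rbrakk> \<Longrightarrow> q = r"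
    and H: "hilbert_space H"
    and R': "operator_rep A H R'"
    and eq: "\<And>p x. p \<in> carrier A \<Longrightarrow> x \<in> H \<Longrightarrow> R' p x = R (\<psi> p) x"
  shows "star_regular_dilation A H R' L I (\<lambda>p. U (\<psi> p))"
proof -
  have dil: "isometric_dilation B H R L I U"
    using reg by (simp add: star_regular_dilation_def)
  have iso: "isometric_rep A L (\<lambda>p. U (\<psi> p))"
    using dil by (auto simp: isometric_dilation_def isometric_rep_def operator_rep_def in_B one mult)
  have dil': "isometric_dilation A H R' L I (\<lambda>p. U (\<psi> p))"
    using dil iso by (auto simp: isometric_dilation_def in_B eq)
  have quot: "left_quotient B (\<psi> p) (\<psi> p \<otimes>\<^bsub>B\<^esub> \<psi> a) = \<psi> a" "left_quotient A p (p \<otimes>\<^bsub>A\<^esub> a) = a"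
    if "p \<in> carrier A" "a \<in> carrier A" for p a
    unfolding left_quotient_def
  proof (rule_tac [!] the_equality)
    fix s assume s: "s \<in> carrier B \<and> \<psi> p \<otimes>\<^bsub>B\<^esub> s = \<psi> p \<otimes>\<^bsub>B\<^esub> \<psi> a"
    then obtain c where c: "c \<in> carrier A" "s = \<psi> c" using B_E by blast
    then have "p \<otimes>\<^bsub>A\<^esub> c = p \<otimes>\<^bsub>A\<^esub> a"
      using s that eq_iff[of "p \<otimes>\<^bsub>A\<^esub> c" "p \<otimes>\<^bsub>A\<^esub> a"] by (simp add: mult)
    then show "s = \<psi> a" using cancel[OF that(1) c(1) that(2)] c by simp
  qed (use that cancel in \<open>auto simp: in_B\<close>)
  have adj: "hilbert_adjoint H (R' a) = hilbert_adjoint H (R (\<psi> a))" if "a \<in> carrier A" for a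
    unfolding hilbert_adjoint_adjt by (rule adjt_cong) (simp add: eq that)
  have adj_in: "hilbert_adjoint H (R' a) h \<in> H" if "a \<in> carrier A" for a h
    unfolding hilbert_adjoint_adjt by (rule adjt_in[OF H operator_rep_bounded[OF R' that]])
  show ?thesis
    unfolding star_regular_dilation_def
  proof (intro conjI ballI impI dil')
    fix p q r h
    assume pq: "p \<in> carrier A" "q \<in> carrier A" and r: "r \<in> carrier A" and h: "h \<in> H"
      and eqr: "(p <#\<^bsub>A\<^esub> carrier A) \<inter> (q <#\<^bsub>A\<^esub> carrier A) = r <#\<^bsub>A\<^esub> carrier A"
    have "r \<in> (p <#\<^bsub>A\<^esub> carrier A) \<inter> (q <#\<^bsub>A\<^esub> carrier A)"
      unfolding eqr by (rule A.l_coset_self[OF r])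
    then obtain a b where ab: "a \<in> carrier A" "r = p \<otimes>\<^bsub>A\<^esub> a" "b \<in> carrier A" "r = q \<otimes>\<^bsub>A\<^esub> b"
      by (auto simp: l_coset_iff)
    have la: "left_quotient A p r = a" "left_quotient B (\<psi> p) (\<psi> r) = \<psi> a"
      using quot[OF pq(1) ab(1)] by (simp_all add: ab(2) mult pq ab(1))
    have lb: "left_quotient A q r = b" "left_quotient B (\<psi> q) (\<psi> r) = \<psi> b"
      using quot[OF pq(2) ab(3)] by (simp_all add: ab(4) mult pq ab(3))
    have "orthogonal_projection (I ` H) (hilbert_adjoint L (U (\<psi> p)) (U (\<psi> q) (I h))) =
        I (R (\<psi> a) (hilbert_adjoint H (R (\<psi> b)) h))"
      using reg in_B[OF pq(1)] in_B[OF pq(2)] in_B[OF r] h ideal_Int_eq[OF pq r] eqr la(2) lb(2)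
      unfolding star_regular_dilation_def by metis
    then show "orthogonal_projection (I ` H) (hilbert_adjoint L (U (\<psi> p)) (U (\<psi> q) (I h))) =
        I (R' (left_quotient A p r) (hilbert_adjoint H (R' (left_quotient A q r)) h))"
      using ab(1,3) adj_in[OF ab(3)] by (simp add: la lb eq adj)
  next
    fix p q h
    assume pq: "p \<in> carrier A" "q \<in> carrier A" and h: "h \<in> H"
      and "(p <#\<^bsub>A\<^esub> carrier A) \<inter> (q <#\<^bsub>A\<^esub> carrier A) = {}"
    then show "orthogonal_projection (I ` H) (hilbert_adjoint L (U (\<psi> p)) (U (\<psi> q) (I h))) = 0"
      using reg in_B ideal_Int_empty[OF pq] unfolding star_regular_dilation_def by blast
  qed
qed

end

section \<open>Normal forms of words in the free product with the natural numbers\<close>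

lemma nat_monoid_simps [simp]:
  "carrier nat_monoid = UNIV" "mult nat_monoid = (+)" "one nat_monoid = 0"
  by (simp_all add: nat_monoid_def)

lemma monoid_nat_monoid: "monoid nat_monoid"
  by (rule monoidI) auto

text \<open>The normal form of a word. The power \<open>n\<close> of the generator contributes
  \<open>n\<close> separators, hence \<open>n\<close> identity letters in front of the remaining
  list.\<close>

primrec word_alt :: "('p, 'm) monoid_scheme \<Rightarrow> (nat + 'p) list \<Rightarrow> 'p list" where
  "word_alt P [] = [\<one>\<^bsub>P\<^esub>]"
| "word_alt P (a # w) = (case a of Inl n \<Rightarrow> replicate n \<one>\<^bsub>P\<^esub> @ word_alt P w
     | Inr p \<Rightarrow> (p \<otimes>\<^bsub>P\<^esub> hd (word_alt P w)) # tl (word_alt P w))"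

primrec alt_word :: "'p list \<Rightarrow> (nat + 'p) list" where
  "alt_word [] = []"
| "alt_word (p # l) = Inr p # (if l = [] then [] else Inl 1 # alt_word l)"

definition alt_class :: "('p, 'm) monoid_scheme \<Rightarrow> 'p list \<Rightarrow> (nat + 'p) list set" where
  "alt_class P l = free_product_rel nat_monoid P `` {alt_word l}"

lemma word_operator_alt_word:
  "l \<noteq> [] \<Longrightarrow> word_operator (nat_rep S) T (alt_word l) x = alt_rep T S l x"
  by (induction l) (auto simp: nat_rep_def)

context right_lcm_monoid
begin

interpretation F: free_factors nat_monoid P
  by (intro free_factors.intro monoid_nat_monoid monoid_axioms)

lemma word_alt_nonempty [simp]: "word_alt P w \<noteq> []"
  by (induction w) (auto split: sum.split)

lemma word_alt_closed: "w \<in> F.words \<Longrightarrow> set (word_alt P w) \<subseteq> carrier P"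
proof (induction w)
  case (Cons a w)
  obtain h t where ht: "word_alt P w = h # t" by (cases "word_alt P w") auto
  then show ?case using Cons by (cases a) auto
qed auto

lemma alt_mult_replicate:
  "l \<noteq> [] \<Longrightarrow> alt_mult P (replicate n \<one> @ l) m = replicate n \<one> @ alt_mult P l m"
  by (induction n) auto

lemma word_alt_append:
  "\<lbrakk>u \<in> F.words; v \<in> F.words\<rbrakk> \<Longrightarrow> word_alt P (u @ v) = alt_mult P (word_alt P u) (word_alt P v)"
proof (induction u)
  case Nil
  then show ?case
    using word_alt_closed[of v] by (cases "word_alt P v") (auto simp: word_alt_nonempty)
next
  case (Cons a u)
  show ?case
  proof (cases a)
    case (Inl n)
    then show ?thesis using Cons by (simp add: alt_mult_replicate)
  next
    case (Inr p)
    obtain h t where ht: "word_alt P u = h # t" by (cases "word_alt P u") auto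
    obtain h' t' where ht': "word_alt P v = h' # t'" by (cases "word_alt P v") auto
    have "p \<in> carrier P" "h \<in> carrier P" "h' \<in> carrier P"
      using Cons.prems word_alt_closed[of u] word_alt_closed[of v] Inr by (auto simp: ht ht')
    then show ?thesis using Cons Inr by (auto simp: ht ht' m_assoc)
  qed
qed

lemma word_alt_step:
  assumes "free_product_step nat_monoid P u v"
  shows "word_alt P u = word_alt P v"
  using assms
proof cases
  case (one_left a b)
  then show ?thesis by (simp add: word_alt_append)
next
  case (one_right a b)
  then have "word_alt P ([Inr \<one>] @ b) = word_alt P b"
    using word_alt_closed[of b] by (cases "word_alt P b") (auto simp: word_alt_nonempty)
  then show ?thesis using one_right by (simp add: word_alt_append)
next
  case (mult_left a b c d)
  then show ?thesis by (simp add: word_alt_append replicate_add)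
next
  case (mult_right a b c d)
  then have "word_alt P ([Inr c, Inr d] @ b) = word_alt P ([Inr (c \<otimes> d)] @ b)"
    using word_alt_closed[of b] by (cases "word_alt P b") (auto simp: word_alt_nonempty m_assoc)
  then show ?thesis using mult_right by (simp add: word_alt_append)
qed

lemma word_alt_rel: "(u, v) \<in> free_product_rel nat_monoid P \<Longrightarrow> word_alt P u = word_alt P v"
proof -
  assume "(u, v) \<in> free_product_rel nat_monoid P"
  then have "equivclp (free_product_step nat_monoid P) u v" by (simp add: free_product_rel_def)
  then show ?thesis
    by (induction rule: equivclp_induct) (auto dest: word_alt_step)
qed

lemma alt_word_in: "set l \<subseteq> carrier P \<Longrightarrow> alt_word l \<in> F.words"
  by (induction l) auto

lemma word_alt_alt_word: "\<lbrakk>l \<noteq> []; set l \<subseteq> carrier P\<rbrakk> \<Longrightarrow> word_alt P (alt_word l) = l"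
  by (induction l) auto

text \<open>The existence half of the normal form theorem, \<open>word_alt_rel\<close> being the
  uniqueness half. A power of the generator is split into single steps, with an identity letter
  inserted before each.\<close>

lemma alt_word_word_alt: "w \<in> F.words \<Longrightarrow> (w, alt_word (word_alt P w)) \<in> free_product_rel nat_monoid P"
proof (induction w)
  case Nil
  then show ?case
    using F.rel_sym[OF F.step_rel[OF free_product_step.one_right[of "[]" nat_monoid P "[]"]]] by simp
next
  case (Cons a w)
  then have w: "w \<in> F.words" and IH: "(w, alt_word (word_alt P w)) \<in> free_product_rel nat_monoid P"
    by (cases a; simp)+
  show ?case
  proof (cases a)
    case (Inl n)
    have "(Inl n # alt_word l, alt_word (replicate n \<one> @ l)) \<in> free_product_rel nat_monoid P"
      if "l \<noteq> []" "set l \<subseteq> carrier P" for n l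
    proof (induction n)
      case 0
      show ?case
        using F.step_rel[OF free_product_step.one_left[of "[]" nat_monoid P "alt_word l"]] alt_word_in[OF that(2)]
        by simp
    next
      case (Suc n)
      have aw: "alt_word l \<in> F.words" by (rule alt_word_in[OF that(2)])
      have "(Inl (Suc n) # alt_word l, Inl 1 # Inl n # alt_word l) \<in> free_product_rel nat_monoid P"
        using F.rel_sym[OF F.step_rel[OF free_product_step.mult_left[of "[]" nat_monoid P "alt_word l" 1 n]]] aw
        by simp
      moreover have "(Inl 1 # Inl n # alt_word l, Inl 1 # alt_word (replicate n \<one> @ l)) \<in> free_product_rel nat_monoid P"
        using F.rel_context[OF Suc.IH, of "[Inl 1]" "[]"] by simp
      moreover have "alt_word (replicate n \<one> @ l) \<in> F.words"
        using that by (intro alt_word_in) auto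
      then have "(Inl 1 # alt_word (replicate n \<one> @ l), Inr \<one> # Inl 1 # alt_word (replicate n \<one> @ l)) \<in> free_product_rel nat_monoid P"
        using F.rel_sym[OF F.step_rel[OF free_product_step.one_right[of "[]" nat_monoid P "Inl 1 # alt_word (replicate n \<one> @ l)"]]]
        by simp
      ultimately show ?case
        using that(1) by (auto intro: F.rel_trans)
    qed
    from this[of "word_alt P w" n] have "(Inl n # alt_word (word_alt P w), alt_word (word_alt P (a # w))) \<in> free_product_rel nat_monoid P"
      using word_alt_closed[OF w] Inl by simp
    moreover have "(Inl n # w, Inl n # alt_word (word_alt P w)) \<in> free_product_rel nat_monoid P"
      using F.rel_context[OF IH, of "[Inl n]" "[]"] by simp
    ultimately show ?thesis using F.rel_trans Inl by blast
  next
    case (Inr p)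
    then have p: "p \<in> carrier P" using Cons.prems by simp
    obtain h t where ht: "word_alt P w = h # t" by (cases "word_alt P w") auto
    have h: "h \<in> carrier P" "set t \<subseteq> carrier P" using word_alt_closed[OF w] ht by auto
    have "(Inr p # w, Inr p # alt_word (h # t)) \<in> free_product_rel nat_monoid P"
      using F.rel_context[OF IH, of "[Inr p]" "[]"] p by (simp add: ht)
    moreover have "(Inr p # alt_word (h # t), alt_word ((p \<otimes> h) # t)) \<in> free_product_rel nat_monoid P"
      using F.step_rel[OF free_product_step.mult_right[of "[]" nat_monoid P "if t = [] then [] else Inl 1 # alt_word t" p h]]
        p h alt_word_in[OF h(2)] by simp
    ultimately show ?thesis using Inr ht by (auto intro: F.rel_trans)
  qed
qed

lemma cls_eq_iff:
  assumes "u \<in> F.words" "v \<in> F.words"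
  shows "F.cls u = F.cls v \<longleftrightarrow> word_alt P u = word_alt P v"
proof
  assume "F.cls u = F.cls v"
  then have "(u, v) \<in> free_product_rel nat_monoid P"
    using F.rel_refl[OF assms(2)] by blast
  then show "word_alt P u = word_alt P v" by (rule word_alt_rel)
next
  assume eq: "word_alt P u = word_alt P v"
  show "F.cls u = F.cls v"
    using F.cls_eqI[OF alt_word_word_alt[OF assms(1)]] F.cls_eqI[OF alt_word_word_alt[OF assms(2)]]
    by (simp add: eq)
qed

lemma monoid_free_product: "monoid (free_product nat_monoid P)"
proof (rule monoidI)
  fix x y z assume "x \<in> carrier (free_product nat_monoid P)" "y \<in> carrier (free_product nat_monoid P)"
    "z \<in> carrier (free_product nat_monoid P)"
  then obtain u v w where "u \<in> F.words" "v \<in> F.words" "w \<in> F.words" "x = F.cls u" "y = F.cls v" "z = F.cls w"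
    by (auto simp: F.carrier_free_product)
  then show "x \<otimes>\<^bsub>free_product nat_monoid P\<^esub> y \<otimes>\<^bsub>free_product nat_monoid P\<^esub> z =
      x \<otimes>\<^bsub>free_product nat_monoid P\<^esub> (y \<otimes>\<^bsub>free_product nat_monoid P\<^esub> z)"
    "x \<otimes>\<^bsub>free_product nat_monoid P\<^esub> y \<in> carrier (free_product nat_monoid P)"
    by (auto simp: F.mult_cls F.carrier_free_product intro!: bexI[of _ "u @ v"])
next
  fix x assume "x \<in> carrier (free_product nat_monoid P)"
  then obtain u where "u \<in> F.words" "x = F.cls u" by (auto simp: F.carrier_free_product)
  then show "\<one>\<^bsub>free_product nat_monoid P\<^esub> \<otimes>\<^bsub>free_product nat_monoid P\<^esub> x = x"
    "x \<otimes>\<^bsub>free_product nat_monoid P\<^esub> \<one>\<^bsub>free_product nat_monoid P\<^esub> = x"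
    by (simp_all add: F.one_cls F.mult_cls)
qed (auto simp: F.one_cls F.carrier_free_product intro!: bexI[of _ "[]"])

lemma alt_iso: "monoid_iso (alt_monoid P) (free_product nat_monoid P) (alt_class P)"
proof (intro monoid_iso.intro monoid_iso_axioms.intro monoid_alt monoid_free_product)
  have "inj_on (alt_class P) (carrier (alt_monoid P))"
    by (rule inj_onI) (auto simp: alt_class_def cls_eq_iff alt_word_in word_alt_alt_word)
  moreover have "alt_class P ` carrier (alt_monoid P) = carrier (free_product nat_monoid P)"
  proof (intro equalityI subsetI)
    fix X assume "X \<in> carrier (free_product nat_monoid P)"
    then obtain w where w: "w \<in> F.words" "X = F.cls w" by (auto simp: F.carrier_free_product)
    then have "X = alt_class P (word_alt P w)"
      using F.cls_eqI[OF alt_word_word_alt[OF w(1)]] by (simp add: alt_class_def)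
    then show "X \<in> alt_class P ` carrier (alt_monoid P)"
      using word_alt_closed[OF w(1)] by auto
  qed (auto simp: alt_class_def F.carrier_free_product intro!: bexI alt_word_in)
  ultimately show "bij_betw (alt_class P) (carrier (alt_monoid P)) (carrier (free_product nat_monoid P))"
    by (simp add: bij_betw_def)
  show "alt_class P (x \<otimes>\<^bsub>alt_monoid P\<^esub> y) = alt_class P x \<otimes>\<^bsub>free_product nat_monoid P\<^esub> alt_class P y"
    if "x \<in> carrier (alt_monoid P)" "y \<in> carrier (alt_monoid P)" for x y
    using that alt_mult_closed[of x y]
    by (simp add: alt_class_def F.mult_cls alt_word_in cls_eq_iff word_alt_append word_alt_alt_word)
  show "alt_class P \<one>\<^bsub>alt_monoid P\<^esub> = \<one>\<^bsub>free_product nat_monoid P\<^esub>"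
    by (simp add: alt_class_def F.one_cls cls_eq_iff)
qed

section \<open>Representations of the free product in terms of alternating lists\<close>

lemma operator_rep_nat:
  assumes "bounded_operator H H S" "csubspace H"
  shows "operator_rep nat_monoid H (nat_rep S)"
proof -
  have "bounded_operator H H (S ^^ n)" for n
  proof (induction n)
    case 0
    show ?case by (auto simp: bounded_operator_def intro: exI[of _ 1])
  next
    case (Suc n)
    then show ?case using bounded_operator_comp[OF Suc assms(1)] by (simp add: comp_def)
  qed
  then show ?thesis by (simp add: operator_rep_def nat_rep_def funpow_add)
qed

lemma alt_class_rep:
  assumes "bounded_operator H H S" "operator_rep P H T" "csubspace H"
    and "l \<in> carrier (alt_monoid P)" "x \<in> H"
  shows "free_product_rep (nat_rep S) T (alt_class P l) x = alt_rep T S l x"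
  unfolding alt_class_def
  using free_product_rep_class[OF operator_rep_nat[OF assms(1,3)] assms(2) alt_word_in assms(5)] assms(4)
  by (simp add: word_operator_alt_word)

lemma operator_rep_alt:
  assumes "bounded_operator H H S" "operator_rep P H T" "csubspace H"
  shows "operator_rep (alt_monoid P) H (alt_rep T S)"
proof -
  interpret i: monoid_iso "alt_monoid P" "free_product nat_monoid P" "alt_class P"
    by (rule alt_iso)
  have rep: "operator_rep (free_product nat_monoid P) H (free_product_rep (nat_rep S) T)"
    by (rule F.operator_rep_free_product[OF operator_rep_nat[OF assms(1,3)] assms(2,3)])
  note eq = alt_class_rep[OF assms, symmetric]
  show ?thesis
    unfolding operator_rep_def
  proof (intro conjI ballI)
    show "bounded_operator H H (alt_rep T S p)" if "p \<in> carrier (alt_monoid P)" for p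
      using operator_rep_bounded[OF rep i.in_B[OF that]] assms(3)
        F.bounded_operator_cong[of H "alt_rep T S p", OF eq[OF that]] by blast
    show "alt_rep T S \<one>\<^bsub>alt_monoid P\<^esub> x = x" if "x \<in> H" for x
      using that assms(2) by (simp add: operator_rep_one)
    fix p q x assume *: "p \<in> carrier (alt_monoid P)" "q \<in> carrier (alt_monoid P)" "x \<in> H"
    show "alt_rep T S (p \<otimes>\<^bsub>alt_monoid P\<^esub> q) x = alt_rep T S p (alt_rep T S q x)"
      unfolding eq[OF *(2,3)] eq[OF *(1) operator_rep_in[OF rep i.in_B[OF *(2)] *(3)]]
        eq[OF i.A.m_closed[OF *(1,2)] *(3)]
      unfolding i.mult[OF *(1,2)] by (rule operator_rep_mult[OF rep i.in_B[OF *(1)] i.in_B[OF *(2)] *(3)])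
  qed
qed

lemma isometric_rep_nat:
  assumes "linear_isometry K K V" "csubspace K"
  shows "isometric_rep nat_monoid K (nat_rep V)"
proof -
  have in_K: "V x \<in> K" if "x \<in> K" for x
    using assms(1) that by (auto simp: linear_isometry_def bounded_operator_def)
  have "(V ^^ n) x \<in> K \<and> norm ((V ^^ n) x) = norm x" if "x \<in> K" for n x
    by (induction n) (use that assms(1) in_K in \<open>auto simp: linear_isometry_def\<close>)
  then show ?thesis
    using operator_rep_nat[OF linear_isometry_bounded[OF assms(1)] assms(2)]
    by (auto simp: isometric_rep_def linear_isometry_def nat_rep_def operator_rep_def)
qed

lemma isometric_rep_alt:
  assumes "linear_isometry K K V" "isometric_rep P K W" "csubspace K"
  shows "isometric_rep (alt_monoid P) K (alt_rep W V)"
proof -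
  interpret i: monoid_iso "alt_monoid P" "free_product nat_monoid P" "alt_class P"
    by (rule alt_iso)
  have W: "operator_rep P K W" using assms(2) by (simp add: isometric_rep_def)
  have iso: "isometric_rep (free_product nat_monoid P) K (free_product_rep (nat_rep V) W)"
    by (rule F.isometric_rep_free_product[OF isometric_rep_nat[OF assms(1,3)] assms(2,3)])
  have rep: "operator_rep (alt_monoid P) K (alt_rep W V)"
    by (rule operator_rep_alt[OF linear_isometry_bounded[OF assms(1)] W assms(3)])
  show ?thesis
    unfolding isometric_rep_def linear_isometry_def
    using rep iso i.in_B alt_class_rep[OF linear_isometry_bounded[OF assms(1)] W assms(3), symmetric]
    by (auto simp: isometric_rep_def linear_isometry_def operator_rep_bounded simp del: alt_monoid_simps)
qed

end

section \<open>Nica-covariance for the free product\<close>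

text \<open>If \<open>W\<close> is Nica-covariant, then these two orthogonality relations are all that
  Nica-covariance of \<open>V * W\<close> requires; the second one is not implied by the first
  when \<open>P\<close> has invertible elements.\<close>

locale nica_free = right_lcm_monoid P for P (structure) +
  fixes K :: "'a::complex_inner set" and W :: "'b \<Rightarrow> 'a \<Rightarrow> 'a" and V :: "'a \<Rightarrow> 'a"
  assumes K: "hilbert_space K" and W: "isometric_rep P K W" "nica_covariant P K W"
    and V: "linear_isometry K K V"
    and orth_W: "\<lbrakk>p \<in> carrier P; p \<notin> Units P; x \<in> K; y \<in> K\<rbrakk> \<Longrightarrow> cinner (V x) (W p y) = 0"
    and orth_V: "\<lbrakk>p \<in> carrier P; q \<in> carrier P; p \<noteq> q; x \<in> K; y \<in> K\<rbrakk> \<Longrightarrow>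
      cinner (W p (V x)) (W q (V y)) = 0"
begin

sublocale W: isometric_representation P K W
  by unfold_locales (fact K, fact W(1))

sublocale A: isometric_representation "alt_monoid P" K "alt_rep W V"
proof (intro isometric_representation.intro isometric_representation_axioms.intro)
  show "monoid (alt_monoid P)" by (rule monoid_alt)
  show "hilbert_space K" by (rule K)
  show "isometric_rep (alt_monoid P) K (alt_rep W V)"
    by (rule isometric_rep_alt[OF V W(1) W.csubspace_K])
qed

lemma V_in: "x \<in> K \<Longrightarrow> V x \<in> K"
  by (rule bounded_operator_in[OF linear_isometry_bounded[OF V]])

lemma V_cinner: "x \<in> K \<Longrightarrow> y \<in> K \<Longrightarrow> cinner (V x) (V y) = cinner x y"
  by (rule linear_isometry_cinner[OF V W.csubspace_K])

lemma Ws_V: "\<lbrakk>b \<in> carrier P; b \<notin> Units P; x \<in> K\<rbrakk> \<Longrightarrow> W.Vs b (V x) = 0"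
  by (rule W.Vs_eq_zeroI) (auto simp: orth_W)

text \<open>If \<open>p\<close> and \<open>q\<close> have cofactors \<open>a\<close> and
  \<open>b\<close>, then \<open>b\<close> is not invertible, as otherwise \<open>q\<close> would be
  a multiple of \<open>p\<close>. By \<open>orth_W\<close> the adjoint at \<open>b\<close>
  annihilates the range of \<open>V\<close>.\<close>

lemma Ws_W_V:
  assumes "p \<in> carrier P" "q \<in> carrier P" "q \<notin> p <# carrier P" "x \<in> K"
  shows "W.Vs p (W q (V x)) = 0"
  using assms(1,2)
proof (cases rule: lcm_cases)
  case 1
  then show ?thesis using W.nica_disjoint[OF W(2)] assms V_in by blast
next
  case (2 a b)
  then have ab: "a \<in> carrier P" "b \<in> carrier P" "p \<otimes> a = q \<otimes> b" by (auto simp: lcm_pair_def)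
  have "b \<notin> Units P"
  proof
    assume b: "b \<in> Units P"
    then have "q = p \<otimes> (a \<otimes> inv b)"
      using ab assms by (metis Units_inv_closed Units_r_inv m_assoc r_one)
    then show False
      using assms(3) ab b by (auto simp: l_coset_iff)
  qed
  then have "W.Vs b (V x) = 0" using ab assms by (simp add: Ws_V)
  then show ?thesis
    using W.nica_lcm[OF W(2) 2 assms(1,2) V_in[OF assms(4)]]
      bounded_operator_zero[OF W.V_bounded[OF ab(1)] csubspace_0[OF W.csubspace_K]] by simp
qed

text \<open>The exchange rule for each shape of pair: adjoints give the symmetry, covariance of
  \<open>W\<close> settles single letters, \<open>Ws_W_V\<close> a letter against a longer word.
  Equal first letters cancel because \<open>W p\<close> and \<open>V\<close> are isometries, and
  different ones give zero by \<open>orth_V\<close>.\<close>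

lemma nica_covariant_alt: "nica_covariant (alt_monoid P) K (alt_rep W V)"
proof (rule A.nica_covariantI)
  fix l m assume "l \<in> carrier (alt_monoid P)" "m \<in> carrier (alt_monoid P)"
  then show "(\<exists>a b. lcm_pair (alt_monoid P) l m a b \<and>
      (\<forall>x\<in>K. A.Vs l (alt_rep W V m x) = alt_rep W V a (A.Vs b x))) \<or>
    disjoint_ideals (alt_monoid P) l m \<and> (\<forall>x\<in>K. A.Vs l (alt_rep W V m x) = 0)"
  proof (induction l m rule: alt_pair_induct)
    case (sym l m)
    then consider (lcm) a b where "lcm_pair (alt_monoid P) l m a b"
        "\<And>x. x \<in> K \<Longrightarrow> A.Vs l (alt_rep W V m x) = alt_rep W V a (A.Vs b x)"
      | (disj) "disjoint_ideals (alt_monoid P) l m" "\<And>x. x \<in> K \<Longrightarrow> A.Vs l (alt_rep W V m x) = 0"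
      by blast
    then show ?case
    proof cases
      case lcm
      then have ab: "a \<in> carrier (alt_monoid P)" "b \<in> carrier (alt_monoid P)"
        by (auto simp: lcm_pair_def)
      have "A.Vs m (alt_rep W V l x) = alt_rep W V b (A.Vs a x)" if x: "x \<in> K" for x
      proof (rule A.Vs_eqI[OF sym(2)])
        show "alt_rep W V b (A.Vs a x) \<in> K" by (intro A.V_in A.Vs_in ab)
        fix z assume z: "z \<in> K"
        have "cinner (alt_rep W V m z) (alt_rep W V l x) = cinner (A.Vs l (alt_rep W V m z)) x"
          using sym z x by (simp only: A.Vs_cinner')
        also have "\<dots> = cinner (alt_rep W V a (A.Vs b z)) x"
          by (simp only: lcm(2)[OF z])
        also have "\<dots> = cinner z (alt_rep W V b (A.Vs a x))"
          by (simp only: A.Vs_cinner[symmetric, OF ab(1) A.Vs_in[OF ab(2)]] A.Vs_cinner'[OF ab(2) A.Vs_in[OF ab(1)]])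
        finally show "cinner (alt_rep W V m z) (alt_rep W V l x) = cinner z (alt_rep W V b (A.Vs a x))" .
      qed
      then show ?thesis using lcm_pair_sym[OF lcm(1)] by blast
    next
      case disj
      have "A.Vs m (alt_rep W V l x) = 0" if x: "x \<in> K" for x
      proof (rule A.Vs_eq_zeroI[OF sym(2)])
        fix z assume z: "z \<in> K"
        show "cinner (alt_rep W V l x) (alt_rep W V m z) = 0"
          using disj(2)[OF z] A.Vs_cinner[OF sym(1) x, of "alt_rep W V m z"] by simp
      qed
      then show ?thesis using disjoint_ideals_sym[OF disj(1)] by blast
    qed
  next
    case (single p q)
    have adj: "A.Vs [r] = W.Vs r" for r by (rule adjt_cong) simp
    show ?case
      using single
    proof (cases rule: lcm_cases)
      case 1
      then show ?thesis
        using single alt_disjoint_single[OF 1] W.nica_disjoint[OF W(2) 1] by (simp add: adj)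
    next
      case (2 a b)
      have "\<forall>x\<in>K. A.Vs [p] (alt_rep W V [q] x) = alt_rep W V [a] (A.Vs [b] x)"
        using single W.nica_lcm[OF W(2) 2] by (simp add: adj)
      then show ?thesis using single alt_lcm_single[OF 2] by blast
    qed
  next
    case (single_Cons p q m)
    have adj: "A.Vs [r] = W.Vs r" for r by (rule adjt_cong) simp
    have m: "m \<noteq> []" "set m \<subseteq> carrier P" using single_Cons by auto
    have Vm: "V (alt_rep W V m x) \<in> K" if "x \<in> K" for x
      using that single_Cons by (intro V_in A.V_in)
    show ?case
    proof (cases "q \<in> p <# carrier P")
      case True
      then obtain c where c: "c \<in> carrier P" "q = p \<otimes> c" by (auto simp: l_coset_iff)
      have "A.Vs [p] (alt_rep W V (q # m) x) = alt_rep W V (c # m) (A.Vs [\<one>] x)" if x: "x \<in> K" for x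
        using W.V_mult[OF single_Cons(1) c(1) Vm[OF x]] W.Vs_V[OF single_Cons(1) W.V_in[OF c(1) Vm[OF x]]]
        by (simp add: adj m c(2) W.Vs_one[OF x])
      then show ?thesis
        using alt_lcm_single_Cons[OF single_Cons(1) c(1) m] c(2) by blast
    next
      case False
      then show ?thesis
        using alt_disjoint_single_Cons[OF False single_Cons(1) m(1)] Ws_W_V[OF single_Cons(1,2) False]
          A.V_in[OF single_Cons(3)] by (simp add: adj m)
    qed
  next
    case (Cons p l m)
    then have ne: "l \<noteq> []" "m \<noteq> []" by auto
    have in_K: "alt_rep W V l x \<in> K" "alt_rep W V m x \<in> K" if "x \<in> K" for x
      using A.V_in[OF Cons(2) that] A.V_in[OF Cons(3) that] by auto
    have "A.Vs (p # l) (alt_rep W V (p # m) x) = A.Vs l (alt_rep W V m x)" if x: "x \<in> K" for x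
    proof (rule A.Vs_eqI)
      show "p # l \<in> carrier (alt_monoid P)" using Cons by simp
      show "A.Vs l (alt_rep W V m x) \<in> K" by (rule A.Vs_in[OF Cons(2)])
      fix z assume z: "z \<in> K"
      have "cinner (alt_rep W V (p # l) z) (alt_rep W V (p # m) x) = cinner (alt_rep W V l z) (alt_rep W V m x)"
        using Cons(1) by (simp add: ne W.V_cinner V_in V_cinner in_K x z)
      also have "\<dots> = cinner z (A.Vs l (alt_rep W V m x))"
        by (rule A.Vs_cinner[OF Cons(2) z, symmetric])
      finally show "cinner (alt_rep W V (p # l) z) (alt_rep W V (p # m) x) = cinner z (A.Vs l (alt_rep W V m x))" .
    qed
    then show ?case
      using Cons(4) alt_lcm_Cons[OF _ ne] alt_disjoint_Cons[OF _ ne] by metis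
  next
    case (neq p q l m)
    then have ne: "l \<noteq> []" "m \<noteq> []" by auto
    have "A.Vs (p # l) (alt_rep W V (q # m) x) = 0" if x: "x \<in> K" for x
    proof (rule A.Vs_eq_zeroI)
      show "p # l \<in> carrier (alt_monoid P)" using neq by simp
      fix z assume z: "z \<in> K"
      show "cinner (alt_rep W V (q # m) x) (alt_rep W V (p # l) z) = 0"
        using orth_V[OF neq(3,2) neq(1)[symmetric] A.V_in[OF neq(5) x] A.V_in[OF neq(4) z]] by (simp add: ne)
    qed
    then show ?case using alt_disjoint_neq[OF neq(1) ne] by blast
  qed
qed

lemma nica_covariant_free_product:
  "nica_covariant (free_product nat_monoid P) K (free_product_rep (nat_rep V) W)"
proof -
  interpret i: monoid_iso "alt_monoid P" "free_product nat_monoid P" "alt_class P"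
    by (rule alt_iso)
  show ?thesis
    by (rule i.nica_covariant_transfer[OF nica_covariant_alt K A.V_bounded])
       (auto intro: alt_class_rep[OF linear_isometry_bounded[OF V] W.rep W.csubspace_K] simp del: alt_monoid_simps)
qed

end

section \<open>Commuting isometries on a space of words\<close>

text \<open>The facts about \<open>e\<close> below have premises \<open>w \<in> lists (carrier P)\<close>, which must stay folded.\<close>

declare in_listsD [rule del] in_listsI [rule del]

lemma cinner_zero_ccspan:
  assumes A: "bounded_operator M M' A" and B: "bounded_operator N N' B"
    and M: "hilbert_space M" "S \<subseteq> M" "x \<in> ccspan S" and N: "hilbert_space N" "T \<subseteq> N" "y \<in> ccspan T"
    and zero: "\<And>s t. s \<in> S \<Longrightarrow> t \<in> T \<Longrightarrow> cinner (A s) (B t) = 0"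
  shows "cinner (A x) (B y) = 0"
proof (rule ccspan_cinner_zero2)
  show "A x \<in> ccspan (A ` S)"
    by (rule bounded_operator_ccspan_in[OF A M(1,2) csubspace_ccspan closed_ccspan _ M(3)])
       (auto intro: ccspan_base)
  show "B y \<in> ccspan (B ` T)"
    by (rule bounded_operator_ccspan_in[OF B N(1,2) csubspace_ccspan closed_ccspan _ N(3)])
       (auto intro: ccspan_base)
qed (auto simp: zero)

text \<open>The ranges of \<open>a\<close> and of the \<open>e w\<close> are the summands of the dilation space: \<open>a\<close> embeds \<open>H\<close>,
  and \<open>e w\<close> embeds the copy of \<open>X\<close> indexed by the word \<open>w\<close>.\<close>

locale creation = right_lcm_monoid P for P (structure) +
  fixes H :: "'y::complex_inner set" and W0 :: "'b \<Rightarrow> 'y \<Rightarrow> 'y"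
    and X :: "'x::complex_inner set" and WX :: "'b \<Rightarrow> 'x \<Rightarrow> 'x"
    and a :: "'y \<Rightarrow> ell2" and e :: "'b list \<Rightarrow> 'x \<Rightarrow> ell2"
  assumes H: "hilbert_space H" and X: "hilbert_space X"
    and W0: "isometric_rep P H W0" "nica_covariant P H W0"
    and WX: "isometric_rep P X WX" "nica_covariant P X WX"
    and a_cinner: "\<lbrakk>x \<in> H; y \<in> H\<rbrakk> \<Longrightarrow> cinner (a x) (a y) = cinner x y"
    and e_cinner: "\<lbrakk>w \<in> lists (carrier P); w' \<in> lists (carrier P); x' \<in> X; y' \<in> X\<rbrakk> \<Longrightarrow>
      cinner (e w x') (e w' y') = (if w = w' then cinner x' y' else 0)"
    and a_e: "\<lbrakk>x \<in> H; w \<in> lists (carrier P); y' \<in> X\<rbrakk> \<Longrightarrow> cinner (a x) (e w y') = 0"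
begin

sublocale W0: isometric_representation P H W0
  by unfold_locales (fact H, fact W0(1))

sublocale WX: isometric_representation P X WX
  by unfold_locales (fact X, fact WX(1))

lemma e_a: "\<lbrakk>x \<in> H; w \<in> lists (carrier P); y \<in> X\<rbrakk> \<Longrightarrow> cinner (e w y) (a x) = 0"
  using a_e by (metis cinner_commute complex_cnj_zero)

lemmas cinner_gens = a_cinner e_cinner a_e e_a

lemma zero_in: "0 \<in> H" "0 \<in> X"
  using csubspace_0[OF W0.csubspace_K] csubspace_0[OF WX.csubspace_K] .

lemma a_zero: "a 0 = 0" and e_zero: "w \<in> lists (carrier P) \<Longrightarrow> e w 0 = 0"
  using a_cinner[OF zero_in(1) zero_in(1)] e_cinner[of w w 0 0] zero_in by auto

definition gens :: "ell2 set" where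
  "gens = a ` H \<union> (\<lambda>(w, y). e w y) ` (lists (carrier P) \<times> X)"

definition K :: "ell2 set" where
  "K = ccspan gens"

lemma K: "hilbert_space K"
  unfolding K_def by (rule hilbert_space_ccspan[OF subset_UNIV hilbert_space_UNIV_ell2])

lemma gens_K: "gens \<subseteq> K"
  unfolding K_def by (rule ccspan_superset)

lemma a_K: "x \<in> H \<Longrightarrow> a x \<in> K" and e_K: "\<lbrakk>w \<in> lists (carrier P); y \<in> X\<rbrakk> \<Longrightarrow> e w y \<in> K"
  using gens_K by (auto simp: gens_def)

lemma K_in: "x \<in> K \<Longrightarrow> x \<in> ccspan gens"
  by (simp add: K_def)

lemma gens_cases:
  assumes "s \<in> gens"
  obtains (a) x where "x \<in> H" "s = a x"
    | (e) w y where "w \<in> lists (carrier P)" "y \<in> X" "s = e w y"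
  using assms by (auto simp: gens_def)

lemma K_eqI:
  assumes "bounded_operator K L A" "bounded_operator K L' B"
    and "\<And>x. x \<in> H \<Longrightarrow> A (a x) = B (a x)"
    and "\<And>w y. \<lbrakk>w \<in> lists (carrier P); y \<in> X\<rbrakk> \<Longrightarrow> A (e w y) = B (e w y)" "\<xi> \<in> K"
  shows "A \<xi> = B \<xi>"
  by (rule bounded_operator_eq_on_ccspan[OF assms(1,2) K gens_K _ K_in[OF assms(5)]])
     (auto elim!: gens_cases simp: assms)

lemma K_zeroI:
  assumes "bounded_operator K L A" "bounded_operator K L' B"
    and "\<And>x y. \<lbrakk>x \<in> H; y \<in> H\<rbrakk> \<Longrightarrow> cinner (A (a x)) (B (a y)) = 0"
    and "\<And>x w y. \<lbrakk>x \<in> H; w \<in> lists (carrier P); y \<in> X\<rbrakk> \<Longrightarrow> cinner (A (a x)) (B (e w y)) = 0"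
    and "\<And>x w y. \<lbrakk>x \<in> H; w \<in> lists (carrier P); y \<in> X\<rbrakk> \<Longrightarrow> cinner (A (e w y)) (B (a x)) = 0"
    and "\<And>w w' x y. \<lbrakk>w \<in> lists (carrier P); w' \<in> lists (carrier P); x \<in> X; y \<in> X\<rbrakk>
      \<Longrightarrow> cinner (A (e w x)) (B (e w' y)) = 0"
    and "\<xi> \<in> K" "\<eta> \<in> K"
  shows "cinner (A \<xi>) (B \<eta>) = 0"
  by (rule cinner_zero_ccspan[OF assms(1,2) K gens_K K_in[OF assms(7)] K gens_K K_in[OF assms(8)]])
     (auto elim!: gens_cases simp: assms)

text \<open>The summands span \<open>K\<close>, so \<open>gram_isometry\<close> applies as soon as
  the prescribed values reproduce the inner products within and between the summands.\<close>

lemma K_extend: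
  assumes "\<And>x. x \<in> H \<Longrightarrow> fa x \<in> K"
    and "\<And>w y. \<lbrakk>w \<in> lists (carrier P); y \<in> X\<rbrakk> \<Longrightarrow> fe w y \<in> K"
    and "\<And>x y. \<lbrakk>x \<in> H; y \<in> H\<rbrakk> \<Longrightarrow> cinner (fa x) (fa y) = cinner x y"
    and "\<And>x w y. \<lbrakk>x \<in> H; w \<in> lists (carrier P); y \<in> X\<rbrakk> \<Longrightarrow> cinner (fa x) (fe w y) = 0"
    and "\<And>w w' x y. \<lbrakk>w \<in> lists (carrier P); w' \<in> lists (carrier P); x \<in> X; y \<in> X\<rbrakk>
      \<Longrightarrow> cinner (fe w x) (fe w' y) = (if w = w' then cinner x y else 0)"
  shows "\<exists>A. linear_isometry K K A \<and> (\<forall>x\<in>H. A (a x) = fa x) \<and>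
    (\<forall>w\<in>lists (carrier P). \<forall>y\<in>X. A (e w y) = fe w y)"
proof -
  define I where "I = H <+> (lists (carrier P) \<times> X)"
  have fe_fa: "\<lbrakk>x \<in> H; w \<in> lists (carrier P); y \<in> X\<rbrakk> \<Longrightarrow> cinner (fe w y) (fa x) = 0" for x w y
    using assms(4) by (metis cinner_commute complex_cnj_zero)
  define g where "g = case_sum a (\<lambda>(w, y). e w y)"
  define f where "f = case_sum fa (\<lambda>(w, y). fe w y)"
  have g_I: "g ` I = gens" by (force simp: g_def I_def gens_def)
  have 1: "g i \<in> K" if "i \<in> I" for i
    using that g_I gens_K by blast
  have 2: "f i \<in> K" if "i \<in> I" for i
    using that by (auto simp: f_def I_def assms)
  have 3: "cinner (g i) (g j) = cinner (f i) (f j)" if "i \<in> I" "j \<in> I" for i j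
    using that by (auto simp: f_def g_def I_def assms cinner_gens fe_fa)
  obtain A where A: "linear_isometry (ccspan (g ` I)) (ccspan (f ` I)) A" "\<And>i. i \<in> I \<Longrightarrow> A (g i) = f i"
    by (rule gram_isometry[of K I g K f]) (use K 1 2 3 in blast)+
  have "ccspan (f ` I) \<subseteq> K"
    by (rule ccspan_subset_hilbert[OF _ K]) (use 2 in auto)
  then have "linear_isometry K K A"
    using A(1) unfolding linear_isometry_def g_I K_def[symmetric]
    by (auto intro: bounded_operator_subset dest: bounded_operator_in)
  moreover have "A (a x) = fa x" if "x \<in> H" for x
    using A(2)[of "Inl x"] that by (auto simp: I_def g_def f_def)
  moreover have "A (e w y) = fe w y" if "w \<in> lists (carrier P)" "y \<in> X" for w y
    using A(2)[of "Inr (w, y)"] that by (auto simp: I_def g_def f_def)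
  ultimately show ?thesis by blast
qed

text \<open>A letter of an index word stands for \<open>W\<close> at that letter followed by the
  isometry to be built, so \<open>W q\<close> changes the first letter only. The copy with index
  \<open>[]\<close> has no letter and carries the given action \<open>WX\<close>.\<close>

primrec word_act :: "'b \<Rightarrow> 'b list \<Rightarrow> 'x \<Rightarrow> ell2" where
  "word_act q [] y = e [] (WX q y)"
| "word_act q (p # w) y = e ((q \<otimes> p) # w) y"

definition W :: "'b \<Rightarrow> ell2 \<Rightarrow> ell2" where
  "W q = (SOME A. linear_isometry K K A \<and> (\<forall>x\<in>H. A (a x) = a (W0 q x)) \<and>
    (\<forall>w\<in>lists (carrier P). \<forall>y\<in>X. A (e w y) = word_act q w y))"

lemma W_spec:
  assumes q: "q \<in> carrier P"
  shows "linear_isometry K K (W q) \<and> (\<forall>x\<in>H. W q (a x) = a (W0 q x)) \<and>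
    (\<forall>w\<in>lists (carrier P). \<forall>y\<in>X. W q (e w y) = word_act q w y)"
proof -
  have "\<exists>A. linear_isometry K K A \<and> (\<forall>x\<in>H. A (a x) = a (W0 q x)) \<and>
    (\<forall>w\<in>lists (carrier P). \<forall>y\<in>X. A (e w y) = word_act q w y)"
  proof (rule K_extend)
    show "a (W0 q x) \<in> K" if "x \<in> H" for x
      using that q by (intro a_K W0.V_in)
    show "word_act q w y \<in> K" if "w \<in> lists (carrier P)" "y \<in> X" for w y
      using that q by (cases w) (auto intro!: e_K WX.V_in)
    show "cinner (a (W0 q x)) (a (W0 q y)) = cinner x y" if "x \<in> H" "y \<in> H" for x y
      using that q by (simp add: a_cinner W0.V_in W0.V_cinner)
    show "cinner (a (W0 q x)) (word_act q w y) = 0" if "x \<in> H" "w \<in> lists (carrier P)" "y \<in> X" for x w y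
      using that q by (cases w) (simp_all add: a_e W0.V_in WX.V_in)
    show "cinner (word_act q w x) (word_act q w' y) = (if w = w' then cinner x y else 0)"
      if "w \<in> lists (carrier P)" "w' \<in> lists (carrier P)" "x \<in> X" "y \<in> X" for w w' x y
      using that q by (cases w; cases w') (auto simp: e_cinner WX.V_in WX.V_cinner left_cancel_iff)
  qed
  then show ?thesis unfolding W_def by (rule someI_ex)
qed

lemma W_isometry: "q \<in> carrier P \<Longrightarrow> linear_isometry K K (W q)"
  and W_a: "\<lbrakk>q \<in> carrier P; x \<in> H\<rbrakk> \<Longrightarrow> W q (a x) = a (W0 q x)"
  and W_e: "\<lbrakk>q \<in> carrier P; w \<in> lists (carrier P); y \<in> X\<rbrakk> \<Longrightarrow> W q (e w y) = word_act q w y"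
  using W_spec by blast+

lemma isometric_W: "isometric_rep P K W"
  unfolding isometric_rep_def operator_rep_def
proof (intro conjI ballI)
  fix p assume p: "p \<in> carrier P"
  show "linear_isometry K K (W p)" by (rule W_isometry[OF p])
  then show "bounded_operator K K (W p)" by (rule linear_isometry_bounded)
next
  have id: "bounded_operator K K (\<lambda>x. x)"
    by (auto simp: bounded_operator_def intro: exI[of _ 1])
  show "W \<one> \<xi> = \<xi>" if "\<xi> \<in> K" for \<xi>
  proof (rule K_eqI[OF linear_isometry_bounded[OF W_isometry[OF one_closed]] id _ _ that])
    show "W \<one> (e w y) = e w y" if "w \<in> lists (carrier P)" "y \<in> X" for w y
      using that by (cases w) (auto simp: W_e WX.V_one)
  qed (simp add: W_a W0.V_one)
  fix p q \<xi> assume pq: "p \<in> carrier P" "q \<in> carrier P" and \<xi>: "\<xi> \<in> K"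
  show "W (p \<otimes> q) \<xi> = W p (W q \<xi>)"
  proof (rule K_eqI[OF linear_isometry_bounded[OF W_isometry[OF m_closed[OF pq]]] _ _ _ \<xi>])
    show "bounded_operator K K (\<lambda>\<xi>. W p (W q \<xi>))"
      by (rule bounded_operator_comp[OF linear_isometry_bounded[OF W_isometry[OF pq(2)]]
            linear_isometry_bounded[OF W_isometry[OF pq(1)]]])
    show "W (p \<otimes> q) (e w y) = W p (W q (e w y))" if "w \<in> lists (carrier P)" "y \<in> X" for w y
      using that pq by (cases w) (auto simp: W_e WX.V_in WX.V_mult m_assoc)
  qed (use pq in \<open>auto simp: W_a W0.V_in W0.V_mult\<close>)
qed

sublocale W: isometric_representation P K W
  by unfold_locales (fact K, fact isometric_W)

lemma Ws_eqI:
  assumes "p \<in> carrier P" "z \<in> K"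
    and "\<And>x. x \<in> H \<Longrightarrow> cinner (a (W0 p x)) y = cinner (a x) z"
    and "\<And>w x. w \<in> lists (carrier P) \<Longrightarrow> x \<in> X \<Longrightarrow> cinner (word_act p w x) y = cinner (e w x) z"
  shows "W.Vs p y = z"
  unfolding K_def
proof (rule ccspan_ext)
  show "adjt (ccspan gens) (W p) y \<in> ccspan gens" "z \<in> ccspan gens"
    using W.Vs_in[OF assms(1)] assms(2) by (simp_all add: K_def)
  fix s assume s: "s \<in> gens"
  then have "s \<in> K" using gens_K by blast
  then have "cinner s (W.Vs p y) = cinner (W p s) y"
    by (rule W.Vs_cinner[OF assms(1)])
  also have "\<dots> = cinner s z"
    using s by (cases rule: gens_cases) (simp_all add: W_a W_e assms)
  finally show "cinner s (adjt (ccspan gens) (W p) y) = cinner s z" by (simp add: K_def)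
qed

lemma Ws_a:
  assumes "p \<in> carrier P" "x \<in> H"
  shows "W.Vs p (a x) = a (W0.Vs p x)"
proof (rule Ws_eqI[OF assms(1) a_K[OF W0.Vs_in[OF assms(1)]]])
  show "cinner (word_act p w y) (a x) = cinner (e w y) (a (W0.Vs p x))" if "w \<in> lists (carrier P)" "y \<in> X" for w y
    using that assms by (cases w) (simp_all add: e_a W0.Vs_in WX.V_in)
qed (use assms in \<open>simp add: a_cinner W0.V_in W0.Vs_in W0.Vs_cinner\<close>)

lemma Ws_e_Nil:
  assumes "p \<in> carrier P" "x \<in> X"
  shows "W.Vs p (e [] x) = e [] (WX.Vs p x)"
proof (rule Ws_eqI[OF assms(1) e_K[OF _ WX.Vs_in[OF assms(1)]]])
  show "cinner (word_act p w y) (e [] x) = cinner (e w y) (e [] (WX.Vs p x))" if "w \<in> lists (carrier P)" "y \<in> X" for w y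
    using that assms by (cases w) (simp_all add: e_cinner WX.V_in WX.Vs_in WX.Vs_cinner)
qed (use assms in \<open>simp_all add: a_e W0.V_in WX.Vs_in\<close>)

lemma Ws_e_Cons:
  assumes "p \<in> carrier P" "c \<in> carrier P" "w \<in> lists (carrier P)" "x \<in> X"
  shows "W.Vs p (e ((p \<otimes> c) # w) x) = e (c # w) x"
proof (rule Ws_eqI[OF assms(1) e_K])
  show "cinner (word_act p w' y) (e ((p \<otimes> c) # w) x) = cinner (e w' y) (e (c # w) x)"
    if "w' \<in> lists (carrier P)" "y \<in> X" for w' y
    using that assms by (cases w') (auto simp: e_cinner WX.V_in left_cancel_iff)
qed (use assms in \<open>simp_all add: a_e W0.V_in\<close>)

lemma Ws_e_Cons_zero:
  assumes "p \<in> carrier P" "q \<in> carrier P" "w \<in> lists (carrier P)" "x \<in> X" "q \<notin> p <# carrier P"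
  shows "W.Vs p (e (q # w) x) = 0"
proof (rule Ws_eqI[OF assms(1) csubspace_0[OF W.csubspace_K]])
  show "cinner (word_act p w' y) (e (q # w) x) = cinner (e w' y) 0"
    if "w' \<in> lists (carrier P)" "y \<in> X" for w' y
    using that assms by (cases w') (auto simp: e_cinner WX.V_in l_coset_iff)
qed (use assms in \<open>simp_all add: a_e W0.V_in\<close>)

text \<open>On \<open>H\<close> and on the copy with index \<open>[]\<close> covariance is given. On
  the other copies \<open>W\<close> is the left regular representation of \<open>P\<close> in the
  first letter, where the adjoint at \<open>p\<close> divides by \<open>p\<close> or gives
  zero.\<close>

lemma nica_W: "nica_covariant P K W"
proof (rule W.nica_covariantI)
  fix p q assume pq: "p \<in> carrier P" "q \<in> carrier P"
  have comp: "bounded_operator K K (\<lambda>x. W.Vs p (W q x))"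
    by (rule bounded_operator_comp[OF W.V_bounded[OF pq(2)] W.Vs_bounded[OF pq(1)]])
  show "(\<exists>a b. lcm_pair P p q a b \<and> (\<forall>x\<in>K. W.Vs p (W q x) = W a (W.Vs b x))) \<or>
    disjoint_ideals P p q \<and> (\<forall>x\<in>K. W.Vs p (W q x) = 0)"
    using pq
  proof (cases rule: lcm_cases)
    case 1
    have "W.Vs p (W q \<xi>) = 0" if "\<xi> \<in> K" for \<xi>
    proof (rule K_eqI[OF comp _ _ _ that, of K "\<lambda>_. 0"])
      show "bounded_operator K K (\<lambda>_. 0)"
        by (auto simp: bounded_operator_def csubspace_0[OF W.csubspace_K] intro: exI[of _ 0])
      show "W.Vs p (W q (a x)) = 0" if "x \<in> H" for x
        using that pq W0.nica_disjoint[OF W0(2) 1] by (simp add: W_a Ws_a W0.V_in a_zero)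
      show "W.Vs p (W q (e w y)) = 0" if "w \<in> lists (carrier P)" "y \<in> X" for w y
      proof (cases w)
        case Nil
        then show ?thesis
          using that pq WX.nica_disjoint[OF WX(2) 1] by (simp add: W_e Ws_e_Nil WX.V_in e_zero)
      next
        case (Cons r w')
        then have r: "r \<in> carrier P" "w' \<in> lists (carrier P)" using that by auto
        then have "q \<otimes> r \<in> q <# carrier P" by (auto simp: l_coset_iff)
        then have "q \<otimes> r \<notin> p <# carrier P" using 1 by (auto simp: disjoint_ideals_def)
        then show ?thesis
          using that pq r Cons by (simp add: W_e Ws_e_Cons_zero)
      qed
    qed
    then show ?thesis using 1 by blast
  next
    case (2 c b)
    then have cb: "c \<in> carrier P" "b \<in> carrier P" "p \<otimes> c = q \<otimes> b" by (auto simp: lcm_pair_def)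
    have "W.Vs p (W q \<xi>) = W c (W.Vs b \<xi>)" if "\<xi> \<in> K" for \<xi>
    proof (rule K_eqI[OF comp bounded_operator_comp[OF W.Vs_bounded[OF cb(2)] W.V_bounded[OF cb(1)]] _ _ that])
      show "W.Vs p (W q (a x)) = W c (W.Vs b (a x))" if "x \<in> H" for x
        using that pq cb(1,2) W0.nica_lcm[OF W0(2) 2] by (simp add: W_a Ws_a W0.V_in W0.Vs_in)
      show "W.Vs p (W q (e w y)) = W c (W.Vs b (e w y))" if wy: "w \<in> lists (carrier P)" "y \<in> X" for w y
      proof (cases w)
        case Nil
        then show ?thesis
          using wy pq cb(1,2) WX.nica_lcm[OF WX(2) 2] by (simp add: W_e Ws_e_Nil WX.V_in WX.Vs_in)
      next
        case (Cons r w')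
        then have r: "r \<in> carrier P" "w' \<in> lists (carrier P)" using wy by auto
        show ?thesis
        proof (cases "q \<otimes> r \<in> p <# carrier P")
          case True
          moreover have "q \<otimes> r \<in> q <# carrier P" using r by (auto simp: l_coset_iff)
          ultimately have "q \<otimes> r \<in> (q \<otimes> b) <# carrier P"
            using 2 by (auto simp: lcm_pair_def)
          then obtain d where d: "d \<in> carrier P" "q \<otimes> r = q \<otimes> b \<otimes> d" by (auto simp: l_coset_iff)
          have r_eq: "r = b \<otimes> d"
            using d pq cb r left_cancel[of q r "b \<otimes> d"] by (simp add: m_assoc)
          have "q \<otimes> r = p \<otimes> (c \<otimes> d)"
            using d cb pq by (metis m_assoc)
          then show ?thesis
            using wy pq cb(1,2) r d(1) Ws_e_Cons[OF pq(1), of "c \<otimes> d" w' y] Ws_e_Cons[OF cb(2) d(1) r(2) wy(2)]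
            unfolding Cons by (simp add: W_e r_eq)
        next
          case False
          have "r \<notin> b <# carrier P"
          proof
            assume "r \<in> b <# carrier P"
            then obtain d where d: "d \<in> carrier P" "r = b \<otimes> d" by (auto simp: l_coset_iff)
            then have "q \<otimes> r = p \<otimes> (c \<otimes> d)" using cb pq by (metis m_assoc)
            then show False using False d cb by (auto simp: l_coset_iff)
          qed
          then show ?thesis
            using False wy pq cb(1,2) r bounded_operator_zero[OF W.V_bounded[OF cb(1)] csubspace_0[OF W.csubspace_K]]
            unfolding Cons by (simp add: W_e Ws_e_Cons_zero)
        qed
      qed
    qed
    then show ?thesis using 2 by blast
  qed
qed

text \<open>What is adjoined to the copy of \<open>H\<close>. The two isometries of the pair will
  agree on it.\<close>

definition E :: "ell2 set" where
  "E = ccspan ((\<lambda>(w, y). e w y) ` (lists (carrier P) \<times> X))"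

lemma E: "hilbert_space E"
  unfolding E_def by (rule hilbert_space_ccspan[OF subset_UNIV hilbert_space_UNIV_ell2])

lemma E_K: "E \<subseteq> K"
  unfolding E_def K_def gens_def by (rule ccspan_mono) auto

lemma e_E: "\<lbrakk>w \<in> lists (carrier P); y \<in> X\<rbrakk> \<Longrightarrow> e w y \<in> E"
  unfolding E_def by (rule ccspan_base) auto

lemma a_E: "x \<in> H \<Longrightarrow> \<xi> \<in> E \<Longrightarrow> cinner (a x) \<xi> = 0"
  unfolding E_def by (erule ccspan_cinner_zero) (auto simp: a_e)

lemma E_invariant:
  assumes "bounded_operator K K A" "\<And>w y. \<lbrakk>w \<in> lists (carrier P); y \<in> X\<rbrakk> \<Longrightarrow> A (e w y) \<in> E" "\<xi> \<in> E"
  shows "A \<xi> \<in> E"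
proof -
  have "\<xi> \<in> ccspan ((\<lambda>(w, y). e w y) ` (lists (carrier P) \<times> X))"
    using assms(3) by (simp add: E_def)
  moreover have "(\<lambda>(w, y). e w y) ` (lists (carrier P) \<times> X) \<subseteq> K"
    by (auto simp: e_K)
  ultimately show ?thesis
    by (intro bounded_operator_ccspan_in[OF assms(1) K _ hilbert_space_csubspace[OF E]
          hilbert_space_closed[OF E] _ \<open>\<xi> \<in> ccspan _\<close>]) (auto simp: assms(2))
qed

lemma W_E: "p \<in> carrier P \<Longrightarrow> \<xi> \<in> E \<Longrightarrow> W p \<xi> \<in> E"
proof (rule E_invariant[OF W.V_bounded])
  show "W p (e w y) \<in> E" if "p \<in> carrier P" "w \<in> lists (carrier P)" "y \<in> X" for w y
    using that by (cases w) (auto simp: W_e intro!: e_E WX.V_in)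
qed

lemma W_adj_a: "\<lbrakk>p \<in> carrier P; x \<in> H; \<xi> \<in> K\<rbrakk> \<Longrightarrow> cinner (W p \<xi>) (a x) = cinner \<xi> (a (W0.Vs p x))"
  by (simp add: Ws_a flip: W.Vs_cinner)

end

text \<open>The assumptions are the two orthogonality relations of \<open>nica_free\<close>, read
  off on the summand \<open>H\<close>, where the isometry is to be the sum of \<open>S\<close> and
  \<open>D\<close>; the case \<open>p = q\<close> of \<open>gram\<close> says that this sum
  preserves inner products.\<close>

locale creation_op = creation +
  fixes S :: "'c \<Rightarrow> 'c" and D :: "'c \<Rightarrow> 'd"
  assumes S: "bounded_operator H H S" and D_in: "x \<in> H \<Longrightarrow> D x \<in> X"
    and gram: "\<lbrakk>p \<in> carrier P; q \<in> carrier P; x \<in> H; y \<in> H\<rbrakk> \<Longrightarrow>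
      cinner (W0 p (S x)) (W0 q (S y)) + cinner (WX p (D x)) (WX q (D y)) = (if p = q then cinner x y else 0)"
    and vac_S: "\<lbrakk>p \<in> carrier P; p \<notin> Units P; x \<in> H; y \<in> H\<rbrakk> \<Longrightarrow> cinner (S x) (W0 p y) = 0"
    and vac_D: "\<lbrakk>p \<in> carrier P; p \<notin> Units P; x \<in> H; z \<in> X\<rbrakk> \<Longrightarrow> cinner (D x) (WX p z) = 0"
begin

lemma S_in: "x \<in> H \<Longrightarrow> S x \<in> H"
  by (rule bounded_operator_in[OF S])

definition V :: "ell2 \<Rightarrow> ell2" where
  "V = (SOME A. linear_isometry K K A \<and> (\<forall>x\<in>H. A (a x) = a (S x) + e [] (D x)) \<and>
    (\<forall>w\<in>lists (carrier P). \<forall>y\<in>X. A (e w y) = e (\<one> # w) y))"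

lemma V_spec:
  "linear_isometry K K V \<and> (\<forall>x\<in>H. V (a x) = a (S x) + e [] (D x)) \<and>
    (\<forall>w\<in>lists (carrier P). \<forall>y\<in>X. V (e w y) = e (\<one> # w) y)"
proof -
  have "\<exists>A. linear_isometry K K A \<and> (\<forall>x\<in>H. A (a x) = a (S x) + e [] (D x)) \<and>
    (\<forall>w\<in>lists (carrier P). \<forall>y\<in>X. A (e w y) = e (\<one> # w) y)"
  proof (rule K_extend)
    show "a (S x) + e [] (D x) \<in> K" if "x \<in> H" for x
      using that by (intro csubspace_add[OF W.csubspace_K] a_K e_K S_in D_in) auto
    show "e (\<one> # w) y \<in> K" if "w \<in> lists (carrier P)" "y \<in> X" for w y
      using that by (intro e_K) auto
    show "cinner (a (S x) + e [] (D x)) (a (S y) + e [] (D y)) = cinner x y" if "x \<in> H" "y \<in> H" for x y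
      using gram[of \<one> \<one> x y] that
      by (simp add: cinner_simps cinner_gens S_in D_in W0.V_one WX.V_one)
  qed (auto simp: cinner_simps cinner_gens S_in D_in)
  then show ?thesis unfolding V_def by (rule someI_ex)
qed

lemma V: "linear_isometry K K V"
  and V_a: "x \<in> H \<Longrightarrow> V (a x) = a (S x) + e [] (D x)"
  and V_e: "\<lbrakk>w \<in> lists (carrier P); y \<in> X\<rbrakk> \<Longrightarrow> V (e w y) = e (\<one> # w) y"
  using V_spec by blast+

lemma V_bounded: "bounded_operator K K V"
  by (rule linear_isometry_bounded[OF V])

lemma V_in: "x \<in> K \<Longrightarrow> V x \<in> K"
  by (rule bounded_operator_in[OF V_bounded])

lemma W_V_a: "p \<in> carrier P \<Longrightarrow> x \<in> H \<Longrightarrow> W p (V (a x)) = a (W0 p (S x)) + e [] (WX p (D x))"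
  by (simp add: V_a bounded_operator_add[OF W.V_bounded] a_K e_K S_in D_in W_a W_e)

lemma W_V_e: "\<lbrakk>p \<in> carrier P; w \<in> lists (carrier P); y \<in> X\<rbrakk> \<Longrightarrow> W p (V (e w y)) = e (p # w) y"
  by (simp add: V_e W_e)

sublocale nica_free P K W V
proof
  show "hilbert_space K" "isometric_rep P K W" "nica_covariant P K W" "linear_isometry K K V"
    by (fact K isometric_W nica_W V)+
next
  fix p x y assume p: "p \<in> carrier P" "p \<notin> Units P" and "x \<in> K" "y \<in> K"
  show "cinner (V x) (W p y) = 0"
  proof (rule K_zeroI[OF V_bounded W.V_bounded[OF p(1)] _ _ _ _ \<open>x \<in> K\<close> \<open>y \<in> K\<close>])
    show "cinner (V (a x)) (W p (e w y)) = 0" if "x \<in> H" "w \<in> lists (carrier P)" "y \<in> X" for x w y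
      using that p by (cases w) (auto simp: V_a W_e cinner_simps cinner_gens S_in D_in vac_D WX.V_in)
    \<comment> \<open>\<open>V\<close> produces words with first letter \<open>\<one>\<close>, and
      \<open>\<one>\<close> is not of the form \<open>p \<otimes> r\<close> for a non-invertible
      \<open>p\<close>.\<close>
    show "cinner (V (e w x)) (W p (e w' y)) = 0"
      if "w \<in> lists (carrier P)" "w' \<in> lists (carrier P)" "x \<in> X" "y \<in> X" for w w' x y
      using that p unit_of_mult by (cases w') (auto simp: V_e W_e cinner_gens WX.V_in)
  qed (use p in \<open>auto simp: V_a V_e W_a cinner_simps cinner_gens S_in D_in W0.V_in vac_S\<close>)
next
  fix p q x y assume pq: "p \<in> carrier P" "q \<in> carrier P" "p \<noteq> q" and "x \<in> K" "y \<in> K"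
  have bd: "bounded_operator K K (\<lambda>x. W r (V x))" if "r \<in> carrier P" for r
    by (rule bounded_operator_comp[OF V_bounded W.V_bounded[OF that]])
  show "cinner (W p (V x)) (W q (V y)) = 0"
  proof (rule K_zeroI[OF bd[OF pq(1)] bd[OF pq(2)] _ _ _ _ \<open>x \<in> K\<close> \<open>y \<in> K\<close>])
    show "cinner (W p (V (a x))) (W q (V (a y))) = 0" if "x \<in> H" "y \<in> H" for x y
      using gram[OF pq(1,2) that] pq that
      by (simp add: W_V_a cinner_simps cinner_gens S_in D_in W0.V_in WX.V_in)
  qed (use pq in \<open>auto simp: W_V_a W_V_e cinner_simps cinner_gens S_in D_in W0.V_in WX.V_in\<close>)
qed

text \<open>All values of \<open>V\<close> on the adjoined summands and all values of
  \<open>D\<close> are orthogonal to the copy of \<open>H\<close>; only \<open>S\<close> is seen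
  there, so \<open>V\<close> co-extends \<open>S\<close>.\<close>

lemma V_adj_a:
  assumes "x \<in> H" "\<xi> \<in> K"
  shows "cinner (V \<xi>) (a x) = cinner \<xi> (a (adjt H S x))"
proof -
  have S': "adjt H S x \<in> H" by (rule adjt_in[OF H S])
  have "adjt K V (a x) = a (adjt H S x)"
    unfolding K_def
  proof (rule ccspan_ext)
    show "adjt (ccspan gens) V (a x) \<in> ccspan gens" "a (adjt H S x) \<in> ccspan gens"
      using adjt_in[OF K V_bounded] a_K[OF S'] by (simp_all add: K_def)
    fix s assume s: "s \<in> gens"
    then have "cinner s (adjt K V (a x)) = cinner (V s) (a x)"
      using gens_K adjt_cinner[OF K V_bounded] by auto
    also have "\<dots> = cinner s (a (adjt H S x))"
      using s
      by (cases rule: gens_cases)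
         (use assms(1) S' in \<open>simp_all add: V_a V_e cinner_simps cinner_gens S_in D_in adjt_cinner[OF H S]\<close>)
    finally show "cinner s (adjt (ccspan gens) V (a x)) = cinner s (a (adjt H S x))" by (simp add: K_def)
  qed
  then show ?thesis
    using adjt_cinner[OF K V_bounded assms(2), of "a x"] by simp
qed

lemma V_E: "\<xi> \<in> E \<Longrightarrow> V \<xi> \<in> E"
  by (rule E_invariant[OF V_bounded]) (auto simp: V_e intro: e_E)

end

text \<open>Orthogonality of the defects is demanded for all their translates under
  \<open>WX\<close>, because the families built from them are acted on by \<open>W\<close>.\<close>

locale commuting_seed = one: creation_op P H W0 X WX a e S1 D1 + two: creation_op P H W0 X WX a e S2 D2
  for P (structure) and H W0 X WX a e S1 D1 S2 D2 +
  assumes comm: "x \<in> H \<Longrightarrow> S1 (S2 x) = S2 (S1 x)"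
    and D_orth: "\<lbrakk>p \<in> carrier P; q \<in> carrier P; x \<in> H; y \<in> H\<rbrakk> \<Longrightarrow> cinner (WX p (D1 x)) (WX q (D2 y)) = 0"
begin

abbreviation "K \<equiv> one.K"
abbreviation "E \<equiv> one.E"
abbreviation "W \<equiv> one.W"
abbreviation "V1 \<equiv> one.V"
abbreviation "V2 \<equiv> two.V"

lemma V2_E: "\<xi> \<in> E \<Longrightarrow> V2 \<xi> = V1 \<xi>"
  unfolding one.E_def
proof (rule bounded_operator_eq_on_ccspan[OF two.V_bounded one.V_bounded one.K])
  show "(\<lambda>(w, y). e w y) ` (lists (carrier P) \<times> X) \<subseteq> K" by (auto simp: one.e_K)
qed (auto simp: one.V_e two.V_e)

text \<open>Both orders of the product of the two isometries act as \<open>c\<close> on \<open>E\<close>; on \<open>H\<close> they differ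
  only in the summands \<open>\<zeta> True x\<close> and \<open>\<zeta> False x\<close>.\<close>

definition c :: "ell2 \<Rightarrow> ell2" where
  "c \<xi> = V1 (V1 \<xi>)"

definition \<zeta> :: "bool \<Rightarrow> 'c \<Rightarrow> ell2" where
  "\<zeta> b x = (if b then e [] (D1 (S2 x)) + e [\<one>] (D2 x) else e [] (D2 (S1 x)) + e [\<one>] (D1 x))"

text \<open>The range of \<open>c\<close> lies in that of \<open>V1\<close>, so both orthogonality
  relations are inherited.\<close>

sublocale C: nica_free P K W c
proof
  show "hilbert_space K" "isometric_rep P K W" "nica_covariant P K W"
    by (fact one.K one.isometric_W one.nica_W)+
  show "linear_isometry K K c"
    unfolding c_def by (rule linear_isometry_comp[OF one.V one.V])
qed (auto simp: c_def one.orth_W one.orth_V one.V_in)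

lemma V1V2_a: "x \<in> H \<Longrightarrow> V1 (V2 (a x)) = a (S1 (S2 x)) + \<zeta> True x"
  by (simp add: \<zeta>_def two.V_a one.V_a one.V_e bounded_operator_add[OF one.V_bounded]
      one.a_K one.e_K two.S_in two.D_in add.assoc)

lemma V2V1_a: "x \<in> H \<Longrightarrow> V2 (V1 (a x)) = a (S1 (S2 x)) + \<zeta> False x"
  by (simp add: \<zeta>_def two.V_a one.V_a two.V_e bounded_operator_add[OF two.V_bounded]
      one.a_K one.e_K one.S_in one.D_in add.assoc comm)

lemma \<zeta>_E: "x \<in> H \<Longrightarrow> \<zeta> b x \<in> E"
  by (auto simp: \<zeta>_def one.S_in one.D_in two.S_in two.D_in
      intro!: csubspace_add[OF hilbert_space_csubspace[OF one.E]] one.e_E)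

lemma E_in_K: "\<xi> \<in> E \<Longrightarrow> \<xi> \<in> K"
  using one.E_K by blast

lemma c_E: "\<xi> \<in> E \<Longrightarrow> c \<xi> \<in> E"
  by (simp add: c_def one.V_E)

lemma W_\<zeta>:
  assumes "p \<in> carrier P" "x \<in> H"
  shows "W p (\<zeta> True x) = e [] (WX p (D1 (S2 x))) + e [p] (D2 x)"
    "W p (\<zeta> False x) = e [] (WX p (D2 (S1 x))) + e [p] (D1 x)"
  using assms
  by (simp_all add: \<zeta>_def bounded_operator_add[OF one.W.V_bounded] one.W_e one.e_K
      one.S_in one.D_in two.S_in two.D_in)

lemma D_orth': "\<lbrakk>p \<in> carrier P; q \<in> carrier P; x \<in> H; y \<in> H\<rbrakk> \<Longrightarrow> cinner (WX p (D2 x)) (WX q (D1 y)) = 0"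
  by (metis D_orth cinner_commute complex_cnj_zero)

lemma D_orth_one: "\<lbrakk>x \<in> H; y \<in> H\<rbrakk> \<Longrightarrow> cinner (D1 x) (D2 y) = 0" "\<lbrakk>x \<in> H; y \<in> H\<rbrakk> \<Longrightarrow> cinner (D2 x) (D1 y) = 0"
  using D_orth[of \<one> \<one> x y] D_orth'[of \<one> \<one> x y] by (simp_all add: one.WX.V_one one.D_in two.D_in)

text \<open>Commutation enters here. By the two defect relations, either diagonal entry equals the
  inner product of \<open>x\<close> and \<open>y\<close>, present only for \<open>p = q\<close>,
  minus that of the translates of \<open>S1 (S2 x)\<close> and \<open>S1 (S2 y)\<close>. Mixed
  entries vanish because the defects, and different index words, are orthogonal.\<close>

lemma gram_\<zeta>:
  assumes pq: "p \<in> carrier P" "q \<in> carrier P" and xy: "x \<in> H" "y \<in> H"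
  shows "cinner (W p (\<zeta> b x)) (W q (\<zeta> b' y)) = cinner (W p (\<zeta> (\<not> b) x)) (W q (\<zeta> (\<not> b') y))"
proof -
  have g1: "cinner (W0 p (S1 (S2 x))) (W0 q (S1 (S2 y))) + cinner (WX p (D1 (S2 x))) (WX q (D1 (S2 y))) =
      (if p = q then cinner (S2 x) (S2 y) else 0)"
    using one.gram[OF pq two.S_in[OF xy(1)] two.S_in[OF xy(2)]] .
  have g2: "cinner (W0 p (S1 (S2 x))) (W0 q (S1 (S2 y))) + cinner (WX p (D2 (S1 x))) (WX q (D2 (S1 y))) =
      (if p = q then cinner (S1 x) (S1 y) else 0)"
    using two.gram[OF pq one.S_in[OF xy(1)] one.S_in[OF xy(2)]] by (simp add: comm xy)
  have n1: "cinner (S1 x) (S1 y) = cinner x y - cinner (D1 x) (D1 y)"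
    using one.gram[OF one.one_closed one.one_closed xy] xy
    by (simp add: one.W0.V_one one.WX.V_one one.S_in one.D_in eq_diff_eq)
  have n2: "cinner (S2 x) (S2 y) = cinner x y - cinner (D2 x) (D2 y)"
    using two.gram[OF one.one_closed one.one_closed xy] xy
    by (simp add: one.W0.V_one one.WX.V_one two.S_in two.D_in eq_diff_eq)
  have d1: "cinner (WX p (D1 (S2 x))) (WX q (D1 (S2 y))) =
      (if p = q then cinner x y - cinner (D2 x) (D2 y) else 0) - cinner (W0 p (S1 (S2 x))) (W0 q (S1 (S2 y)))"
    using g1 unfolding n2 by (simp add: eq_diff_eq add.commute)
  have d2: "cinner (WX p (D2 (S1 x))) (WX q (D2 (S1 y))) =
      (if p = q then cinner x y - cinner (D1 x) (D1 y) else 0) - cinner (W0 p (S1 (S2 x))) (W0 q (S1 (S2 y)))"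
    using g2 unfolding n1 by (simp add: eq_diff_eq add.commute)
  have same: "cinner (W p (\<zeta> True x)) (W q (\<zeta> True y)) = cinner (W p (\<zeta> False x)) (W q (\<zeta> False y))"
    using d1 d2 pq xy
    by (simp add: W_\<zeta> cinner_simps one.e_cinner one.WX.V_in one.S_in one.D_in two.S_in two.D_in)
  have cross: "cinner (W p (\<zeta> True x)) (W q (\<zeta> False y)) = 0" "cinner (W p (\<zeta> False x)) (W q (\<zeta> True y)) = 0"
    using pq xy
    by (simp_all add: W_\<zeta> cinner_simps one.e_cinner one.WX.V_in one.S_in one.D_in two.S_in two.D_in
        D_orth D_orth' D_orth_one)
  show ?thesis
    using same cross by (cases b; cases b') auto
qed

text \<open>For a non-invertible \<open>p\<close>, the defects are orthogonal to the range of
  \<open>WX p\<close> and the letter \<open>\<one>\<close> is not a multiple of \<open>p\<close>.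
  This is what lets \<open>R\<close> below reduce \<open>W\<close>.\<close>

lemma \<zeta>_vacuum:
  assumes "p \<in> carrier P" "p \<notin> Units P" "x \<in> H"
  shows "one.W.Vs p (\<zeta> b x) = 0"
proof -
  have nu: "\<one> \<notin> p <# carrier P"
    using assms one.unit_of_mult by (auto simp: l_coset_iff)
  have "one.W.Vs p (e [] (D1 y)) = 0" "one.W.Vs p (e [] (D2 y)) = 0" if "y \<in> H" for y
  proof -
    have "one.WX.Vs p (D1 y) = 0" "one.WX.Vs p (D2 y) = 0"
      using assms that by (auto intro!: one.WX.Vs_eq_zeroI one.vac_D two.vac_D)
    then show "one.W.Vs p (e [] (D1 y)) = 0" "one.W.Vs p (e [] (D2 y)) = 0"
      using assms that by (simp_all add: one.Ws_e_Nil one.D_in two.D_in one.e_zero)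
  qed
  moreover have "one.W.Vs p (e [\<one>] (D1 y)) = 0" "one.W.Vs p (e [\<one>] (D2 y)) = 0" if "y \<in> H" for y
    using assms that nu by (simp_all add: one.Ws_e_Cons_zero one.D_in two.D_in)
  ultimately show ?thesis
    using assms
    by (simp add: \<zeta>_def bounded_operator_add[OF one.W.Vs_bounded] one.e_K one.S_in one.D_in two.S_in two.D_in)
qed

text \<open>The left vector lives on index words of length at most one, the right one on words of
  length at least two.\<close>

lemma W_c_\<zeta>:
  assumes "p \<in> carrier P" "q \<in> carrier P" "\<xi> \<in> E" "x \<in> H"
  shows "cinner (W p (\<zeta> b x)) (W q (c \<xi>)) = 0"
proof -
  have "bounded_operator K K (\<lambda>\<xi>. W q (c \<xi>))"
    by (rule bounded_operator_comp[OF linear_isometry_bounded[OF C.V] one.W.V_bounded[OF assms(2)]])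
  then have "W q (c \<xi>) \<in> ccspan ((\<lambda>(w, y). e (q # \<one> # w) y) ` (lists (carrier P) \<times> X))"
  proof (rule bounded_operator_ccspan_in[OF _ one.K _ csubspace_ccspan closed_ccspan])
    show "\<xi> \<in> ccspan ((\<lambda>(w, y). e w y) ` (lists (carrier P) \<times> X))"
      using assms(3) by (simp add: one.E_def)
    show "(\<lambda>(w, y). e w y) ` (lists (carrier P) \<times> X) \<subseteq> K"
      by (auto simp: one.e_K)
    fix s assume "s \<in> (\<lambda>(w, y). e w y) ` (lists (carrier P) \<times> X)"
    then obtain w y where wy: "w \<in> lists (carrier P)" "y \<in> X" "s = e w y" by auto
    then have "W q (c s) = e (q # \<one> # w) y"
      using assms(2) by (simp add: c_def one.V_e one.W_e)
    then show "W q (c s) \<in> ccspan ((\<lambda>(w, y). e (q # \<one> # w) y) ` (lists (carrier P) \<times> X))"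
      using wy by (intro ccspan_base) auto
  qed
  then show ?thesis
  proof (rule ccspan_cinner_zero)
    fix s assume "s \<in> (\<lambda>(w, y). e (q # \<one> # w) y) ` (lists (carrier P) \<times> X)"
    then obtain w y where wy: "w \<in> lists (carrier P)" "y \<in> X" "s = e (q # \<one> # w) y" by auto
    then show "cinner (W p (\<zeta> b x)) s = 0"
      using assms
      by (cases b) (simp_all add: W_\<zeta> cinner_simps one.e_cinner one.WX.V_in one.S_in one.D_in two.S_in two.D_in)
  qed
qed

abbreviation "C \<equiv> alt_rep W c"

lemma C_E: "\<xi> \<in> E \<Longrightarrow> set z \<subseteq> carrier P \<Longrightarrow> C z \<xi> \<in> E"
  by (induction z) (auto intro: one.W_E c_E)

lemma C_\<zeta>_K: "\<lbrakk>z \<in> carrier (alt_monoid P); x \<in> H\<rbrakk> \<Longrightarrow> C z (\<zeta> b x) \<in> K"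
  by (rule E_in_K) (simp add: C_E \<zeta>_E)

text \<open>Equal first letters cancel by isometry, and all unequal lengths or letters give zero for
  either choice of indices; only two one-letter words involve the defects, and there
  \<open>gram_\<zeta>\<close> applies.\<close>

lemma gram_C:
  assumes "z \<in> carrier (alt_monoid P)" "z' \<in> carrier (alt_monoid P)" "x \<in> H" "y \<in> H"
  shows "cinner (C z (\<zeta> b x)) (C z' (\<zeta> b' y)) = cinner (C z (\<zeta> (\<not> b) x)) (C z' (\<zeta> (\<not> b') y))"
proof -
  have "\<forall>b b'. \<forall>x\<in>H. \<forall>y\<in>H.
    cinner (C z (\<zeta> b x)) (C z' (\<zeta> b' y)) = cinner (C z (\<zeta> (\<not> b) x)) (C z' (\<zeta> (\<not> b') y))"
    using assms(1,2)
  proof (induction z z' rule: one.alt_pair_induct)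
    case (sym l m)
    show ?case
    proof (intro allI ballI)
      fix b b' x y assume "x \<in> H" "y \<in> H"
      then have "cinner (C l (\<zeta> b' y)) (C m (\<zeta> b x)) = cinner (C l (\<zeta> (\<not> b') y)) (C m (\<zeta> (\<not> b) x))"
        using sym(3) by blast
      then show "cinner (C m (\<zeta> b x)) (C l (\<zeta> b' y)) = cinner (C m (\<zeta> (\<not> b) x)) (C l (\<zeta> (\<not> b') y))"
        by (metis cinner_commute)
    qed
  next
    case (single p q)
    then show ?case by (auto intro!: gram_\<zeta>)
  next
    case (single_Cons p q m)
    then show ?case by (simp add: W_c_\<zeta> C_E \<zeta>_E)
  next
    case (Cons p l m)
    have red: "cinner (C (p # l) (\<zeta> b x)) (C (p # m) (\<zeta> b' y)) = cinner (C l (\<zeta> b x)) (C m (\<zeta> b' y))"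
      if "x \<in> H" "y \<in> H" for b b' x y
      using Cons(1-3) that by (simp add: one.W.V_cinner C.V_in C.V_cinner C_E \<zeta>_E E_in_K)
    show ?case
    proof (intro allI ballI)
      fix b b' x y assume xy: "x \<in> H" "y \<in> H"
      show "cinner (C (p # l) (\<zeta> b x)) (C (p # m) (\<zeta> b' y)) =
          cinner (C (p # l) (\<zeta> (\<not> b) x)) (C (p # m) (\<zeta> (\<not> b') y))"
        unfolding red[OF xy] using Cons(4) xy by blast
    qed
  next
    case (neq p q l m)
    then show ?case by (simp add: C.orth_V C_E \<zeta>_E E_in_K)
  qed
  then show ?thesis using assms(3,4) by blast
qed

section \<open>The subspace generated by both families and the symmetry that exchanges them\<close>

definition R :: "ell2 set" where
  "R = ccspan ((\<lambda>(b, z, x). C z (\<zeta> b x)) ` (UNIV \<times> carrier (alt_monoid P) \<times> H))"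

lemma R_gens_E: "(\<lambda>(b, z, x). C z (\<zeta> b x)) ` (UNIV \<times> carrier (alt_monoid P) \<times> H) \<subseteq> E"
  by (auto simp: C_E \<zeta>_E)

lemma R: "hilbert_space R" and R_E: "R \<subseteq> E"
  unfolding R_def by (rule hilbert_space_ccspan[OF R_gens_E one.E], rule ccspan_subset_hilbert[OF R_gens_E one.E])

lemma R_gen: "\<lbrakk>z \<in> carrier (alt_monoid P); x \<in> H\<rbrakk> \<Longrightarrow> C z (\<zeta> b x) \<in> R"
  unfolding R_def by (rule ccspan_base) force

definition R_perp :: "ell2 set" where
  "R_perp = {k \<in> K. \<forall>z\<in>carrier (alt_monoid P). \<forall>x\<in>H. \<forall>b. cinner k (C z (\<zeta> b x)) = 0}"

lemma R_perpD: "\<lbrakk>k \<in> R_perp; \<rho> \<in> R\<rbrakk> \<Longrightarrow> cinner k \<rho> = 0"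
  unfolding R_def by (erule ccspan_cinner_zero) (auto simp: R_perp_def)

lemma R_perpI: "\<lbrakk>k \<in> K; \<And>\<rho>. \<rho> \<in> R \<Longrightarrow> cinner k \<rho> = 0\<rbrakk> \<Longrightarrow> k \<in> R_perp"
  by (simp add: R_perp_def R_gen del: alt_monoid_simps)

lemma R_decomp:
  assumes "k \<in> K"
  obtains \<rho> \<tau> where "\<rho> \<in> R" "\<tau> \<in> R_perp" "k = \<rho> + \<tau>" "\<tau> = k - \<rho>"
proof (rule that)
  show \<rho>: "orthogonal_projection R k \<in> R" by (rule orthogonal_projection_in[OF R])
  show "k - orthogonal_projection R k \<in> R_perp"
  proof (rule R_perpI)
    have "orthogonal_projection R k \<in> K" using \<rho> R_E one.E_K by auto
    with assms show "k - orthogonal_projection R k \<in> K"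
      by (rule csubspace_diff[OF one.W.csubspace_K])
  qed (rule orthogonal_projection_orth[OF R])
  show "k = orthogonal_projection R k + (k - orthogonal_projection R k)" by simp
qed (rule refl)

definition G_spec :: "(ell2 \<Rightarrow> ell2) \<Rightarrow> bool" where
  "G_spec G \<longleftrightarrow> linear_isometry K K G \<and> (\<forall>k\<in>R_perp. G k = k) \<and>
    (\<forall>z\<in>carrier (alt_monoid P). \<forall>x\<in>H. \<forall>b. G (C z (\<zeta> b x)) = C z (\<zeta> (\<not> b) x))"

text \<open>The generators of \<open>R\<close> together with all vectors orthogonal to them span
  \<open>K\<close>; flipping the index \<open>b\<close> and fixing the rest preserves the Gram
  matrix by \<open>gram_C\<close>.\<close>

lemma ex_G: "\<exists>G. G_spec G"
proof -
  define I where "I = R_perp <+> ((UNIV :: bool set) \<times> carrier (alt_monoid P) \<times> H)"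
  define f where "f = case_sum (\<lambda>k. k) (\<lambda>(b, z, x). C z (\<zeta> b x))"
  define g where "g = case_sum (\<lambda>k. k) (\<lambda>(b, z, x). C z (\<zeta> (\<not> b) x))"
  have perp: "cinner (C z (\<zeta> b x)) k = 0" if "k \<in> R_perp" "z \<in> carrier (alt_monoid P)" "x \<in> H" for k z b x
    using that by (metis R_perpD R_gen cinner_commute complex_cnj_zero)
  have f: "f i \<in> K" and g: "g i \<in> K" if "i \<in> I" for i
    using that by (auto simp: f_def g_def I_def C_\<zeta>_K R_perp_def simp del: alt_monoid_simps)
  have fg: "cinner (f i) (f j) = cinner (g i) (g j)" if "i \<in> I" "j \<in> I" for i j
    using that
    by (auto simp: f_def g_def I_def perp R_perpD R_gen simp del: alt_monoid_simps
        intro: gram_C)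
  obtain G where G: "linear_isometry (ccspan (f ` I)) (ccspan (g ` I)) G" "\<And>i. i \<in> I \<Longrightarrow> G (f i) = g i"
    by (rule gram_isometry[of K I f K g]) (use one.K f g fg in blast)+
  have "K \<subseteq> ccspan (f ` I)"
  proof
    fix k assume "k \<in> K"
    then obtain \<rho> \<tau> where k: "\<rho> \<in> R" "\<tau> \<in> R_perp" "k = \<rho> + \<tau>" by (rule R_decomp)
    have "R \<subseteq> ccspan (f ` I)"
      unfolding R_def
    proof (rule ccspan_mono, rule subsetI)
      fix s assume "s \<in> (\<lambda>(b, z, x). C z (\<zeta> b x)) ` (UNIV \<times> carrier (alt_monoid P) \<times> H)"
      then obtain b z x where "z \<in> carrier (alt_monoid P)" "x \<in> H" "s = C z (\<zeta> b x)" by auto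
      then show "s \<in> f ` I"
        by (intro image_eqI[of _ _ "Inr (b, z, x)"]) (auto simp: f_def I_def)
    qed
    moreover have "\<tau> \<in> ccspan (f ` I)"
      using k(2) by (intro ccspan_base image_eqI[of _ _ "Inl \<tau>"]) (auto simp: f_def I_def)
    ultimately show "k \<in> ccspan (f ` I)"
      using k by (auto intro: csubspace_add[OF csubspace_ccspan])
  qed
  moreover have "ccspan (g ` I) \<subseteq> K"
    by (rule ccspan_subset_hilbert[OF _ one.K]) (use g in auto)
  ultimately have "linear_isometry K K G"
    using G(1) unfolding linear_isometry_def
    by (auto intro!: bounded_operator_subset[of "ccspan (f ` I)" "ccspan (g ` I)" G] dest: bounded_operator_in)
  moreover have "G k = k" if "k \<in> R_perp" for k
    using G(2)[of "Inl k"] that by (auto simp: f_def g_def I_def)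
  moreover have "G (C z (\<zeta> b x)) = C z (\<zeta> (\<not> b) x)" if "z \<in> carrier (alt_monoid P)" "x \<in> H" for z b x
    using G(2)[of "Inr (b, z, x)"] that by (auto simp: f_def g_def I_def simp del: alt_monoid_simps)
  ultimately show ?thesis unfolding G_spec_def by blast
qed

definition G :: "ell2 \<Rightarrow> ell2" where
  "G = (SOME G. G_spec G)"

lemma G_spec_G: "G_spec G"
  unfolding G_def by (rule someI_ex[OF ex_G])

lemma G: "linear_isometry K K G"
  and G_perp: "k \<in> R_perp \<Longrightarrow> G k = k"
  and G_C: "\<lbrakk>z \<in> carrier (alt_monoid P); x \<in> H\<rbrakk> \<Longrightarrow> G (C z (\<zeta> b x)) = C z (\<zeta> (\<not> b) x)"
  using G_spec_G unfolding G_spec_def by blast+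

lemma G_bounded: "bounded_operator K K G"
  by (rule linear_isometry_bounded[OF G])

lemma G_in: "k \<in> K \<Longrightarrow> G k \<in> K"
  by (rule bounded_operator_in[OF G_bounded])

lemma R_eqI:
  assumes "bounded_operator K L A" "bounded_operator K L' B"
    and "\<And>z x b. \<lbrakk>z \<in> carrier (alt_monoid P); x \<in> H\<rbrakk> \<Longrightarrow> A (C z (\<zeta> b x)) = B (C z (\<zeta> b x))" "\<rho> \<in> R"
  shows "A \<rho> = B \<rho>"
proof (rule bounded_operator_eq_on_ccspan[OF assms(1,2) one.K])
  show "(\<lambda>(b, z, x). C z (\<zeta> b x)) ` (UNIV \<times> carrier (alt_monoid P) \<times> H) \<subseteq> K"
    using R_gens_E one.E_K by blast
  show "\<rho> \<in> ccspan ((\<lambda>(b, z, x). C z (\<zeta> b x)) ` (UNIV \<times> carrier (alt_monoid P) \<times> H))"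
    using assms(4) by (simp add: R_def)
qed (auto simp: assms(3) simp del: alt_monoid_simps)

lemma R_invariant:
  assumes "bounded_operator K L A"
    and "\<And>z x b. \<lbrakk>z \<in> carrier (alt_monoid P); x \<in> H\<rbrakk> \<Longrightarrow> A (C z (\<zeta> b x)) \<in> R" "\<rho> \<in> R"
  shows "A \<rho> \<in> R"
proof (rule bounded_operator_ccspan_in[OF assms(1) one.K])
  show "(\<lambda>(b, z, x). C z (\<zeta> b x)) ` (UNIV \<times> carrier (alt_monoid P) \<times> H) \<subseteq> K"
    using R_gens_E one.E_K by blast
  show "\<rho> \<in> ccspan ((\<lambda>(b, z, x). C z (\<zeta> b x)) ` (UNIV \<times> carrier (alt_monoid P) \<times> H))"
    using assms(3) by (simp add: R_def)
  show "csubspace R" "closed R"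
    using R by (simp_all add: hilbert_space_csubspace hilbert_space_closed)
qed (auto simp: assms(2) simp del: alt_monoid_simps)

lemma G_R: "\<rho> \<in> R \<Longrightarrow> G \<rho> \<in> R"
  by (rule R_invariant[OF G_bounded]) (simp_all add: G_C R_gen del: alt_monoid_simps)

lemma K_eq_by_parts:
  assumes A: "bounded_operator K L A" and B: "bounded_operator K L' B" and k: "k \<in> K"
    and R: "\<And>\<rho>. \<rho> \<in> R \<Longrightarrow> A \<rho> = B \<rho>" and perp: "\<And>\<tau>. \<tau> \<in> R_perp \<Longrightarrow> A \<tau> = B \<tau>"
  shows "A k = B k"
proof -
  obtain \<rho> \<tau> where *: "\<rho> \<in> R" "\<tau> \<in> R_perp" "k = \<rho> + \<tau>" using k by (rule R_decomp)
  then have "\<rho> \<in> K" "\<tau> \<in> K" using R_E one.E_K by (auto simp: R_perp_def)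
  then show ?thesis
    using * R perp by (simp add: bounded_operator_add[OF A] bounded_operator_add[OF B])
qed

lemma G_G:
  assumes "k \<in> K" shows "G (G k) = k"
proof (rule K_eq_by_parts[OF _ _ assms])
  show "bounded_operator K K (\<lambda>k. G (G k))"
    by (rule bounded_operator_comp[OF G_bounded G_bounded])
  show id: "bounded_operator K K (\<lambda>k. k)"
    by (auto simp: bounded_operator_def intro: exI[of _ 1])
  show "G (G \<rho>) = \<rho>" if "\<rho> \<in> R" for \<rho>
    by (rule R_eqI[OF \<open>bounded_operator K K (\<lambda>k. G (G k))\<close> id _ that]) (simp add: G_C del: alt_monoid_simps)
qed (simp add: G_perp)

text \<open>An isometry that is its own inverse is self-adjoint.\<close>

lemma G_cinner: "\<lbrakk>x \<in> K; y \<in> K\<rbrakk> \<Longrightarrow> cinner (G x) y = cinner x (G y)"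
  using linear_isometry_cinner[OF G one.W.csubspace_K, of x "G y"] by (simp add: G_in G_G)

text \<open>Behind its first letter a generator is a vector \<open>\<tau>\<close> annihilated by the
  adjoint at every non-invertible element. Moving the adjoint at \<open>p\<close> past that letter
  leaves an adjoint at some \<open>s\<close> in front of \<open>\<tau>\<close>: the result is zero
  unless \<open>s\<close> is invertible, and then it is again a generator. So \<open>R\<close>
  reduces \<open>W\<close>.\<close>

lemma Ws_R:
  assumes p: "p \<in> carrier P" and z: "z \<in> carrier (alt_monoid P)" and x: "x \<in> H"
  shows "one.W.Vs p (C z (\<zeta> b x)) \<in> R"
proof -
  obtain q l where ql: "z = q # l" "q \<in> carrier P" "set l \<subseteq> carrier P" using z by (cases z) auto
  define \<tau> where "\<tau> = (if l = [] then \<zeta> b x else c (C l (\<zeta> b x)))"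
  have C: "C (r # l) (\<zeta> b x) = W r \<tau>" for r by (simp add: \<tau>_def)
  have \<tau>: "\<tau> \<in> K"
    using ql x by (auto simp: \<tau>_def intro!: E_in_K \<zeta>_E c_E C_E)
  have vac: "one.W.Vs b' \<tau> = 0" if "b' \<in> carrier P" "b' \<notin> Units P" for b'
    using that ql x by (auto simp: \<tau>_def \<zeta>_vacuum C.Ws_V C_E \<zeta>_E E_in_K)
  have R0: "0 \<in> R" by (rule csubspace_0[OF hilbert_space_csubspace[OF R]])
  show ?thesis
    unfolding ql(1) C using p ql(2)
  proof (cases rule: one.lcm_cases)
    case 1
    then show "one.W.Vs p (W q \<tau>) \<in> R"
      using one.W.nica_disjoint[OF one.nica_W 1 p ql(2) \<tau>] R0 by simp
  next
    case (2 r s)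
    then have rs: "r \<in> carrier P" "s \<in> carrier P" by (auto simp: lcm_pair_def)
    have eq: "one.W.Vs p (W q \<tau>) = W r (one.W.Vs s \<tau>)"
      by (rule one.W.nica_lcm[OF one.nica_W 2 p ql(2) \<tau>])
    show "one.W.Vs p (W q \<tau>) \<in> R"
    proof (cases "s \<in> Units P")
      case True
      then have "W r (one.W.Vs s \<tau>) = W (r \<otimes> inv s) \<tau>"
        using rs \<tau> by (simp add: one.W.Vs_unit one.W.V_mult)
      also have "\<dots> \<in> R"
        using R_gen[of "(r \<otimes> inv s) # l" x b] rs True ql x by (simp add: C[symmetric] del: alt_rep.simps)
      finally show ?thesis by (simp add: eq)
    next
      case False
      then show ?thesis
        using vac[OF rs(2)] R0 bounded_operator_zero[OF one.W.V_bounded[OF rs(1)] csubspace_0[OF one.W.csubspace_K]]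
        by (simp add: eq)
    qed
  qed
qed

lemma W_R_perp:
  assumes "p \<in> carrier P" "k \<in> R_perp"
  shows "W p k \<in> R_perp"
proof -
  have k: "k \<in> K" using assms by (simp add: R_perp_def)
  have "cinner (W p k) (C z (\<zeta> b x)) = 0" if "z \<in> carrier (alt_monoid P)" "x \<in> H" for z x b
    using R_perpD[OF assms(2) Ws_R[OF assms(1) that, of b]] one.W.Vs_cinner[OF assms(1) k] by simp
  then show ?thesis
    using one.W.V_in[OF assms(1) k] by (simp add: R_perp_def del: alt_monoid_simps)
qed

text \<open>That one new word serves both values of \<open>b\<close> is why \<open>G\<close>
  commutes with \<open>W\<close> on \<open>R\<close>.\<close>

lemma W_C:
  assumes "p \<in> carrier P" "z \<in> carrier (alt_monoid P)" "x \<in> H"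
  obtains z' where "z' \<in> carrier (alt_monoid P)" "\<And>b. W p (C z (\<zeta> b x)) = C z' (\<zeta> b x)"
proof -
  obtain q l where ql: "z = q # l" "q \<in> carrier P" "set l \<subseteq> carrier P" using assms(2) by (cases z) auto
  show ?thesis
  proof (rule that[of "(p \<otimes> q) # l"])
    show "(p \<otimes> q) # l \<in> carrier (alt_monoid P)" using ql assms(1) by simp
    show "W p (C z (\<zeta> b x)) = C ((p \<otimes> q) # l) (\<zeta> b x)" for b
      using ql assms by (auto simp: one.W.V_mult \<zeta>_E E_in_K c_E C_E)
  qed
qed

lemma G_W:
  assumes p: "p \<in> carrier P" and k: "k \<in> K"
  shows "G (W p k) = W p (G k)"
proof (rule K_eq_by_parts[OF _ _ k])
  show 1: "bounded_operator K K (\<lambda>k. G (W p k))"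
    by (rule bounded_operator_comp[OF one.W.V_bounded[OF p] G_bounded])
  show 2: "bounded_operator K K (\<lambda>k. W p (G k))"
    by (rule bounded_operator_comp[OF G_bounded one.W.V_bounded[OF p]])
  show "G (W p \<rho>) = W p (G \<rho>)" if "\<rho> \<in> R" for \<rho>
  proof (rule R_eqI[OF 1 2 _ that])
    fix z x b assume zx: "z \<in> carrier (alt_monoid P)" "x \<in> H"
    obtain z' where z': "z' \<in> carrier (alt_monoid P)" "\<And>b. W p (C z (\<zeta> b x)) = C z' (\<zeta> b x)"
      by (rule W_C[OF p zx]) blast
    show "G (W p (C z (\<zeta> b x))) = W p (G (C z (\<zeta> b x)))"
      unfolding z'(2) G_C[OF zx] G_C[OF z'(1) zx(2)] ..
  qed
qed (simp add: G_perp W_R_perp p)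

text \<open>Against one-letter words this is \<open>W_c_\<zeta>\<close>, which speaks of
  \<open>E\<close>: on the copy of \<open>H\<close>, \<open>c\<close> also has components at index
  words of length at most one. Against longer words either the first letter is \<open>\<one>\<close>
  and \<open>c\<close> cancels, or \<open>orth_V\<close> applies.\<close>

lemma c_R_perp:
  assumes "k \<in> R_perp" "k \<in> E"
  shows "c k \<in> R_perp"
proof -
  have k: "k \<in> K" using assms(2) by (rule E_in_K)
  \<comment> \<open>Viewed as a translate by \<open>\<one>\<close>, the vector \<open>c k\<close>
    has the shape required by \<open>W_c_\<zeta>\<close> and by the orthogonality relation for
    \<open>c\<close>.\<close>
  have ck: "W \<one> (c k) = c k"
    by (rule one.W.V_one[OF C.V_in[OF k]])
  have "cinner (c k) (C z (\<zeta> b x)) = 0" if z: "z \<in> carrier (alt_monoid P)" and x: "x \<in> H" for z x b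
  proof -
    obtain q l where ql: "z = q # l" "q \<in> carrier P" "set l \<subseteq> carrier P" using z by (cases z) auto
    show ?thesis
    proof (cases "l = []")
      case True
      have "cinner (W q (\<zeta> b x)) (W \<one> (c k)) = 0"
        by (rule W_c_\<zeta>[OF ql(2) one.one_closed assms(2) x])
      then show ?thesis
        using ql True ck by (simp, metis cinner_commute complex_cnj_zero)
    next
      case False
      have l: "C l (\<zeta> b x) \<in> K" using ql x by (intro E_in_K C_E \<zeta>_E)
      have "cinner (W \<one> (c k)) (W q (c (C l (\<zeta> b x)))) = 0"
      proof (cases "q = \<one>")
        case True
        have "cinner k (C l (\<zeta> b x)) = 0"
          using assms(1) ql False x by (simp add: R_perp_def)
        then show ?thesis
          using True k l by (simp add: one.W.V_cinner C.V_in C.V_cinner)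
      next
        case ne: False
        then show ?thesis using C.orth_V[OF one.one_closed ql(2) _ k l] by simp
      qed
      then show ?thesis using ql False ck by simp
    qed
  qed
  then show ?thesis
    using C.V_in[OF k] by (simp add: R_perp_def del: alt_monoid_simps)
qed

text \<open>On \<open>R\<close>, applying \<open>c\<close> prefixes \<open>\<one>\<close> to the
  word, which is compatible with the exchange. The vectors of \<open>E\<close> orthogonal to
  \<open>R\<close>, and their images under \<open>c\<close>, are fixed by \<open>G\<close>.\<close>

lemma G_c:
  assumes "\<xi> \<in> E"
  shows "G (c \<xi>) = c (G \<xi>)" and "G \<xi> \<in> E"
proof -
  have 1: "bounded_operator K K (\<lambda>k. G (c k))"
    by (rule bounded_operator_comp[OF linear_isometry_bounded[OF C.V] G_bounded])
  have 2: "bounded_operator K K (\<lambda>k. c (G k))"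
    by (rule bounded_operator_comp[OF G_bounded linear_isometry_bounded[OF C.V]])
  have R: "G (c \<rho>) = c (G \<rho>)" if "\<rho> \<in> R" for \<rho>
  proof (rule R_eqI[OF 1 2 _ that])
    fix z x b assume zx: "z \<in> carrier (alt_monoid P)" "x \<in> H"
    have z': "\<one> # z \<in> carrier (alt_monoid P)" using zx by simp
    have "C (\<one> # z) (\<zeta> b x) = c (C z (\<zeta> b x))" for b
      using zx C.V_in[OF C_\<zeta>_K[OF zx]] by (simp add: one.W.V_one)
    then show "G (c (C z (\<zeta> b x))) = c (G (C z (\<zeta> b x)))"
      using G_C[OF z' zx(2), of b] G_C[OF zx, of b] by simp
  qed
  obtain \<rho> \<tau> where *: "\<rho> \<in> R" "\<tau> \<in> R_perp" "\<xi> = \<rho> + \<tau>" "\<tau> = \<xi> - \<rho>"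
    using E_in_K[OF assms] by (rule R_decomp)
  have "\<rho> \<in> E" using *(1) R_E by blast
  then have "\<tau> \<in> E" using *(4) assms csubspace_diff[OF hilbert_space_csubspace[OF one.E]] by simp
  have K: "\<rho> \<in> K" "\<tau> \<in> K" using \<open>\<rho> \<in> E\<close> \<open>\<tau> \<in> E\<close> by (auto intro: E_in_K)
  show "G (c \<xi>) = c (G \<xi>)"
    using R[OF *(1)] G_perp[OF *(2)] G_perp[OF c_R_perp[OF *(2) \<open>\<tau> \<in> E\<close>]] K
    by (simp add: *(3) bounded_operator_add[OF 1] bounded_operator_add[OF 2])
  show "G \<xi> \<in> E"
    using G_R[OF *(1)] R_E G_perp[OF *(2)] \<open>\<tau> \<in> E\<close> K
    by (auto simp: *(3) bounded_operator_add[OF G_bounded] intro: csubspace_add[OF hilbert_space_csubspace[OF one.E]])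
qed

lemma a_R_perp: "x \<in> H \<Longrightarrow> a x \<in> R_perp"
  using R_E by (intro R_perpI one.a_K one.a_E) auto

lemma G_a: "x \<in> H \<Longrightarrow> G (a x) = a x"
  by (rule G_perp[OF a_R_perp])

text \<open>On the copy of \<open>H\<close> the exchange carries one correction term into the other
  and fixes the common part; on \<open>E\<close> both products are \<open>c\<close>, which commutes
  with \<open>G\<close> there.\<close>

lemma G_V1V2:
  assumes "k \<in> K"
  shows "G (V1 (V2 k)) = V2 (V1 (G k))"
proof (rule one.K_eqI[OF _ _ _ _ assms])
  show "bounded_operator K K (\<lambda>k. G (V1 (V2 k)))"
    by (rule bounded_operator_comp[OF bounded_operator_comp[OF two.V_bounded one.V_bounded] G_bounded])
  show "bounded_operator K K (\<lambda>k. V2 (V1 (G k)))"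
    by (rule bounded_operator_comp[OF bounded_operator_comp[OF G_bounded one.V_bounded] two.V_bounded])
  show "G (V1 (V2 (a x))) = V2 (V1 (G (a x)))" if "x \<in> H" for x
  proof -
    \<comment> \<open>Exhibits the correction term as the generator of \<open>R\<close> for the
      trivial word, so that \<open>G_C\<close> applies to it.\<close>
    have "\<zeta> b x = C [\<one>] (\<zeta> b x)" for b
      using that by (simp add: one.W.V_one \<zeta>_E E_in_K)
    then have "G (\<zeta> True x) = \<zeta> False x"
      using G_C[of "[\<one>]" x True] that by simp
    then show ?thesis
      using that
      by (simp add: G_a V1V2_a V2V1_a bounded_operator_add[OF G_bounded] one.a_K \<zeta>_E E_in_K one.S_in two.S_in)
  qed
  show "G (V1 (V2 (e w y))) = V2 (V1 (G (e w y)))" if "w \<in> lists (carrier P)" "y \<in> X" for w y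
  proof -
    have E: "e w y \<in> E" using that by (rule one.e_E)
    then show ?thesis
      using G_c[OF E] by (simp add: V2_E one.V_E c_def)
  qed
qed

text \<open>The range of \<open>V1 G\<close> is contained in that of \<open>V1\<close>. For
  \<open>G V2\<close>, self-adjointness of \<open>G\<close> and its commutation with
  \<open>W\<close> move \<open>G\<close> to the other argument, where the relations of
  \<open>V2\<close> apply. Since \<open>G\<close> fixes the copy of \<open>H\<close>, the action of
  the adjoints on it is unchanged.\<close>

theorem commuting_isometries:
  shows "nica_free P K W (\<lambda>k. V1 (G k))" "nica_free P K W (\<lambda>k. G (V2 k))"
    and "k \<in> K \<Longrightarrow> V1 (G (G (V2 k))) = G (V2 (V1 (G k)))"
    and "\<lbrakk>x \<in> H; k \<in> K\<rbrakk> \<Longrightarrow> cinner (V1 (G k)) (a x) = cinner k (a (adjt H S1 x))"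
    and "\<lbrakk>x \<in> H; k \<in> K\<rbrakk> \<Longrightarrow> cinner (G (V2 k)) (a x) = cinner k (a (adjt H S2 x))"
proof -
  show "nica_free P K W (\<lambda>k. V1 (G k))"
  proof
    show "hilbert_space K" "isometric_rep P K W" "nica_covariant P K W"
      by (fact one.K one.isometric_W one.nica_W)+
    show "linear_isometry K K (\<lambda>k. V1 (G k))"
      by (rule linear_isometry_comp[OF G one.V])
  qed (auto simp: one.orth_W one.orth_V G_in)
  show "nica_free P K W (\<lambda>k. G (V2 k))"
  proof
    show "hilbert_space K" "isometric_rep P K W" "nica_covariant P K W"
      by (fact one.K one.isometric_W one.nica_W)+
    show "linear_isometry K K (\<lambda>k. G (V2 k))"
      by (rule linear_isometry_comp[OF two.V G])
    show "cinner (G (V2 x)) (W p y) = 0" if "p \<in> carrier P" "p \<notin> Units P" "x \<in> K" "y \<in> K" for p x y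
      using that by (simp add: G_cinner two.V_in one.W.V_in G_W two.orth_W G_in)
    show "cinner (W p (G (V2 x))) (W q (G (V2 y))) = 0"
      if "p \<in> carrier P" "q \<in> carrier P" "p \<noteq> q" "x \<in> K" "y \<in> K" for p q x y
      using that by (simp add: G_W[symmetric] two.V_in one.W.V_in G_cinner G_G G_in two.orth_V)
  qed
  show "V1 (G (G (V2 k))) = G (V2 (V1 (G k)))" if "k \<in> K"
    using that by (simp add: G_G two.V_in one.V_in G_V1V2[symmetric])
  show "cinner (V1 (G k)) (a x) = cinner k (a (adjt H S1 x))" if "x \<in> H" "k \<in> K"
    using that adjt_in[OF one.H one.S, of x] by (simp add: one.V_adj_a G_in G_cinner one.a_K G_a)
  show "cinner (G (V2 k)) (a x) = cinner k (a (adjt H S2 x))" if "x \<in> H" "k \<in> K"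
    using that by (simp add: two.V_adj_a two.V_in G_cinner one.a_K G_a)
qed

end

section \<open>Reduction to a common space\<close>

locale free_regular = right_lcm_monoid P for P (structure) +
  fixes H :: "'h::complex_inner set" and T :: "'b \<Rightarrow> 'h \<Rightarrow> 'h" and S :: "'h \<Rightarrow> 'h"
    and L :: "'k::complex_inner set" and I :: "'h \<Rightarrow> 'k" and U :: "'b list \<Rightarrow> 'k \<Rightarrow> 'k"
  assumes H: "hilbert_space H" and T: "operator_rep P H T" and S: "bounded_operator H H S"
    and reg: "star_regular_dilation (alt_monoid P) H (alt_rep T S) L I U"
begin

sublocale A: star_regular "alt_monoid P" H "alt_rep T S" L I U
  by (intro star_regular.intro star_regular_axioms.intro right_lcm_alt H reg
      operator_rep_alt[OF S T hilbert_space_csubspace[OF H]])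

abbreviation "M \<equiv> A.M"

definition W :: "'b \<Rightarrow> 'k \<Rightarrow> 'k" where "W p = U [p]"
text \<open>In list form \<open>[\<one>, \<one>]\<close> is \<open>\<one> s \<one>\<close>, the
  generator of the natural numbers.\<close>

definition V :: "'k \<Rightarrow> 'k" where "V = U [\<one>, \<one>]"

lemma isometric_W: "isometric_rep P M W"
  unfolding isometric_rep_def operator_rep_def
proof (intro conjI ballI)
  fix p assume p: "p \<in> carrier P"
  show "linear_isometry M M (W p)" unfolding W_def using p by (intro A.min.V_isometry) simp
  then show "bounded_operator M M (W p)" by (rule linear_isometry_bounded)
next
  show "W \<one> x = x" if "x \<in> M" for x
    using A.min.V_one[OF that] by (simp add: W_def)
  show "W (p \<otimes> q) x = W p (W q x)" if "p \<in> carrier P" "q \<in> carrier P" "x \<in> M" for p q x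
    using A.min.V_mult[of "[p]" "[q]" x] that by (simp add: W_def)
qed

sublocale W: isometric_representation P M W
  by unfold_locales (fact A.M, fact isometric_W)

lemma nica_W: "nica_covariant P M W"
proof (rule W.nica_covariantI)
  fix p q assume pq: "p \<in> carrier P" "q \<in> carrier P"
  show "(\<exists>a b. lcm_pair P p q a b \<and> (\<forall>x\<in>M. W.Vs p (W q x) = W a (W.Vs b x))) \<or>
    disjoint_ideals P p q \<and> (\<forall>x\<in>M. W.Vs p (W q x) = 0)"
    using pq
  proof (cases rule: lcm_cases)
    case 1
    then show ?thesis
      using A.min.nica_disjoint[OF A.nica_covariant_M alt_disjoint_single[OF 1 pq]] pq by (simp add: W_def)
  next
    case (2 a b)
    have "\<forall>x\<in>M. W.Vs p (W q x) = W a (W.Vs b x)"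
      using A.min.nica_lcm[OF A.nica_covariant_M alt_lcm_single[OF 2 pq]] pq by (simp add: W_def)
    then show ?thesis using 2 by blast
  qed
qed

lemma V: "linear_isometry M M V"
  unfolding V_def by (rule A.min.V_isometry) simp

lemma V_in: "x \<in> M \<Longrightarrow> V x \<in> M"
  by (rule bounded_operator_in[OF linear_isometry_bounded[OF V]])

lemma V_cinner: "x \<in> M \<Longrightarrow> y \<in> M \<Longrightarrow> cinner (V x) (V y) = cinner x y"
  by (rule linear_isometry_cinner[OF V W.csubspace_K])

text \<open>\<open>\<one>\<close> is not in the ideal of a non-invertible \<open>p\<close>, so
  \<open>[p]\<close> and the generator have disjoint ideals in the free product.\<close>

lemma V_orth_W:
  assumes "p \<in> carrier P" "p \<notin> Units P" "x \<in> M" "y \<in> M"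
  shows "cinner (V x) (W p y) = 0"
proof -
  have "\<one> \<notin> p <# carrier P"
    using assms unit_of_mult[of p] unfolding l_coset_iff by metis
  then have "disjoint_ideals (alt_monoid P) [\<one>, \<one>] [p]"
    using disjoint_ideals_sym[OF alt_disjoint_single_Cons[of \<one> p "[\<one>]"]] assms by simp
  then show ?thesis
    using A.min.nica_disjoint_cinner[OF A.nica_covariant_M _ _ _ assms(3,4), of "[\<one>, \<one>]" "[p]"] assms
    by (simp add: V_def W_def)
qed

lemma W_V:
  assumes "p \<in> carrier P" "x \<in> M"
  shows "W p (V x) = U [p, \<one>] x"
  using A.min.V_mult[of "[p]" "[\<one>, \<one>]" x] assms by (simp add: V_def W_def)

lemma V_orth_V:
  assumes "p \<in> carrier P" "q \<in> carrier P" "p \<noteq> q" "x \<in> M" "y \<in> M"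
  shows "cinner (W p (V x)) (W q (V y)) = 0"
  using A.min.nica_disjoint_cinner[OF A.nica_covariant_M alt_disjoint_neq[OF assms(3), of "[\<one>]" "[\<one>]"] _ _ assms(4,5)]
    assms by (simp add: W_V)

lemma proj_W: "\<lbrakk>p \<in> carrier P; x \<in> M\<rbrakk> \<Longrightarrow> A.proj (W p x) = T p (A.proj x)"
  using A.proj_U[of "[p]" x] by (simp add: W_def)

lemma proj_V: "x \<in> M \<Longrightarrow> A.proj (V x) = S (A.proj x)"
  using A.proj_U[of "[\<one>, \<one>]" x] A.proj_in[of x] bounded_operator_in[OF S]
  by (simp add: V_def operator_rep_one[OF T])

lemma T_adj_in: "p \<in> carrier P \<Longrightarrow> adjt H (T p) h \<in> H"
  by (rule adjt_in[OF H operator_rep_bounded[OF T]])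

lemma adj_alt_single: "adjt H (alt_rep T S [p]) h = adjt H (T p) h"
  by (rule arg_cong[where f = "\<lambda>f. f h"], rule adjt_cong) simp

text \<open>The right-hand side depends on \<open>T\<close> alone, which is why the spaces
  \<open>H0\<close> of two dilations can be identified.\<close>

lemma gram_W_lcm:
  "\<lbrakk>lcm_pair P p q a b; p \<in> carrier P; q \<in> carrier P; h \<in> H; k \<in> H\<rbrakk> \<Longrightarrow>
    cinner (W q (I h)) (W p (I k)) = cinner (adjt H (T b) h) (adjt H (T a) k)"
  using A.gram_lcm[OF alt_lcm_single] unfolding adj_alt_single W_def by simp

lemma gram_W_disjoint:
  "\<lbrakk>disjoint_ideals P p q; p \<in> carrier P; q \<in> carrier P; h \<in> H; k \<in> H\<rbrakk> \<Longrightarrow>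
    cinner (W q (I h)) (W p (I k)) = 0"
  using A.gram_disjoint[OF alt_disjoint_single] unfolding W_def by simp

lemma Ws_lcm:
  assumes "lcm_pair P p q a b" "p \<in> carrier P" "q \<in> carrier P" "h \<in> H"
  shows "W.Vs p (W q (I h)) = W a (I (adjt H (T b) h))"
  using A.adj_generator[OF alt_lcm_single[OF assms(1-3)]] assms unfolding adj_alt_single W_def by simp

lemma Ws_disjoint:
  assumes "disjoint_ideals P p q" "p \<in> carrier P" "q \<in> carrier P" "h \<in> H"
  shows "W.Vs p (W q (I h)) = 0"
  using A.adj_generator_disjoint[OF alt_disjoint_single[OF assms(1-3)]] assms unfolding W_def by simp

text \<open>The adjoint form of \<open>proj_W\<close>: the copy of \<open>H\<close> is invariant
  under the adjoints of \<open>W\<close>.\<close>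

lemma Ws_I:
  assumes p: "p \<in> carrier P" and h: "h \<in> H"
  shows "W.Vs p (I h) = I (adjt H (T p) h)"
proof (rule W.Vs_eqI[OF p A.I_M[OF T_adj_in[OF p]]])
  fix x assume x: "x \<in> M"
  have "cinner (W p x) (I h) = cinner (A.proj (W p x)) h"
    by (rule A.proj_cinner[OF h])
  also have "\<dots> = cinner (A.proj x) (adjt H (T p) h)"
    unfolding proj_W[OF p x] by (rule adjt_cinner[OF H operator_rep_bounded[OF T p] A.proj_in])
  also have "\<dots> = cinner x (I (adjt H (T p) h))"
    by (rule A.proj_cinner[OF T_adj_in[OF p], symmetric])
  finally show "cinner (W p x) (I h) = cinner x (I (adjt H (T p) h))" .
qed

section \<open>The minimal dilation space of \<open>T\<close> inside \<open>M\<close>\<close>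

definition gens0 :: "'k set" where
  "gens0 = (\<lambda>(p, h). W p (I h)) ` (carrier P \<times> H)"

definition H0 :: "'k set" where
  "H0 = ccspan gens0"

lemma gens0_M: "gens0 \<subseteq> M"
  by (auto simp: gens0_def W.V_in A.I_M)

lemma H0: "hilbert_space H0"
  unfolding H0_def by (rule hilbert_space_ccspan[OF gens0_M A.M])

lemma H0_M: "x \<in> H0 \<Longrightarrow> x \<in> M"
  using ccspan_subset_hilbert[OF gens0_M A.M] by (auto simp: H0_def)

lemma gen_H0: "p \<in> carrier P \<Longrightarrow> h \<in> H \<Longrightarrow> W p (I h) \<in> H0"
  unfolding H0_def by (rule ccspan_base) (auto simp: gens0_def)

lemma I_H0: "h \<in> H \<Longrightarrow> I h \<in> H0"
  using gen_H0[OF one_closed] by (simp add: W.V_one A.I_M)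

lemma H0_invariant:
  assumes "bounded_operator M M B" "\<And>p h. p \<in> carrier P \<Longrightarrow> h \<in> H \<Longrightarrow> B (W p (I h)) \<in> H0" "x \<in> H0"
  shows "B x \<in> H0"
  using assms(3) unfolding H0_def
  by (rule bounded_operator_ccspan_in[OF assms(1) A.M gens0_M csubspace_ccspan closed_ccspan, rotated])
     (use assms(2) in \<open>auto simp: gens0_def H0_def\<close>)

lemma W_H0: "p \<in> carrier P \<Longrightarrow> x \<in> H0 \<Longrightarrow> W p x \<in> H0"
proof (rule H0_invariant[OF W.V_bounded])
  show "W p (W q (I h)) \<in> H0" if "p \<in> carrier P" "q \<in> carrier P" "h \<in> H" for q h
    using gen_H0[of "p \<otimes> q" h] that by (simp add: W.V_mult A.I_M)
qed

text \<open>The adjoint sends a generator to a generator or to zero. With \<open>W_H0\<close> this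
  makes \<open>H0\<close> reducing, so that covariance restricts to it.\<close>

lemma Ws_H0: "p \<in> carrier P \<Longrightarrow> x \<in> H0 \<Longrightarrow> W.Vs p x \<in> H0"
proof (rule H0_invariant[OF W.Vs_bounded])
  fix q h assume pq: "p \<in> carrier P" "q \<in> carrier P" and h: "h \<in> H"
  show "W.Vs p (W q (I h)) \<in> H0"
    using pq
  proof (cases rule: lcm_cases)
    case 1
    then show ?thesis
      using Ws_disjoint pq h csubspace_0[OF hilbert_space_csubspace[OF H0]] by simp
  next
    case (2 a b)
    then show ?thesis
      using Ws_lcm[OF 2 pq h] gen_H0[of a "adjt H (T b) h"] T_adj_in by (simp add: lcm_pair_def)
  qed
qed

lemma isometric_H0: "isometric_rep P H0 W"
  unfolding isometric_rep_def operator_rep_def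
proof (intro conjI ballI)
  fix p assume p: "p \<in> carrier P"
  show 1: "bounded_operator H0 H0 (W p)"
    by (rule bounded_operator_subset[OF W.V_bounded[OF p]]) (auto simp: H0_M W_H0 p)
  show "linear_isometry H0 H0 (W p)"
    using 1 W.V_isometry[OF p] H0_M by (auto simp: linear_isometry_def)
qed (auto simp: W.V_one W.V_mult H0_M)

sublocale W0: isometric_representation P H0 W
  by unfold_locales (fact H0, fact isometric_H0)

lemma Ws_eq: "p \<in> carrier P \<Longrightarrow> x \<in> H0 \<Longrightarrow> W0.Vs p x = W.Vs p x"
  by (rule W0.Vs_eqI) (auto simp: Ws_H0 W.Vs_cinner H0_M)

lemma nica_H0: "nica_covariant P H0 W"
proof (rule W0.nica_covariantI)
  fix p q assume pq: "p \<in> carrier P" "q \<in> carrier P"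
  show "(\<exists>a b. lcm_pair P p q a b \<and> (\<forall>x\<in>H0. W0.Vs p (W q x) = W a (W0.Vs b x))) \<or>
    disjoint_ideals P p q \<and> (\<forall>x\<in>H0. W0.Vs p (W q x) = 0)"
    using pq
  proof (cases rule: lcm_cases)
    case 1
    then show ?thesis
      using W.nica_disjoint[OF nica_W 1 pq] pq by (simp add: Ws_eq W_H0 H0_M)
  next
    case (2 a b)
    then have "b \<in> carrier P" by (simp add: lcm_pair_def)
    then have "\<forall>x\<in>H0. W0.Vs p (W q x) = W a (W0.Vs b x)"
      using W.nica_lcm[OF nica_W 2 pq] pq by (simp add: Ws_eq W_H0 H0_M)
    then show ?thesis using 2 by blast
  qed
qed

lemma H0_eqI:
  assumes "bounded_operator H0 K A" "bounded_operator H0 K' B"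
    and "\<And>p h. p \<in> carrier P \<Longrightarrow> h \<in> H \<Longrightarrow> A (W p (I h)) = B (W p (I h))" "x \<in> H0"
  shows "A x = B x"
proof (rule bounded_operator_eq_on_ccspan[OF assms(1,2) H0])
  show "gens0 \<subseteq> H0" unfolding H0_def by (rule ccspan_superset)
  show "x \<in> ccspan gens0" using assms(4) by (simp add: H0_def)
qed (auto simp: gens0_def assms(3))

text \<open>For an invertible \<open>p\<close> the vector \<open>W p (I h)\<close> lies in the image of \<open>I\<close>, so a vector of
  \<open>H0\<close> is determined by its projection to \<open>H\<close> once it is orthogonal to all other generators.\<close>

lemma H0_zeroI:
  assumes z: "z \<in> H0"
    and nonunit: "\<And>p y. \<lbrakk>p \<in> carrier P; p \<notin> Units P; y \<in> H0\<rbrakk> \<Longrightarrow> cinner z (W p y) = 0"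
    and proj: "A.proj z = 0"
  shows "z = 0"
proof (rule ccspan_ext[where S = gens0])
  show "z \<in> ccspan gens0" using z by (simp add: H0_def)
  fix s assume "s \<in> gens0"
  then obtain p h where s: "p \<in> carrier P" "h \<in> H" "s = W p (I h)" by (auto simp: gens0_def)
  have "cinner z s = 0"
  proof (cases "p \<in> Units P")
    case True
    then have "W p (I h) = W.Vs (inv p) (I h)"
      using W.Vs_unit[of "inv p" "I h"] s by (simp add: A.I_M Units_inv_Units)
    then have "s = I (adjt H (T (inv p)) h)"
      using True s by (simp add: Ws_I)
    then show ?thesis
      using True proj A.proj_cinner[OF T_adj_in, of "inv p" z h] by simp
  next
    case False
    then show ?thesis using nonunit s I_H0 by simp
  qed
  then show "cinner s z = cinner s 0" by (metis cinner_commute cinner_zero_right complex_cnj_zero)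
qed (simp add: csubspace_0 csubspace_ccspan)

text \<open>There are countably many alternating lists over a countable monoid, and by continuity in
  \<open>h\<close> a countable spanning set of \<open>H\<close> suffices.\<close>

lemma countable_M:
  assumes "countable (carrier P)" "separable_hilbert_space H"
  obtains N where "countable N" "N \<subseteq> M" "ccspan N = M"
proof -
  obtain C where C: "countable C" "C \<subseteq> H" "ccspan C = H"
    using assms(2) by (rule separable_hilbert_space_ccspan)
  define N where "N = (\<lambda>(x, h). U x (I h)) ` (carrier (alt_monoid P) \<times> C)"
  have "carrier (alt_monoid P) \<subseteq> lists (carrier P)" by (auto simp: in_lists_conv_set)
  then have "countable (carrier (alt_monoid P))"
    using countable_lists[OF assms(1)] countable_subset by blast
  then have "countable N" using C(1) by (auto simp: N_def)
  moreover have N: "N \<subseteq> M"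
    using C(2) by (auto simp: N_def A.gens_M simp del: alt_monoid_simps)
  moreover have "M \<subseteq> ccspan N"
    unfolding A.M_def
  proof (rule ccspan_minimal)
    show "A.gens \<subseteq> ccspan N"
    proof
      fix s assume "s \<in> A.gens"
      then obtain x h where s: "x \<in> carrier (alt_monoid P)" "h \<in> H" "s = U x (I h)"
        by (auto simp: A.gens_def)
      have "bounded_operator H M I"
        by (rule bounded_operator_subset[OF linear_isometry_bounded[OF A.I] subset_refl A.I_M])
      then have "bounded_operator H M (\<lambda>h. U x (I h))"
        by (rule bounded_operator_comp[OF _ A.min.V_bounded[OF s(1)]])
      then have "U x (I h) \<in> ccspan N"
        by (rule bounded_operator_ccspan_in[OF _ H C(2) csubspace_ccspan closed_ccspan])
           (use s C in \<open>auto simp: N_def intro!: ccspan_base\<close>)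
      then show "s \<in> ccspan N" using s by simp
    qed
  qed (rule csubspace_ccspan closed_ccspan)+
  ultimately show ?thesis
    using that ccspan_subset_hilbert[OF N A.M] by blast
qed

end

text \<open>\<open>\<Gamma>\<close> embeds a common copy \<open>Hc\<close> of the minimal dilation space of \<open>T\<close>; \<open>Sc\<close> and \<open>D\<close> are
  the components of \<open>V\<close> on this copy along it and along its complement.\<close>

locale branch = free_regular P H T S L I U
  for P :: "('b, 'm) monoid_scheme" (structure) and H :: "'h::complex_inner set" and T S
    and L :: "'k::complex_inner set" and I U +
  fixes Hc :: "'y::complex_inner set" and Wc :: "'b \<Rightarrow> 'y \<Rightarrow> 'y" and \<Gamma> :: "'y \<Rightarrow> 'k"
  assumes Hc: "hilbert_space Hc" and iso_Wc: "isometric_rep P Hc Wc"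
    and \<Gamma>: "linear_isometry Hc M \<Gamma>"
    and \<Gamma>_W: "\<lbrakk>p \<in> carrier P; x \<in> Hc\<rbrakk> \<Longrightarrow> \<Gamma> (Wc p x) = W p (\<Gamma> x)"
    and \<Gamma>_Ws: "\<lbrakk>p \<in> carrier P; x \<in> Hc\<rbrakk> \<Longrightarrow> W.Vs p (\<Gamma> x) = \<Gamma> (adjt Hc (Wc p) x)"
begin

sublocale Wc: isometric_representation P Hc Wc
  by unfold_locales (fact Hc, fact iso_Wc)

lemma \<Gamma>_bounded: "bounded_operator Hc M \<Gamma>"
  by (rule linear_isometry_bounded[OF \<Gamma>])

lemma \<Gamma>_in: "x \<in> Hc \<Longrightarrow> \<Gamma> x \<in> M"
  by (rule bounded_operator_in[OF \<Gamma>_bounded])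

lemma \<Gamma>_cinner: "\<lbrakk>x \<in> Hc; y \<in> Hc\<rbrakk> \<Longrightarrow> cinner (\<Gamma> x) (\<Gamma> y) = cinner x y"
  by (rule linear_isometry_cinner[OF \<Gamma> Wc.csubspace_K])

abbreviation "\<Gamma>s \<equiv> adjt Hc \<Gamma>"

lemma \<Gamma>s_in: "\<Gamma>s y \<in> Hc"
  by (rule adjt_in[OF Hc \<Gamma>_bounded])

lemma \<Gamma>s_cinner: "x \<in> Hc \<Longrightarrow> cinner x (\<Gamma>s y) = cinner (\<Gamma> x) y"
  by (rule adjt_cinner[OF Hc \<Gamma>_bounded, symmetric])

lemma \<Gamma>s_cinner': "x \<in> Hc \<Longrightarrow> cinner (\<Gamma>s y) x = cinner y (\<Gamma> x)"
  by (rule adjt_cinner'[OF Hc \<Gamma>_bounded, symmetric])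

definition Sc :: "'y \<Rightarrow> 'y" where "Sc x = \<Gamma>s (V (\<Gamma> x))"
definition D :: "'y \<Rightarrow> 'k" where "D x = V (\<Gamma> x) - \<Gamma> (Sc x)"

lemma Sc_in: "Sc x \<in> Hc"
  by (simp add: Sc_def \<Gamma>s_in)

lemma Sc_bounded: "bounded_operator Hc Hc Sc"
proof -
  have "bounded_operator M Hc \<Gamma>s"
    by (rule bounded_operator_subset[OF bounded_operator_adjt[OF Hc \<Gamma>_bounded]]) (auto simp: \<Gamma>s_in)
  then show ?thesis
    unfolding Sc_def
    by (rule bounded_operator_comp[OF bounded_operator_comp[OF \<Gamma>_bounded linear_isometry_bounded[OF V]]])
qed

lemma D_in: "x \<in> Hc \<Longrightarrow> D x \<in> M"
  unfolding D_def by (intro csubspace_diff[OF W.csubspace_K] V_in \<Gamma>_in Sc_in)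

lemma D_orth: "x \<in> Hc \<Longrightarrow> y \<in> Hc \<Longrightarrow> cinner (\<Gamma> y) (D x) = 0"
  by (simp add: D_def cinner_simps \<Gamma>_cinner Sc_in) (simp add: Sc_def \<Gamma>s_cinner)

lemma W_D_orth:
  assumes "q \<in> carrier P" "x \<in> Hc" "y \<in> Hc"
  shows "cinner (\<Gamma> y) (W q (D x)) = 0"
proof -
  have "cinner (\<Gamma> y) (W q (D x)) = cinner (W.Vs q (\<Gamma> y)) (D x)"
    using assms by (simp add: W.Vs_cinner' D_in)
  then show ?thesis using assms by (simp add: \<Gamma>_Ws D_orth Wc.Vs_in)
qed

text \<open>\<open>V_orth_V\<close> and isometry of \<open>V\<close> give the total; since the image
  of \<open>\<Gamma>\<close> reduces \<open>W\<close>, the mixed terms of the decomposition along it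
  vanish.\<close>

lemma gram:
  assumes pq: "p \<in> carrier P" "q \<in> carrier P" and xy: "x \<in> Hc" "y \<in> Hc"
  shows "cinner (Wc p (Sc x)) (Wc q (Sc y)) + cinner (W p (D x)) (W q (D y)) = (if p = q then cinner x y else 0)"
proof -
  have split: "W r (V (\<Gamma> z)) = \<Gamma> (Wc r (Sc z)) + W r (D z)" if "r \<in> carrier P" "z \<in> Hc" for r z
  proof -
    have "V (\<Gamma> z) = \<Gamma> (Sc z) + D z" by (simp add: D_def)
    then show ?thesis
      using that by (simp add: bounded_operator_add[OF W.V_bounded] \<Gamma>_in Sc_in D_in \<Gamma>_W)
  qed
  have flip: "cinner (W p (D x)) (\<Gamma> z) = 0" if "z \<in> Hc" for z
    using W_D_orth[OF pq(1) xy(1) that] by (metis cinner_commute complex_cnj_zero)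
  have "cinner (W p (V (\<Gamma> x))) (W q (V (\<Gamma> y))) = (if p = q then cinner x y else 0)"
    using pq xy V_orth_V by (simp add: W.V_cinner V_in V_cinner \<Gamma>_in \<Gamma>_cinner)
  then show ?thesis
    using pq xy
    by (simp add: split cinner_simps W_D_orth flip \<Gamma>_cinner Wc.V_in Sc_in)
qed

lemma vac_Sc: "\<lbrakk>p \<in> carrier P; p \<notin> Units P; x \<in> Hc; y \<in> Hc\<rbrakk> \<Longrightarrow> cinner (Sc x) (Wc p y) = 0"
  by (simp add: Sc_def \<Gamma>s_cinner' Wc.V_in \<Gamma>_W V_orth_W \<Gamma>_in)

text \<open>The adjoint of \<open>\<Gamma>\<close> intertwines the two actions because the image of
  \<open>\<Gamma>\<close> reduces \<open>W\<close>. So \<open>\<Gamma> (Sc x)\<close> inherits the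
  relation that \<open>V (\<Gamma> x)\<close> has, and hence so does their difference.\<close>

lemma vac_D:
  assumes "p \<in> carrier P" "p \<notin> Units P" "x \<in> Hc" "z \<in> M"
  shows "cinner (D x) (W p z) = 0"
proof -
  have "\<Gamma>s (W p z) = Wc p (\<Gamma>s z)"
  proof (rule adjt_unique[OF Wc.csubspace_K])
    show "Wc p (\<Gamma>s z) \<in> Hc" using assms by (simp add: Wc.V_in \<Gamma>s_in)
    fix y assume y: "y \<in> Hc"
    have "cinner (\<Gamma> y) (W p z) = cinner (\<Gamma> (Wc.Vs p y)) z"
      using assms y by (simp flip: \<Gamma>_Ws add: W.Vs_cinner')
    then show "cinner (\<Gamma> y) (W p z) = cinner y (Wc p (\<Gamma>s z))"
      using assms y by (simp add: \<Gamma>s_in Wc.Vs_in flip: \<Gamma>s_cinner Wc.Vs_cinner')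
  qed
  then have "cinner (\<Gamma> (Sc x)) (W p z) = cinner (Sc x) (Wc p (\<Gamma>s z))"
    by (simp add: Sc_in flip: \<Gamma>s_cinner)
  then show ?thesis
    using assms by (simp add: D_def cinner_simps V_orth_W \<Gamma>_in vac_Sc \<Gamma>s_in)
qed

text \<open>The copy of \<open>H\<close> lies inside the common space, so compressing
  \<open>V\<close> there loses nothing that \<open>proj_V\<close> sees: \<open>Sc\<close> co-extends
  \<open>S\<close>.\<close>

lemma proj_Sc:
  assumes x: "x \<in> Hc" and Jc: "\<And>h. h \<in> H \<Longrightarrow> Jc h \<in> Hc" "\<And>h. h \<in> H \<Longrightarrow> \<Gamma> (Jc h) = I h" and h: "h \<in> H"
  shows "cinner (Sc x) (Jc h) = cinner x (Jc (adjt H S h))"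
proof -
  have S': "adjt H S h \<in> H" by (rule adjt_in[OF H S])
  have "cinner (Sc x) (Jc h) = cinner (V (\<Gamma> x)) (I h)"
    using Jc[OF h] by (simp add: Sc_def \<Gamma>s_cinner')
  also have "\<dots> = cinner (S (A.proj (\<Gamma> x))) h"
    using x h by (simp add: A.proj_cinner proj_V \<Gamma>_in)
  also have "\<dots> = cinner (A.proj (\<Gamma> x)) (adjt H S h)"
    by (rule adjt_cinner[OF H S A.proj_in])
  also have "\<dots> = cinner (\<Gamma> x) (\<Gamma> (Jc (adjt H S h)))"
    using S' by (simp add: Jc A.proj_cinner)
  also have "\<dots> = cinner x (Jc (adjt H S h))"
    by (rule \<Gamma>_cinner[OF x Jc(1)[OF S']])
  finally show ?thesis .
qed

end

text \<open>The adjoint of \<open>J\<close> intertwines all words once it intertwines the letters.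
  Applied to vectors of the copy of \<open>H\<close> this is the dilation identity; passing to
  adjoints, it is invariance of that copy.\<close>

lemma (in free_factors) co_extension_free_product:
  assumes H: "hilbert_space H" and K: "hilbert_space K" and J: "linear_isometry H K J"
    and V: "isometric_rep Q K V" and W: "isometric_rep P K W"
    and S: "operator_rep Q H S" and T: "operator_rep P H T"
    and V_J: "\<And>q x. \<lbrakk>q \<in> carrier Q; x \<in> K\<rbrakk> \<Longrightarrow> adjt H J (V q x) = S q (adjt H J x)"
    and W_J: "\<And>p x. \<lbrakk>p \<in> carrier P; x \<in> K\<rbrakk> \<Longrightarrow> adjt H J (W p x) = T p (adjt H J x)"
  shows "co_extension (free_product Q P) H (free_product_rep S T) K J (free_product_rep V W)"
proof -
  have sub: "csubspace H" "csubspace K" using H K by (auto intro: hilbert_space_csubspace)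
  note Jb = linear_isometry_bounded[OF J]
  have rep: "operator_rep Q K V" "operator_rep P K W" using V W by (auto simp: isometric_rep_def)
  have iso: "isometric_rep (free_product Q P) K (free_product_rep V W)"
    by (rule isometric_rep_free_product[OF V W sub(2)])
  have rep_H: "operator_rep (free_product Q P) H (free_product_rep S T)"
    by (rule operator_rep_free_product[OF S T sub(1)])
  have J_in: "J h \<in> K" if "h \<in> H" for h by (rule bounded_operator_in[OF Jb that])
  have J_J: "adjt H J (J h) = h" if "h \<in> H" for h
    by (rule adjt_unique[OF sub(1) that]) (rule linear_isometry_cinner[OF J sub(1) _ that])
  have proj: "orthogonal_projection (J ` H) x = J (adjt H J x)" for x
  proof (rule orthogonal_projection_unique)
    show "csubspace (J ` H)"
      by (rule hilbert_space_csubspace[OF linear_isometry_hilbert_image[OF J H]])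
    show "J (adjt H J x) \<in> J ` H" by (rule imageI[OF adjt_in[OF H Jb]])
    show "cinner (x - J (adjt H J x)) z = 0" if "z \<in> J ` H" for z
      using that linear_isometry_cinner[OF J sub(1) adjt_in[OF H Jb]]
      by (auto simp: cinner_diff_left adjt_cinner'[OF H Jb])
  qed
  have intertwine: "adjt H J (free_product_rep V W X x) = free_product_rep S T X (adjt H J x)"
    if X: "X \<in> carrier (free_product Q P)" and x: "x \<in> K" for X x
  proof -
    obtain w where w: "w \<in> words" "X = cls w" using X by (auto simp: carrier_free_product)
    show ?thesis
      using word_intertwine[of K V "adjt H J" S W T w x] w x V_J W_J
        operator_rep_in[OF rep(1)] operator_rep_in[OF rep(2)]
        free_product_rep_class[OF rep w(1) x] free_product_rep_class[OF S T w(1) adjt_in[OF H Jb]]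
      by simp
  qed
  have adj: "adjt K (free_product_rep V W X) (J h) = J (adjt H (free_product_rep S T X) h)"
    if X: "X \<in> carrier (free_product Q P)" and h: "h \<in> H" for X h
  proof (rule adjt_unique[OF sub(2)])
    note b = operator_rep_bounded[OF rep_H X]
    show "J (adjt H (free_product_rep S T X) h) \<in> K" by (rule J_in[OF adjt_in[OF H b]])
    fix x assume x: "x \<in> K"
    have "cinner (free_product_rep V W X x) (J h) = cinner (free_product_rep S T X (adjt H J x)) h"
      by (simp add: adjt_cinner'[OF H Jb h] intertwine[OF X x])
    also have "\<dots> = cinner (adjt H J x) (adjt H (free_product_rep S T X) h)"
      by (rule adjt_cinner[OF H b adjt_in[OF H Jb]])
    finally show "cinner (free_product_rep V W X x) (J h) = cinner x (J (adjt H (free_product_rep S T X) h))"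
      by (simp add: adjt_cinner'[OF H Jb adjt_in[OF H b]])
  qed
  have "isometric_dilation (free_product Q P) H (free_product_rep S T) K J (free_product_rep V W)"
    unfolding isometric_dilation_def by (auto simp: K J iso proj intertwine J_in J_J)
  moreover have "adjt H (free_product_rep S T X) h \<in> H" if "X \<in> carrier (free_product Q P)" for X h
    by (rule adjt_in[OF H operator_rep_bounded[OF rep_H that]])
  ultimately show ?thesis
    unfolding co_extension_def hilbert_adjoint_adjt by (auto simp: adj)
qed

section \<open>Identification of the two minimal dilation spaces of \<open>T\<close>\<close>

locale free_regular_pair = b1: free_regular P H T S1 L1 I1 U1 + b2: free_regular P H T S2 L2 I2 U2
  for P :: "('b, 'm) monoid_scheme" (structure) and H :: "'h::complex_inner set" and T S1 S2
    and L1 :: "'k1::complex_inner set" and I1 U1 and L2 :: "'k2::complex_inner set" and I2 U2 +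
  assumes S_comm: "x \<in> H \<Longrightarrow> S1 (S2 x) = S2 (S1 x)"
begin

definition \<Gamma>_spec :: "('k1 \<Rightarrow> 'k2) \<Rightarrow> bool" where
  "\<Gamma>_spec A \<longleftrightarrow> linear_isometry b1.H0 b2.H0 A \<and> (\<forall>p\<in>carrier P. \<forall>h\<in>H. A (b1.W p (I1 h)) = b2.W p (I2 h))"

lemma ex_\<Gamma>: "\<exists>A. \<Gamma>_spec A"
proof -
  define f where "f = (\<lambda>(p, h). b1.W p (I1 h))"
  define g where "g = (\<lambda>(p, h). b2.W p (I2 h))"
  have fg: "f ` (carrier P \<times> H) = b1.gens0" "g ` (carrier P \<times> H) = b2.gens0"
    by (simp_all add: f_def g_def b1.gens0_def b2.gens0_def)
  have eq: "cinner (b1.W p (I1 h)) (b1.W q (I1 k)) = cinner (b2.W p (I2 h)) (b2.W q (I2 k))"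
    if "p \<in> carrier P" "q \<in> carrier P" "h \<in> H" "k \<in> H" for p q h k
    using that(2,1)
  proof (cases rule: b1.lcm_cases)
    case 1
    then show ?thesis using b1.gram_W_disjoint[OF 1] b2.gram_W_disjoint[OF 1] that by simp
  next
    case (2 a b)
    then show ?thesis using b1.gram_W_lcm[OF 2] b2.gram_W_lcm[OF 2] that by simp
  qed
  obtain A where "linear_isometry (ccspan (f ` (carrier P \<times> H))) (ccspan (g ` (carrier P \<times> H))) A"
    "\<And>i. i \<in> carrier P \<times> H \<Longrightarrow> A (f i) = g i"
    by (rule gram_isometry[of b1.M "carrier P \<times> H" f b2.M g])
       (use b1.A.M b2.A.M b1.W.V_in b2.W.V_in b1.A.I_M b2.A.I_M eq in \<open>auto simp: f_def g_def\<close>)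
  then have "\<Gamma>_spec A"
    unfolding \<Gamma>_spec_def fg b1.H0_def b2.H0_def by (auto simp: f_def g_def)
  then show ?thesis by blast
qed

definition \<Gamma> :: "'k1 \<Rightarrow> 'k2" where "\<Gamma> = (SOME A. \<Gamma>_spec A)"

lemma \<Gamma>_spec: "\<Gamma>_spec \<Gamma>"
  unfolding \<Gamma>_def by (rule someI_ex[OF ex_\<Gamma>])

lemma \<Gamma>_gen: "\<lbrakk>p \<in> carrier P; h \<in> H\<rbrakk> \<Longrightarrow> \<Gamma> (b1.W p (I1 h)) = b2.W p (I2 h)"
  using \<Gamma>_spec by (auto simp: \<Gamma>_spec_def)

lemma \<Gamma>_isometry: "linear_isometry b1.H0 b2.M \<Gamma>"
  using \<Gamma>_spec b2.H0_M unfolding \<Gamma>_spec_def linear_isometry_def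
  by (auto intro: bounded_operator_subset dest: bounded_operator_in)

lemma \<Gamma>_I: "h \<in> H \<Longrightarrow> \<Gamma> (I1 h) = I2 h"
  using \<Gamma>_gen[OF b1.one_closed] by (simp add: b1.W.V_one b2.W.V_one b1.A.I_M b2.A.I_M)

text \<open>The common space is the \<open>H0\<close> of the first dilation, placed in the first
  \<open>M\<close> by inclusion and in the second by \<open>\<Gamma>\<close>.\<close>

sublocale c1: branch P H T S1 L1 I1 U1 b1.H0 b1.W "\<lambda>x. x"
proof
  show "linear_isometry b1.H0 b1.M (\<lambda>x. x)"
    by (rule linear_isometryI) (auto simp: b1.H0_M)
qed (auto simp: b1.H0 b1.isometric_H0 b1.Ws_eq)

sublocale c2: branch P H T S2 L2 I2 U2 b1.H0 b1.W \<Gamma>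
proof
  show "hilbert_space b1.H0" "isometric_rep P b1.H0 b1.W" "linear_isometry b1.H0 b2.M \<Gamma>"
    by (fact b1.H0 b1.isometric_H0 \<Gamma>_isometry)+
  note bd = linear_isometry_bounded[OF \<Gamma>_isometry]
  fix p x assume p: "p \<in> carrier P" and x: "x \<in> b1.H0"
  show "\<Gamma> (b1.W p x) = b2.W p (\<Gamma> x)"
  proof (rule b1.H0_eqI[OF bounded_operator_comp[OF b1.W0.V_bounded[OF p] bd]
        bounded_operator_comp[OF bd b2.W.V_bounded[OF p]] _ x])
    show "\<Gamma> (b1.W p (b1.W q (I1 h))) = b2.W p (\<Gamma> (b1.W q (I1 h)))" if "q \<in> carrier P" "h \<in> H" for q h
      using that p \<Gamma>_gen[of "p \<otimes> q" h]
      by (simp add: \<Gamma>_gen b1.W.V_mult b2.W.V_mult b1.A.I_M b2.A.I_M)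
  qed
  show "b2.W.Vs p (\<Gamma> x) = \<Gamma> (b1.W0.Vs p x)"
  proof (rule b1.H0_eqI[OF bounded_operator_comp[OF bd b2.W.Vs_bounded[OF p]]
        bounded_operator_comp[OF b1.W0.Vs_bounded[OF p] bd] _ x])
    fix q h assume q: "q \<in> carrier P" and h: "h \<in> H"
    show "b2.W.Vs p (\<Gamma> (b1.W q (I1 h))) = \<Gamma> (b1.W0.Vs p (b1.W q (I1 h)))"
      using p q
    proof (cases rule: b1.lcm_cases)
      case 1
      have "\<Gamma> 0 = 0"
        by (rule bounded_operator_zero[OF bd csubspace_0[OF b1.W0.csubspace_K]])
      then show ?thesis
        using 1 p q h by (simp add: \<Gamma>_gen b1.Ws_eq b1.gen_H0 b1.Ws_disjoint b2.Ws_disjoint)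
    next
      case (2 a b)
      then have "a \<in> carrier P" "b \<in> carrier P" by (auto simp: lcm_pair_def)
      then show ?thesis
        using p q h by (simp add: \<Gamma>_gen b1.Ws_eq b1.gen_H0 b1.Ws_lcm[OF 2] b2.Ws_lcm[OF 2] b1.T_adj_in)
    qed
  qed
qed

lemma Sc1_I: "\<lbrakk>x \<in> b1.H0; h \<in> H\<rbrakk> \<Longrightarrow> cinner (c1.Sc x) (I1 h) = cinner x (I1 (adjt H S1 h))"
  by (rule c1.proj_Sc) (auto simp: b1.I_H0)

lemma Sc2_I: "\<lbrakk>x \<in> b1.H0; h \<in> H\<rbrakk> \<Longrightarrow> cinner (c2.Sc x) (I1 h) = cinner x (I1 (adjt H S2 h))"
  by (rule c2.proj_Sc) (auto simp: b1.I_H0 \<Gamma>_I)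

lemma S_adj_in: "adjt H S1 h \<in> H" "adjt H S2 h \<in> H"
  by (rule adjt_in[OF b1.H b1.S], rule adjt_in[OF b1.H b2.S])

text \<open>The difference is orthogonal to every \<open>W p y\<close> with non-invertible
  \<open>p\<close>, because the ranges of both compressions are. Its projection to \<open>H\<close>
  vanishes because the adjoints of \<open>S1\<close> and \<open>S2\<close> commute.\<close>

lemma Sc_comm:
  assumes x: "x \<in> b1.H0"
  shows "c1.Sc (c2.Sc x) = c2.Sc (c1.Sc x)"
proof -
  define z where "z = c1.Sc (c2.Sc x) - c2.Sc (c1.Sc x)"
  have adj: "adjt H S1 (adjt H S2 h) = adjt H S2 (adjt H S1 h)" for h
  proof -
    have "adjt H (\<lambda>x. S2 (S1 x)) = adjt H (\<lambda>x. S1 (S2 x))"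
      by (rule adjt_cong) (simp add: S_comm)
    then show ?thesis
      using adjt_comp[OF b1.H b1.H b1.S b2.S, of h] adjt_comp[OF b1.H b1.H b2.S b1.S, of h] by simp
  qed
  have "z = 0"
  proof (rule b1.H0_zeroI)
    show "z \<in> b1.H0"
      unfolding z_def by (intro csubspace_diff[OF b1.W0.csubspace_K] c1.Sc_in c2.Sc_in)
    show "cinner z (b1.W p y) = 0" if "p \<in> carrier P" "p \<notin> Units P" "y \<in> b1.H0" for p y
      using that by (simp add: z_def cinner_simps c1.vac_Sc c2.vac_Sc c1.Sc_in c2.Sc_in)
    show "b1.A.proj z = 0"
    proof (rule adjt_unique[OF hilbert_space_csubspace[OF b1.H]])
      show "cinner (I1 h) z = cinner h 0" if "h \<in> H" for h
      proof -
        have "cinner z (I1 h) = 0"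
          using that x by (simp add: z_def cinner_simps Sc1_I Sc2_I c1.Sc_in c2.Sc_in S_adj_in adj)
        then show ?thesis by (metis cinner_commute cinner_zero_right complex_cnj_zero)
      qed
    qed (rule csubspace_0[OF hilbert_space_csubspace[OF b1.H]])
  qed
  then show ?thesis by (simp add: z_def)
qed

end

section \<open>Realization of the space of words inside \<open>ell2\<close>\<close>

locale embedded_pair = free_regular_pair P H T S1 S2 L1 I1 U1 L2 I2 U2
  for P :: "('b, 'm) monoid_scheme" (structure) and H :: "'h::complex_inner set" and T S1 S2
    and L1 :: "'k1::complex_inner set" and I1 U1 and L2 :: "'k2::complex_inner set" and I2 U2 +
  fixes \<beta>1 :: "'k1 \<Rightarrow> ell2" and \<beta>2 :: "'k2 \<Rightarrow> ell2"
  assumes countable: "countable (carrier P)"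
    and \<beta>1: "linear_isometry b1.M (UNIV :: ell2 set) \<beta>1" and \<beta>2: "linear_isometry b2.M (UNIV :: ell2 set) \<beta>2"
begin

lemma \<beta>1_cinner: "\<lbrakk>x \<in> b1.M; y \<in> b1.M\<rbrakk> \<Longrightarrow> cinner (\<beta>1 x) (\<beta>1 y) = cinner x y"
  by (rule linear_isometry_cinner[OF \<beta>1 b1.W.csubspace_K])

lemma \<beta>2_cinner: "\<lbrakk>x \<in> b2.M; y \<in> b2.M\<rbrakk> \<Longrightarrow> cinner (\<beta>2 x) (\<beta>2 y) = cinner x y"
  by (rule linear_isometry_cinner[OF \<beta>2 b2.W.csubspace_K])

definition X where "X = b1.M \<times> b2.M"
definition WX where "WX p x = (b1.W p (fst x), b2.W p (snd x))"

definition a where "a x = ell2_copy 0 (\<beta>1 x)"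
text \<open>The word with number \<open>n\<close> occupies the copies \<open>2 * n + 1\<close> and
  \<open>2 * n + 2\<close>, one for each component of \<open>X\<close>; copy \<open>0\<close> holds
  the common space.\<close>

definition e where "e w x =
  ell2_copy (Suc (2 * to_nat_on (lists (carrier P)) w)) (\<beta>1 (fst x)) +
  ell2_copy (Suc (Suc (2 * to_nat_on (lists (carrier P)) w))) (\<beta>2 (snd x))"

lemma X: "hilbert_space X"
  unfolding X_def by (rule hilbert_space_Times[OF b1.A.M b2.A.M])

lemma X_iff: "x \<in> X \<longleftrightarrow> fst x \<in> b1.M \<and> snd x \<in> b2.M"
  by (simp add: X_def mem_Times_iff)

lemma WX_isometry: "p \<in> carrier P \<Longrightarrow> linear_isometry X X (WX p)"
  by (rule linear_isometry_of_cinner[OF hilbert_space_csubspace[OF X]])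
     (auto simp: X_iff WX_def b1.W.V_in b2.W.V_in cinner_prod_def b1.W.V_cinner b2.W.V_cinner)

lemma isometric_WX: "isometric_rep P X WX"
  unfolding isometric_rep_def operator_rep_def
  using WX_isometry linear_isometry_bounded[OF WX_isometry]
  by (auto simp: X_iff WX_def b1.W.V_one b2.W.V_one b1.W.V_mult b2.W.V_mult)

sublocale WX: isometric_representation P X WX
  by unfold_locales (fact X, fact isometric_WX)

lemma WX_adj: "p \<in> carrier P \<Longrightarrow> x \<in> X \<Longrightarrow> WX.Vs p x = (b1.W.Vs p (fst x), b2.W.Vs p (snd x))"
  by (rule WX.Vs_eqI)
     (auto simp: X_iff WX_def cinner_prod_def b1.W.Vs_in b2.W.Vs_in b1.W.Vs_cinner b2.W.Vs_cinner)

lemma nica_WX: "nica_covariant P X WX"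
proof (rule WX.nica_covariantI)
  fix p q assume pq: "p \<in> carrier P" "q \<in> carrier P"
  have WX_in: "WX r x \<in> X" if "r \<in> carrier P" "x \<in> X" for r x
    by (rule WX.V_in[OF that])
  show "(\<exists>a b. lcm_pair P p q a b \<and> (\<forall>x\<in>X. WX.Vs p (WX q x) = WX a (WX.Vs b x))) \<or>
    disjoint_ideals P p q \<and> (\<forall>x\<in>X. WX.Vs p (WX q x) = 0)"
    using pq
  proof (cases rule: b1.lcm_cases)
    case 1
    then show ?thesis
      using pq b1.W.nica_disjoint[OF b1.nica_W 1 pq] b2.W.nica_disjoint[OF b2.nica_W 1 pq] WX_in[OF pq(2)]
      by (simp add: WX_adj) (simp add: WX_def X_iff zero_prod_def)
  next
    case (2 a b)
    then have "b \<in> carrier P" by (simp add: lcm_pair_def)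
    then have "\<forall>x\<in>X. WX.Vs p (WX q x) = WX a (WX.Vs b x)"
      using pq b1.W.nica_lcm[OF b1.nica_W 2 pq] b2.W.nica_lcm[OF b2.nica_W 2 pq] WX_in[OF pq(2)]
      by (simp add: WX_adj) (simp add: WX_def X_iff)
    then show ?thesis using 2 by blast
  qed
qed

text \<open>Placing the defects in different components of \<open>X\<close> makes all their
  translates orthogonal.\<close>

definition D1 where "D1 x = (c1.D x, 0)"
definition D2 where "D2 x = (0, c2.D x)"

lemma zero_M: "0 \<in> b1.M" "0 \<in> b2.M"
  by (rule csubspace_0[OF b1.W.csubspace_K], rule csubspace_0[OF b2.W.csubspace_K])

lemma W_zero: "p \<in> carrier P \<Longrightarrow> b1.W p 0 = 0" "p \<in> carrier P \<Longrightarrow> b2.W p 0 = 0"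
  by (simp_all add: bounded_operator_zero[OF b1.W.V_bounded zero_M(1)]
      bounded_operator_zero[OF b2.W.V_bounded zero_M(2)])

lemma creation: "creation P b1.H0 b1.W X WX a e"
proof
  show "hilbert_space b1.H0" "hilbert_space X" "isometric_rep P b1.H0 b1.W" "nica_covariant P b1.H0 b1.W"
    "isometric_rep P X WX" "nica_covariant P X WX"
    by (fact b1.H0 X b1.isometric_H0 b1.nica_H0 isometric_WX nica_WX)+
  show "cinner (a x) (a y) = cinner x y" if "x \<in> b1.H0" "y \<in> b1.H0" for x y
    using that by (simp add: a_def cinner_ell2_copy \<beta>1_cinner b1.H0_M)
  show "cinner (a x) (e w y) = 0" if "x \<in> b1.H0" "w \<in> lists (carrier P)" "y \<in> X" for x w y
    by (simp add: a_def e_def cinner_simps cinner_ell2_copy)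
  fix w w' x y assume w: "w \<in> lists (carrier P)" "w' \<in> lists (carrier P)" and xy: "x \<in> X" "y \<in> X"
  let ?n = "to_nat_on (lists (carrier P))"
  have "?n w = ?n w' \<longleftrightarrow> w = w'"
    using w by (simp add: to_nat_on_inj countable_lists[OF countable])
  moreover have "2 * ?n w \<noteq> Suc (2 * ?n w')" "Suc (2 * ?n w) \<noteq> 2 * ?n w'" by presburger+
  ultimately show "cinner (e w x) (e w' y) = (if w = w' then cinner x y else 0)"
    using xy by (auto simp: e_def cinner_simps cinner_ell2_copy \<beta>1_cinner \<beta>2_cinner X_iff cinner_prod_def)
qed

sublocale commuting_seed P b1.H0 b1.W X WX a e c1.Sc D1 c2.Sc D2
proof (intro commuting_seed.intro creation_op.intro creation creation_op_axioms.intro commuting_seed_axioms.intro)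
  show "bounded_operator b1.H0 b1.H0 c1.Sc" "bounded_operator b1.H0 b1.H0 c2.Sc"
    by (fact c1.Sc_bounded c2.Sc_bounded)+
  show "D1 x \<in> X" "D2 x \<in> X" if "x \<in> b1.H0" for x
    using that by (simp_all add: D1_def D2_def X_iff c1.D_in c2.D_in zero_M)
  show "cinner (b1.W p (c1.Sc x)) (b1.W q (c1.Sc y)) + cinner (WX p (D1 x)) (WX q (D1 y)) =
      (if p = q then cinner x y else 0)"
    "cinner (b1.W p (c2.Sc x)) (b1.W q (c2.Sc y)) + cinner (WX p (D2 x)) (WX q (D2 y)) =
      (if p = q then cinner x y else 0)"
    "cinner (WX p (D1 x)) (WX q (D2 y)) = 0"
    if "p \<in> carrier P" "q \<in> carrier P" "x \<in> b1.H0" "y \<in> b1.H0" for p q x y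
    using c1.gram[OF that] c2.gram[OF that] that
    by (simp_all add: D1_def D2_def WX_def cinner_prod_def W_zero)
  show "cinner (c1.Sc x) (b1.W p y) = 0" "cinner (c2.Sc x) (b1.W p y) = 0"
    if "p \<in> carrier P" "p \<notin> Units P" "x \<in> b1.H0" "y \<in> b1.H0" for p x y
    using that by (rule c1.vac_Sc, rule c2.vac_Sc)
  show "cinner (D1 x) (WX p z) = 0" "cinner (D2 x) (WX p z) = 0"
    if "p \<in> carrier P" "p \<notin> Units P" "x \<in> b1.H0" "z \<in> X" for p x z
    using that by (simp_all add: D1_def D2_def WX_def cinner_prod_def X_iff c1.vac_D c2.vac_D)
  show "c1.Sc (c2.Sc x) = c2.Sc (c1.Sc x)" if "x \<in> b1.H0" for x
    by (rule Sc_comm[OF that])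
qed

definition J where "J h = a (I1 h)"

lemma J: "linear_isometry H K J"
  by (rule linear_isometry_of_cinner[OF hilbert_space_csubspace[OF b1.H]])
     (simp_all add: J_def one.a_K one.a_cinner b1.I_H0 b1.A.I_cinner)

lemma J_bounded: "bounded_operator H K J"
  by (rule linear_isometry_bounded[OF J])

text \<open>If the adjoint of \<open>B\<close> acts on the copy of \<open>H\<close> as that of
  \<open>A\<close>, then dually the adjoint of \<open>J\<close> intertwines \<open>B\<close> with
  \<open>A\<close>.\<close>

lemma J_adj_V:
  assumes A: "bounded_operator H H A"
    and B: "\<And>k h. \<lbrakk>k \<in> K; h \<in> H\<rbrakk> \<Longrightarrow> cinner (B k) (J h) = cinner k (J (adjt H A h))" and k: "k \<in> K"
  shows "adjt H J (B k) = A (adjt H J k)"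
proof (rule adjt_unique[OF hilbert_space_csubspace[OF b1.H]])
  show "A (adjt H J k) \<in> H" by (rule bounded_operator_in[OF A adjt_in[OF b1.H J_bounded]])
  fix h assume h: "h \<in> H"
  have "cinner (B k) (J h) = cinner (adjt H J k) (adjt H A h)"
    by (simp add: B[OF k h] adjt_cinner'[OF b1.H J_bounded adjt_in[OF b1.H A]])
  also have "\<dots> = cinner (A (adjt H J k)) h"
    by (rule adjt_cinner[OF b1.H A adjt_in[OF b1.H J_bounded], symmetric])
  finally show "cinner (J h) (B k) = cinner h (A (adjt H J k))"
    by (metis cinner_commute)
qed

lemma J_adj_V1: "k \<in> K \<Longrightarrow> adjt H J (V1 (G k)) = S1 (adjt H J k)"
proof (rule J_adj_V[OF b1.S])
  fix k h assume k: "k \<in> K" and h: "h \<in> H"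
  have "adjt b1.H0 c1.Sc (I1 h) = I1 (adjt H S1 h)"
    by (rule adjt_unique[OF b1.W0.csubspace_K]) (auto simp: b1.I_H0 S_adj_in Sc1_I h)
  then show "cinner (V1 (G k)) (J h) = cinner k (J (adjt H S1 h))"
    using commuting_isometries(4)[OF b1.I_H0[OF h] k] by (simp add: J_def)
qed

lemma J_adj_V2: "k \<in> K \<Longrightarrow> adjt H J (G (V2 k)) = S2 (adjt H J k)"
proof (rule J_adj_V[OF b2.S])
  fix k h assume k: "k \<in> K" and h: "h \<in> H"
  have "adjt b1.H0 c2.Sc (I1 h) = I1 (adjt H S2 h)"
    by (rule adjt_unique[OF b1.W0.csubspace_K]) (auto simp: b1.I_H0 S_adj_in Sc2_I h)
  then show "cinner (G (V2 k)) (J h) = cinner k (J (adjt H S2 h))"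
    using commuting_isometries(5)[OF b1.I_H0[OF h] k] by (simp add: J_def)
qed

lemma J_adj_W:
  assumes p: "p \<in> carrier P" and k: "k \<in> K"
  shows "adjt H J (W p k) = T p (adjt H J k)"
proof (rule J_adj_V[OF operator_rep_bounded[OF b1.T p] _ k])
  fix k h assume "k \<in> K" "h \<in> H"
  then show "cinner (W p k) (J h) = cinner k (J (adjt H (T p) h))"
    using p by (simp add: J_def one.W_adj_a b1.I_H0 b1.Ws_eq b1.Ws_I)
qed

lemma funpow_intertwine:
  assumes "linear_isometry K K V" "\<And>k. k \<in> K \<Longrightarrow> adjt H J (V k) = S (adjt H J k)" "k \<in> K"
  shows "(V ^^ n) k \<in> K \<and> norm ((V ^^ n) k) = norm k \<and> adjt H J ((V ^^ n) k) = (S ^^ n) (adjt H J k)"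
  by (induction n) (use assms in \<open>auto simp: linear_isometry_def bounded_operator_def\<close>)

theorem dilation:
  "\<exists>(K :: ell2 set) J V1 V2 W.
     hilbert_space K \<and> linear_isometry H K J \<and> linear_isometry K K V1 \<and> linear_isometry K K V2 \<and>
     (\<forall>x\<in>K. V1 (V2 x) = V2 (V1 x)) \<and> isometric_rep P K W \<and>
     isometric_dilation (free_product (nat_monoid \<times>\<times> nat_monoid) P) H
       (free_product_rep (nat2_rep S1 S2) T) K J (free_product_rep (nat2_rep V1 V2) W) \<and>
     nica_covariant_co_extension (free_product nat_monoid P) H
       (free_product_rep (nat_rep S1) T) K J (free_product_rep (nat_rep V1) W) \<and>
     nica_covariant_co_extension (free_product nat_monoid P) H
       (free_product_rep (nat_rep S2) T) K J (free_product_rep (nat_rep V2) W)"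
proof -
  define A where "A = (\<lambda>k. V1 (G k))"
  define B where "B = (\<lambda>k. G (V2 k))"
  interpret A: nica_free P K W A unfolding A_def by (rule commuting_isometries)
  interpret B: nica_free P K W B unfolding B_def by (rule commuting_isometries)
  have AJ: "\<And>k. k \<in> K \<Longrightarrow> adjt H J (A k) = S1 (adjt H J k)"
    unfolding A_def by (rule J_adj_V1)
  have BJ: "\<And>k. k \<in> K \<Longrightarrow> adjt H J (B k) = S2 (adjt H J k)"
    unfolding B_def by (rule J_adj_V2)
  have AB: "\<And>k. k \<in> K \<Longrightarrow> A (B k) = B (A k)"
    unfolding A_def B_def by (rule commuting_isometries)
  note K = one.K and sub = one.W.csubspace_K hilbert_space_csubspace[OF b1.H]
  note powA = funpow_intertwine[OF A.V AJ] and powB = funpow_intertwine[OF B.V BJ]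
  have commute: "(f ^^ n) ((g ^^ m) x) = (g ^^ m) ((f ^^ n) x)"
    if "\<And>x. x \<in> M \<Longrightarrow> f x \<in> M" "\<And>x. x \<in> M \<Longrightarrow> g x \<in> M" "\<And>x. x \<in> M \<Longrightarrow> f (g x) = g (f x)" "x \<in> M"
    for f g :: "'a \<Rightarrow> 'a" and M n m x
  proof -
    have gM: "(g ^^ m) y \<in> M" if "y \<in> M" for m y
      by (induction m) (use that \<open>\<And>x. x \<in> M \<Longrightarrow> g x \<in> M\<close> in auto)
    have fM: "(f ^^ m) y \<in> M" if "y \<in> M" for m y
      by (induction m) (use that \<open>\<And>x. x \<in> M \<Longrightarrow> f x \<in> M\<close> in auto)
    have 1: "f ((g ^^ m) y) = (g ^^ m) (f y)" if "y \<in> M" for y m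
      by (induction m) (use that gM \<open>\<And>x. x \<in> M \<Longrightarrow> f (g x) = g (f x)\<close> in auto)
    show ?thesis
      by (induction n) (use 1 fM \<open>x \<in> M\<close> in auto)
  qed
  \<comment> \<open>Polymorphic, since it is used on \<open>H\<close> for the given contractions and
    on \<open>K\<close> for the constructed isometries.\<close>
  have rep2: "operator_rep (nat_monoid \<times>\<times> nat_monoid) N (nat2_rep f g)"
    if f: "bounded_operator N N f" and g: "bounded_operator N N g" and N: "csubspace N"
      and fg: "\<And>x. x \<in> N \<Longrightarrow> f (g x) = g (f x)" for N :: "'a::complex_inner set" and f g
  proof -
    have pow: "bounded_operator N N (f ^^ n)" "bounded_operator N N (g ^^ n)" for n
      using operator_rep_bounded[OF b1.operator_rep_nat[OF f N], of n]
        operator_rep_bounded[OF b1.operator_rep_nat[OF g N], of n] by (simp_all add: nat_rep_def)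
    have "bounded_operator N N (\<lambda>x. (f ^^ n) ((g ^^ m) x))" for n m
      by (rule bounded_operator_comp[OF pow(2) pow(1)])
    moreover have "(f ^^ (n + n')) ((g ^^ (m + m')) x) = (f ^^ n) ((g ^^ m) ((f ^^ n') ((g ^^ m') x)))"
      if "x \<in> N" for n n' m m' x
      using commute[of N f g "(g ^^ m') x" n' m] that bounded_operator_in[OF f] bounded_operator_in[OF g]
        fg bounded_operator_in[OF pow(2) that, of m']
      by (simp add: funpow_add)
    ultimately show ?thesis
      by (auto simp: operator_rep_def nat2_rep_def DirProd_def comp_def)
  qed
  have iso2: "isometric_rep (nat_monoid \<times>\<times> nat_monoid) K (nat2_rep A B)"
    using rep2[OF linear_isometry_bounded[OF A.V] linear_isometry_bounded[OF B.V] sub(1) AB] powA powB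
    by (auto simp: isometric_rep_def linear_isometry_def operator_rep_def nat2_rep_def)
  interpret N: free_factors nat_monoid P
    by (intro free_factors.intro monoid_nat_monoid b1.monoid_axioms)
  interpret N2: free_factors "nat_monoid \<times>\<times> nat_monoid" P
    by (intro free_factors.intro DirProd_monoid monoid_nat_monoid b1.monoid_axioms)
  have "co_extension (free_product (nat_monoid \<times>\<times> nat_monoid) P) H
      (free_product_rep (nat2_rep S1 S2) T) K J (free_product_rep (nat2_rep A B) W)"
    by (rule N2.co_extension_free_product[OF b1.H K J iso2 one.isometric_W
          rep2[OF b1.S b2.S sub(2) S_comm] b1.T _ J_adj_W])
       (use powA powB in \<open>auto simp: nat2_rep_def\<close>)
  moreover have "co_extension (free_product nat_monoid P) H
      (free_product_rep (nat_rep S1) T) K J (free_product_rep (nat_rep A) W)"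
    by (rule N.co_extension_free_product[OF b1.H K J b1.isometric_rep_nat[OF A.V sub(1)] one.isometric_W
          b1.operator_rep_nat[OF b1.S sub(2)] b1.T _ J_adj_W])
       (use powA in \<open>auto simp: nat_rep_def\<close>)
  moreover have "co_extension (free_product nat_monoid P) H
      (free_product_rep (nat_rep S2) T) K J (free_product_rep (nat_rep B) W)"
    by (rule N.co_extension_free_product[OF b1.H K J b1.isometric_rep_nat[OF B.V sub(1)] one.isometric_W
          b1.operator_rep_nat[OF b2.S sub(2)] b1.T _ J_adj_W])
       (use powB in \<open>auto simp: nat_rep_def\<close>)
  ultimately show ?thesis
    using K J A.V B.V AB one.isometric_W A.nica_covariant_free_product B.nica_covariant_free_product
    unfolding nica_covariant_co_extension_def co_extension_def[of "free_product (nat_monoid \<times>\<times> nat_monoid) P"]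
    by blast
qed

end

theorem theorem3p5:
  fixes P :: "('p, 'm) monoid_scheme"
    and H :: "'h::complex_inner set"
    and T :: "'p \<Rightarrow> 'h \<Rightarrow> 'h"
    and S1 S2 :: "'h \<Rightarrow> 'h"
    and L1 :: "'k1::complex_inner set" and I1 :: "'h \<Rightarrow> 'k1"
    and U1 :: "(nat + 'p) list set \<Rightarrow> 'k1 \<Rightarrow> 'k1"
    and L2 :: "'k2::complex_inner set" and I2 :: "'h \<Rightarrow> 'k2"
    and U2 :: "(nat + 'p) list set \<Rightarrow> 'k2 \<Rightarrow> 'k2"
  assumes "right_lcm_monoid P" and "countable (carrier P)"
    and "separable_hilbert_space H"
    and "contractive_rep P H T"
    and "contraction H H S1" and "contraction H H S2"
    and "\<forall>x\<in>H. S1 (S2 x) = S2 (S1 x)"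
    and "star_regular_dilation (free_product nat_monoid P) H
           (free_product_rep (nat_rep S1) T) L1 I1 U1"
    and "star_regular_dilation (free_product nat_monoid P) H
           (free_product_rep (nat_rep S2) T) L2 I2 U2"
  shows "\<exists>(K :: ell2 set) (J :: 'h \<Rightarrow> ell2) (V1 :: ell2 \<Rightarrow> ell2) (V2 :: ell2 \<Rightarrow> ell2)
            (W :: 'p \<Rightarrow> ell2 \<Rightarrow> ell2).
           hilbert_space K \<and> linear_isometry H K J \<and>
           linear_isometry K K V1 \<and> linear_isometry K K V2 \<and>
           (\<forall>x\<in>K. V1 (V2 x) = V2 (V1 x)) \<and>
           isometric_rep P K W \<and>
           isometric_dilation (free_product (nat_monoid \<times>\<times> nat_monoid) P) H
             (free_product_rep (nat2_rep S1 S2) T) K J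
             (free_product_rep (nat2_rep V1 V2) W) \<and>
           nica_covariant_co_extension (free_product nat_monoid P) H
             (free_product_rep (nat_rep S1) T) K J
             (free_product_rep (nat_rep V1) W) \<and>
           nica_covariant_co_extension (free_product nat_monoid P) H
             (free_product_rep (nat_rep S2) T) K J
             (free_product_rep (nat_rep V2) W)"
proof -
  interpret right_lcm_monoid P by fact
  interpret i: monoid_iso "alt_monoid P" "free_product nat_monoid P" "alt_class P"
    by (rule alt_iso)
  have H: "hilbert_space H" using assms(3) by (simp add: separable_hilbert_space_def)
  note sub = hilbert_space_csubspace[OF H]
  have T: "operator_rep P H T" using assms(4) by (simp add: contractive_rep_def)
  have S: "bounded_operator H H S1" "bounded_operator H H S2"
    using assms(5,6) by (simp_all add: contraction_def)
  note cancel = right_lcm_monoid.left_cancel[OF right_lcm_alt]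
  \<comment> \<open>Regularity is moved from classes of words to alternating lists, where ideals are
    explicit.\<close>
  have r1: "star_regular_dilation (alt_monoid P) H (alt_rep T S1) L1 I1 (\<lambda>l. U1 (alt_class P l))"
    by (rule i.star_regular_transfer[OF assms(8) cancel H operator_rep_alt[OF S(1) T sub]
          alt_class_rep[OF S(1) T sub, symmetric]])
  have r2: "star_regular_dilation (alt_monoid P) H (alt_rep T S2) L2 I2 (\<lambda>l. U2 (alt_class P l))"
    by (rule i.star_regular_transfer[OF assms(9) cancel H operator_rep_alt[OF S(2) T sub]
          alt_class_rep[OF S(2) T sub, symmetric]])
  interpret free_regular_pair P H T S1 S2 L1 I1 "\<lambda>l. U1 (alt_class P l)" L2 I2 "\<lambda>l. U2 (alt_class P l)"
    by unfold_locales (use H T S r1 r2 assms(7) in auto)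
  \<comment> \<open>Separability of \<open>H\<close> and countability of \<open>P\<close> give
    countable spanning sets of the minimal spaces, which can therefore be placed in
    \<open>ell2\<close>.\<close>
  obtain N1 where N1: "countable N1" "N1 \<subseteq> b1.M" "ccspan N1 = b1.M"
    using assms(2,3) by (rule b1.countable_M)
  obtain N2 where N2: "countable N2" "N2 \<subseteq> b2.M" "ccspan N2 = b2.M"
    using assms(2,3) by (rule b2.countable_M)
  obtain \<beta>1 where "linear_isometry b1.M (UNIV :: ell2 set) \<beta>1"
    using ell2_embedding[OF b1.A.M N1(2,1)] unfolding N1(3) .
  moreover obtain \<beta>2 where "linear_isometry b2.M (UNIV :: ell2 set) \<beta>2"
    using ell2_embedding[OF b2.A.M N2(2,1)] unfolding N2(3) .
  ultimately interpret embedded_pair P H T S1 S2 L1 I1 "\<lambda>l. U1 (alt_class P l)" L2 I2 "\<lambda>l. U2 (alt_class P l)" \<beta>1 \<beta>2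
    by unfold_locales (use assms(2) in auto)
  show ?thesis by (rule dilation)
qed

end
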